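(* Let $|\Psi\rangle\in\mathcal{B}^n$ be an $M$-party stabilizer state with stabilizer group $S$, where $m=|M|\ge 3$, and let $S_{loc}=\sum_{\alpha\in M}S_{\hat\alpha}$. Then the maximal number $q$ such that $|\Psi_m^+\rangle^{\otimes q}$ is extractable from $|\Psi\rangle$ by local Clifford unitaries equals $\Delta(\Psi)=\dim(S)-\dim(S_{loc})=n-\dim(S_{loc})$.
   Context: Let $G^n\cong\mathbb{F}_2^{2n}$, with elements $f=(a_1,b_1,\dots,a_n,b_n)$; $\sigma_{00}=I,\sigma_{10}=\sigma^x,\sigma_{01}=\sigma^z,\sigma_{11}=\sigma^y$, $\sigma(f)=\sigma_{a_1b_1}\otimes\cdots\otimes\sigma_{a_nb_n}$ on $\mathcal{B}^n=(\mathbb{C}^2)^{\otimes n}$; symplectic form $\omega(f,f')=\sum_j(a_jb_j'+b_ja_j')\bmod 2$. A subspace $S$ is self-dual if $S=\{f:\omega(f,g)=0\ \forall g\in S\}$. A stabilizer state with stabilizer group $S$ (self-dual, $\dim S=n$) is the unique up-to-phase unit vector $|\Psi\rangle$ with $\sigma(f)|\Psi\rangle=\epsilon(f)|\Psi\rangle$ for all $f\in S$, for some consistent signs $\epsilon(f)\in\{\pm1\}$. The Clifford group $\mathcal{C}(n)$ consists of unitaries $U$ with $U\sigma(f)U^\dagger=\pm\sigma(u(f))$ for all $f$ for some map $u$. Multipartite setting: $M$ is a finite set of parties; party $\alpha$ holds $n_\alpha$ qubits, $n=\sum_\alpha n_\alpha$; $f_\alpha$ is the restriction of $f\in G^n$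 to party $\alpha$'s qubits; the co-local subgroup is $S_{\hat\alpha}=\{g\in S: g_\alpha=0\}$ (equal to $S$ if $n_\alpha=0$). $|\Psi_m^+\rangle=\frac{1}{\sqrt2}(|0\rangle^{\otimes m}+|1\rangle^{\otimes m})$ is the $m$-party GHZ state in which each party holds one qubit. $|\Psi_m^+\rangle^{\otimes q}$ is extractable from $|\Psi\rangle$ by local Clifford unitaries if there exist $U_\alpha\in\mathcal{C}(n_\alpha)$ acting on party $\alpha$'s qubits and an $M$-party stabilizer state $|\Psi''\rangle$ (party $\alpha$ holding $n_\alpha-q$ qubits) such that, up to global phase, $\bigotimes_\alpha U_\alpha|\Psi\rangle=|\Psi_m^+\rangle^{\otimes q}\otimes|\Psi''\rangle$, where each party holds one qubit of each GHZ copy. *)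

theory Defs
  imports Complex_Main
begin

text \<open>A register is a finite set Q of qubit labels. A computational basis vector is a
  function x :: 'q => bool vanishing outside Q. A state (vector of the Hilbert space
  (C^2)^{tensor Q}) is a function from such bit strings to complex amplitudes.\<close>

definition basis :: "'q set \<Rightarrow> ('q \<Rightarrow> bool) set" where
  "basis Q = {x. \<forall>j. j \<notin> Q \<longrightarrow> \<not> x j}"

definition restr :: "'q set \<Rightarrow> ('q \<Rightarrow> bool) \<Rightarrow> ('q \<Rightarrow> bool)" where
  "restr A x = (\<lambda>j. j \<in> A \<and> x j)"

definition is_vec :: "'q set \<Rightarrow> (('q \<Rightarrow> bool) \<Rightarrow> complex) \<Rightarrow> bool" where
  "is_vec Q \<psi> \<longleftrightarrow> (\<forall>x. x \<notin> basis Q \<longrightarrow> \<psi> x = 0)"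

definition unit_vec :: "'q set \<Rightarrow> (('q \<Rightarrow> bool) \<Rightarrow> complex) \<Rightarrow> bool" where
  "unit_vec Q \<psi> \<longleftrightarrow> is_vec Q \<psi> \<and> (\<Sum>x\<in>basis Q. (cmod (\<psi> x))^2) = 1"

text \<open>An element f = (a,b) with a_j, b_j in F_2 = bool, supported in Q.\<close>

type_synonym 'q pel = "('q \<Rightarrow> bool) \<times> ('q \<Rightarrow> bool)"

definition Gn :: "'q set \<Rightarrow> 'q pel set" where
  "Gn Q = {(a, b). \<forall>j. j \<notin> Q \<longrightarrow> \<not> a j \<and> \<not> b j}"

definition gzero :: "'q pel" where
  "gzero = (\<lambda>_. False, \<lambda>_. False)"

definition gadd :: "'q pel \<Rightarrow> 'q pel \<Rightarrow> 'q pel" where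
  "gadd f g = (\<lambda>j. fst f j \<noteq> fst g j, \<lambda>j. snd f j \<noteq> snd g j)"

definition omega :: "'q set \<Rightarrow> 'q pel \<Rightarrow> 'q pel \<Rightarrow> bool" where
  "omega Q f g \<longleftrightarrow>
     odd (card {j \<in> Q. (fst f j \<and> snd g j) \<noteq> (snd f j \<and> fst g j)})"

definition f2_subspace :: "'q set \<Rightarrow> 'q pel set \<Rightarrow> bool" where
  "f2_subspace Q S \<longleftrightarrow> S \<subseteq> Gn Q \<and> gzero \<in> S \<and> (\<forall>f\<in>S. \<forall>g\<in>S. gadd f g \<in> S)"

definition self_dual :: "'q set \<Rightarrow> 'q pel set \<Rightarrow> bool" where
  "self_dual Q S \<longleftrightarrow> f2_subspace Q S \<and> S = {f \<in> Gn Q. \<forall>g\<in>S. \<not> omega Q f g}"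

definition f2dim :: "'q pel set \<Rightarrow> nat" where
  "f2dim V = (THE d. card V = 2 ^ d)"

text \<open>Operators on the register Q are given by their matrices (kernels) indexed by basis
  vectors: K y x = <y|K|x>.\<close>

type_synonym 'q op = "('q \<Rightarrow> bool) \<Rightarrow> ('q \<Rightarrow> bool) \<Rightarrow> complex"

definition op_app :: "'q set \<Rightarrow> 'q op \<Rightarrow> (('q \<Rightarrow> bool) \<Rightarrow> complex) \<Rightarrow> (('q \<Rightarrow> bool) \<Rightarrow> complex)" where
  "op_app Q K \<psi> = (\<lambda>y. if y \<in> basis Q then (\<Sum>x\<in>basis Q. K y x * \<psi> x) else 0)"

definition op_mult :: "'q set \<Rightarrow> 'q op \<Rightarrow> 'q op \<Rightarrow> 'q op" where
  "op_mult Q K L = (\<lambda>y z. \<Sum>x\<in>basis Q. K y x * L x z)"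

definition op_adj :: "'q op \<Rightarrow> 'q op" where
  "op_adj K = (\<lambda>y x. cnj (K x y))"

definition op_id :: "'q op" where
  "op_id = (\<lambda>y x. if y = x then 1 else 0)"

definition op_eq :: "'q set \<Rightarrow> 'q op \<Rightarrow> 'q op \<Rightarrow> bool" where
  "op_eq Q K L \<longleftrightarrow> (\<forall>y\<in>basis Q. \<forall>x\<in>basis Q. K y x = L y x)"

definition unitary_op :: "'q set \<Rightarrow> 'q op \<Rightarrow> bool" where
  "unitary_op Q U \<longleftrightarrow> op_eq Q (op_mult Q (op_adj U) U) op_id \<and> op_eq Q (op_mult Q U (op_adj U)) op_id"

text \<open>Pauli operator sigma(f) = sigma_{a_1 b_1} tensor ... ; on basis vectors
  sigma_{ab} |x> = i^{ab} (-1)^{bx} |x xor a> (sigma_00 = I, sigma_10 = X, sigma_01 = Z, sigma_11 = Y).\<close>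
definition pauli :: "'q set \<Rightarrow> 'q pel \<Rightarrow> 'q op" where
  "pauli Q f = (\<lambda>y x. if y = (\<lambda>j. x j \<noteq> fst f j)
      then \<i> ^ card {j \<in> Q. fst f j \<and> snd f j} * (-1) ^ card {j \<in> Q. snd f j \<and> x j}
      else 0)"

definition clifford :: "'q set \<Rightarrow> 'q op \<Rightarrow> bool" where
  "clifford Q U \<longleftrightarrow> unitary_op Q U \<and>
     (\<forall>f\<in>Gn Q. \<exists>g\<in>Gn Q. \<exists>s\<in>{1, -1}.
        op_eq Q (op_mult Q (op_mult Q U (pauli Q f)) (op_adj U)) (\<lambda>y x. s * pauli Q g y x))"

definition stab_group :: "'q set \<Rightarrow> 'q pel set \<Rightarrow> (('q \<Rightarrow> bool) \<Rightarrow> complex) \<Rightarrow> bool" where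
  "stab_group Q S \<psi> \<longleftrightarrow> self_dual Q S \<and> f2dim S = card Q \<and> unit_vec Q \<psi> \<and>
     (\<forall>f\<in>S. \<exists>e\<in>{1, -1}. op_app Q (pauli Q f) \<psi> = (\<lambda>x. e * \<psi> x))"

definition stabilizer_state :: "'q set \<Rightarrow> (('q \<Rightarrow> bool) \<Rightarrow> complex) \<Rightarrow> bool" where
  "stabilizer_state Q \<psi> \<longleftrightarrow> (\<exists>S. stab_group Q S \<psi>)"

text \<open>Parties M, party alpha holds N alpha qubits labelled (alpha, i), i < N alpha.\<close>

definition Qpart :: "('p \<Rightarrow> nat) \<Rightarrow> 'p \<Rightarrow> ('p \<times> nat) set" where
  "Qpart N \<alpha> = {(\<alpha>, i) | i. i < N \<alpha>}"

definition Qall :: "('p \<Rightarrow> nat) \<Rightarrow> 'p set \<Rightarrow> ('p \<times> nat) set" where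
  "Qall N M = (\<Union>\<alpha>\<in>M. Qpart N \<alpha>)"

definition colocal :: "('p \<Rightarrow> nat) \<Rightarrow> ('p \<times> nat) pel set \<Rightarrow> 'p \<Rightarrow> ('p \<times> nat) pel set" where
  "colocal N S \<alpha> = {g \<in> S. \<forall>j\<in>Qpart N \<alpha>. \<not> fst g j \<and> \<not> snd g j}"

definition gsum :: "'p set \<Rightarrow> ('p \<Rightarrow> 'q pel) \<Rightarrow> 'q pel" where
  "gsum M h = (\<lambda>j. odd (card {\<alpha> \<in> M. fst (h \<alpha>) j}), \<lambda>j. odd (card {\<alpha> \<in> M. snd (h \<alpha>) j}))"

definition Sloc :: "('p \<Rightarrow> nat) \<Rightarrow> 'p set \<Rightarrow> ('p \<times> nat) pel set \<Rightarrow> ('p \<times> nat) pel set" where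
  "Sloc N M S = {gsum M h | h. \<forall>\<alpha>\<in>M. h \<alpha> \<in> colocal N S \<alpha>}"

definition local_op :: "('p \<Rightarrow> nat) \<Rightarrow> 'p set \<Rightarrow> ('p \<Rightarrow> ('p \<times> nat) op) \<Rightarrow> ('p \<times> nat) op" where
  "local_op N M U = (\<lambda>y x. \<Prod>\<alpha>\<in>M. U \<alpha> (restr (Qpart N \<alpha>) y) (restr (Qpart N \<alpha>) x))"

text \<open>The state |Psi_m^+>^{tensor q} tensor |Psi''>: GHZ copy k (k < q) consists of the qubits
  (alpha, k), alpha in M; Psi'' (party alpha holding N alpha - q qubits, labelled
  (alpha, i - q)) lives on the qubits (alpha, i) with q <= i < N alpha.\<close>
definition ghz_times :: "'p set \<Rightarrow> nat \<Rightarrow> (('p \<times> nat \<Rightarrow> bool) \<Rightarrow> complex)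
    \<Rightarrow> (('p \<times> nat \<Rightarrow> bool) \<Rightarrow> complex)" where
  "ghz_times M q \<psi>'' = (\<lambda>y.
     (if \<forall>k<q. \<forall>\<alpha>\<in>M. \<forall>\<beta>\<in>M. y (\<alpha>, k) = y (\<beta>, k) then complex_of_real ((1 / sqrt 2) ^ q) else 0)
     * \<psi>'' (\<lambda>(\<alpha>, i). y (\<alpha>, i + q)))"

definition extractable :: "('p \<Rightarrow> nat) \<Rightarrow> 'p set \<Rightarrow> (('p \<times> nat \<Rightarrow> bool) \<Rightarrow> complex) \<Rightarrow> nat \<Rightarrow> bool" where
  "extractable N M \<psi> q \<longleftrightarrow> (\<forall>\<alpha>\<in>M. q \<le> N \<alpha>) \<and>
     (\<exists>U \<psi>'' c. (\<forall>\<alpha>\<in>M. clifford (Qpart N \<alpha>) (U \<alpha>))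
        \<and> stabilizer_state (Qall (\<lambda>\<alpha>. N \<alpha> - q) M) \<psi>''
        \<and> cmod c = 1
        \<and> (\<forall>y\<in>basis (Qall N M).
              op_app (Qall N M) (local_op N M U) \<psi> y = c * ghz_times M q \<psi>'' y))"

end

theory Submission
  imports Defs "HOL-Library.FuncSet"
begin

text \<open>Write \<open>\<Delta> = dim S - dim S\<^sub>l\<^sub>o\<^sub>c\<close> and choose \<open>g\<^sub>k \<in> S\<close> completing a basis of \<open>S\<^sub>l\<^sub>o\<^sub>c\<close> together with
  dual functionals \<open>\<phi>\<^sub>k\<close> on \<open>S\<close> vanishing on \<open>S\<^sub>l\<^sub>o\<^sub>c\<close>. Since \<open>\<phi>\<^sub>k\<close> vanishes on the co-local subgroup of
  \<open>\<alpha>\<close>, it is represented by an element \<open>z\<close> supported on \<open>\<alpha>\<close> alone. Sums of these elements over two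
  parties commute with \<open>S\<close>, hence lie in \<open>S\<close>; being trivial at a third party they lie in \<open>S\<^sub>l\<^sub>o\<^sub>c\<close>, which makes
  the local \<open>z\<close>'s of a party commute. After correcting the \<open>g\<^sub>k\<close> by even combinations of the
  \<open>z\<close>'s, the restrictions of the \<open>g\<^sub>k\<close> and the \<open>z\<close>'s form hyperbolic pairs at every party. A product of
  transvections, each implemented by the Clifford operator \<open>(1 + i\<sigma>(h))/\<surd>2\<close>, moves them to the
  \<open>X\<close> and \<open>Z\<close> of the first \<open>\<Delta>\<close> qubits, and the resulting stabilizers force GHZ factors.

  Conversely, if \<open>q\<close> GHZ states are extracted, the \<open>X\<close>-components of a transformed stabilizer
  element on the GHZ qubits do not depend on the party, so they give \<open>q\<close> functionals vanishing on
  \<open>S\<^sub>l\<^sub>o\<^sub>c\<close>; they are independent because \<open>X\<^sup>\<otimes>\<^sup>m\<close> of each copy is a stabilizer.\<close>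

section \<open>Symplectic linear algebra over the two-element field\<close>

text \<open>The bound of three parties excludes a real failure: for an EPR pair S_loc is zero, so
  \<Delta> would be 2 although there is only one copy. There the local representatives of the two
  functionals are Z and X on the same qubit, which anticommute. The g_k commute globally but not
  party by party. Their commutation defects at the single parties have even total parity, and this
  evenness is exactly what makes the correcting combinations of the z's elements of S. A symplectic
  map determines the action of a Clifford operator only up to signs, so the transformed GHZ
  generators may have eigenvalue -1. One more local Pauli operator, acting as the identity on G^n,
  repairs all these signs without disturbing the group. Since \<open>f2dim\<close> is defined by
  \<open>card V = 2 ^ d\<close>, the linear algebra is carried out by counting: kernels of
  functionals have half the size, and character sums give the size of an annihilator.\<close>

text \<open>Source of bilinearity: the form \<open>omega\<close> and the sum \<open>gsum\<close> are
  both parities of cardinalities.\<close>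

lemma odd_card_xor:
  assumes "finite Q"
  shows "odd (card {j \<in> Q. P j \<noteq> R j}) \<longleftrightarrow> odd (card {j \<in> Q. P j}) \<noteq> odd (card {j \<in> Q. R j})"
  using assms
proof (induction Q)
  case (insert x F)
  have *: "card {j \<in> insert x F. T j} = card {j \<in> F. T j} + of_bool (T x)" for T
  proof -
    have "{j \<in> insert x F. T j} = (if T x then insert x {j \<in> F. T j} else {j \<in> F. T j})"
      by auto
    then show ?thesis using insert.hyps by simp
  qed
  show ?case unfolding * using insert.IH by (auto simp: of_bool_def)
qed auto

lemma gadd_simps [simp]: "fst (gadd f g) j \<longleftrightarrow> fst f j \<noteq> fst g j"
  "snd (gadd f g) j \<longleftrightarrow> snd f j \<noteq> snd g j"
  "fst gzero j \<longleftrightarrow> False" "snd gzero j \<longleftrightarrow> False"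
  by (auto simp: gadd_def gzero_def)

lemma pel_eqI: "(\<And>j. fst f j = fst g j) \<Longrightarrow> (\<And>j. snd f j = snd g j) \<Longrightarrow> f = g"
  for f g :: "'q pel"
  by (auto simp: prod_eq_iff fun_eq_iff)

lemma gadd_commute: "gadd f g = gadd g f" by (rule pel_eqI) auto

lemma gadd_zero [simp]: "gadd f gzero = f" "gadd gzero f = f" by (auto intro: pel_eqI)

lemma gadd_self [simp]: "gadd f f = gzero" "gadd f (gadd f g) = g" by (auto intro: pel_eqI)

lemma Gn_iff: "f \<in> Gn Q \<longleftrightarrow> (\<forall>j. j \<notin> Q \<longrightarrow> \<not> fst f j \<and> \<not> snd f j)"
  by (cases f) (auto simp: Gn_def)

lemma gzero_Gn [simp]: "gzero \<in> Gn Q" by (auto simp: Gn_iff)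

lemma gadd_Gn [intro]: "f \<in> Gn Q \<Longrightarrow> g \<in> Gn Q \<Longrightarrow> gadd f g \<in> Gn Q" by (auto simp: Gn_iff)

lemma omega_commute: "omega Q f g = omega Q g f"
  unfolding omega_def by (rule arg_cong[where f = "\<lambda>A. odd (card A)"]) auto

lemma omega_gadd:
  assumes "finite Q"
  shows "omega Q f (gadd g h) \<longleftrightarrow> omega Q f g \<noteq> omega Q f h"
proof -
  have "{j \<in> Q. (fst f j \<and> snd (gadd g h) j) \<noteq> (snd f j \<and> fst (gadd g h) j)}
    = {j \<in> Q. ((fst f j \<and> snd g j) \<noteq> (snd f j \<and> fst g j)) \<noteq> ((fst f j \<and> snd h j) \<noteq> (snd f j \<and> fst h j))}"
    by auto
  then show ?thesis unfolding omega_def by (simp only: odd_card_xor[OF assms, symmetric])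
qed

lemma omega_gadd':
  assumes "finite Q"
  shows "omega Q (gadd g h) f \<longleftrightarrow> omega Q g f \<noteq> omega Q h f"
  using omega_gadd[OF assms] omega_commute by metis

lemma omega_zero [simp]: "\<not> omega Q f gzero" "\<not> omega Q gzero f" by (simp_all add: omega_def)

lemma omega_self [simp]: "\<not> omega Q f f"
  by (simp add: omega_def conj_commute)

definition Xel :: "'q \<Rightarrow> 'q pel" where "Xel j = (\<lambda>i. i = j, \<lambda>_. False)"

definition Zel :: "'q \<Rightarrow> 'q pel" where "Zel j = (\<lambda>_. False, \<lambda>i. i = j)"

lemma XZ_simps [simp]: "fst (Xel j) i \<longleftrightarrow> i = j" "snd (Xel j) i \<longleftrightarrow> False"
  "fst (Zel j) i \<longleftrightarrow> False" "snd (Zel j) i \<longleftrightarrow> i = j"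
  by (auto simp: Xel_def Zel_def)

lemma XZ_Gn [simp]: "Xel j \<in> Gn Q \<longleftrightarrow> j \<in> Q" "Zel j \<in> Gn Q \<longleftrightarrow> j \<in> Q"
  by (auto simp: Gn_iff)

lemma omega_Xel: "j \<in> Q \<Longrightarrow> omega Q (Xel j) f \<longleftrightarrow> snd f j"
  and omega_Zel: "j \<in> Q \<Longrightarrow> omega Q (Zel j) f \<longleftrightarrow> fst f j"
proof -
  assume j: "j \<in> Q"
  have "{i \<in> Q. (fst (Xel j) i \<and> snd f i) \<noteq> (snd (Xel j) i \<and> fst f i)} = (if snd f j then {j} else {})"
    using j by auto
  then show "omega Q (Xel j) f \<longleftrightarrow> snd f j" by (auto simp: omega_def)
  have "{i \<in> Q. (fst (Zel j) i \<and> snd f i) \<noteq> (snd (Zel j) i \<and> fst f i)} = (if fst f j then {j} else {})"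
    using j by auto
  then show "omega Q (Zel j) f \<longleftrightarrow> fst f j" by (auto simp: omega_def)
qed

lemma omega_nondegenerate:
  assumes "f \<in> Gn Q" "f \<noteq> gzero"
  obtains j where "j \<in> Q" "fst f j \<or> snd f j" "omega Q (Xel j) f \<or> omega Q (Zel j) f"
proof -
  obtain j where j: "fst f j \<or> snd f j"
    using assms(2) pel_eqI[of f gzero] by auto
  then have "j \<in> Q" using assms(1) by (auto simp: Gn_iff)
  with j that show ?thesis by (auto simp: omega_Xel omega_Zel)
qed

lemma card_basis: "finite Q \<Longrightarrow> card (basis Q) = 2 ^ card Q" and finite_basis: "finite Q \<Longrightarrow> finite (basis Q)"
proof -
  assume Q: "finite Q"
  have "bij_betw Collect (basis Q) (Pow Q)"
    by (rule bij_betwI[where g = "\<lambda>A x. x \<in> A"]) (auto simp: basis_def)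
  then show "card (basis Q) = 2 ^ card Q" "finite (basis Q)"
    using Q by (auto simp: bij_betw_same_card card_Pow dest: bij_betw_finite)
qed

lemma Gn_eq_Times: "Gn Q = basis Q \<times> basis Q"
  by (auto simp: Gn_def basis_def)

lemma finite_Gn: "finite Q \<Longrightarrow> finite (Gn Q)"
  by (simp add: Gn_eq_Times finite_basis)

lemma card_Gn: "finite Q \<Longrightarrow> card (Gn Q) = (2 ^ card Q)\<^sup>2"
  by (simp add: Gn_eq_Times card_cartesian_product card_basis power2_eq_square)

lemma f2_subspace_Gn: "f2_subspace Q (Gn Q)"
  by (auto simp: f2_subspace_def)

text \<open>Translation by g exchanges the two fibres of \<phi>. The functional is a bare predicate
  so that it can be either a pairing \<open>omega Q f\<close> or a coordinate of a transformed
  element.\<close>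

lemma card_halve:
  assumes fin: "finite W" and add: "\<And>f g. f \<in> W \<Longrightarrow> g \<in> W \<Longrightarrow> gadd f g \<in> W"
    and phi: "\<And>f g. f \<in> W \<Longrightarrow> g \<in> W \<Longrightarrow> \<phi> (gadd f g) \<longleftrightarrow> \<phi> f \<noteq> \<phi> g"
    and g: "g \<in> W" "\<phi> g"
  shows "card W = 2 * card {w \<in> W. \<not> \<phi> w}" "card {w \<in> W. \<phi> w} = card {w \<in> W. \<not> \<phi> w}"
proof -
  have "bij_betw (gadd g) {w \<in> W. \<phi> w} {w \<in> W. \<not> \<phi> w}"
    by (rule bij_betwI[where g = "gadd g"]) (auto simp: phi g add)
  then show eq: "card {w \<in> W. \<phi> w} = card {w \<in> W. \<not> \<phi> w}" by (rule bij_betw_same_card)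
  have "W = {w \<in> W. \<not> \<phi> w} \<union> {w \<in> W. \<phi> w}" by auto
  then have "card W = card {w \<in> W. \<not> \<phi> w} + card {w \<in> W. \<phi> w}"
    using card_Un_disjoint[of "{w \<in> W. \<not> \<phi> w}" "{w \<in> W. \<phi> w}"] fin by auto
  with eq show "card W = 2 * card {w \<in> W. \<not> \<phi> w}" by simp
qed

section \<open>Symplectic complements\<close>

definition perp :: "'q set \<Rightarrow> 'q pel set \<Rightarrow> 'q pel set" where
  "perp Q V = {f \<in> Gn Q. \<forall>g\<in>V. \<not> omega Q f g}"

lemma perpD: "f \<in> perp Q V \<Longrightarrow> g \<in> V \<Longrightarrow> \<not> omega Q f g"
  by (simp add: perp_def)

lemma perp_subspace: "finite Q \<Longrightarrow> f2_subspace Q (perp Q V)"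
  by (auto simp: f2_subspace_def perp_def omega_gadd')

text \<open>Orthogonality of characters: a nontrivial sign character takes both values equally
  often, by \<open>card_halve\<close>.\<close>

lemma character_sum:
  assumes Q: "finite Q" and V: "f2_subspace Q V"
  shows "(\<Sum>g\<in>V. if omega Q f g then - 1 else (1::int)) = (if \<forall>g\<in>V. \<not> omega Q f g then int (card V) else 0)"
proof (cases "\<forall>g\<in>V. \<not> omega Q f g")
  case False
  then obtain h where h: "h \<in> V" "omega Q f h" by blast
  have fV: "finite V" using V finite_Gn[OF Q] finite_subset by (auto simp: f2_subspace_def)
  have "card {g \<in> V. omega Q f g} = card {g \<in> V. \<not> omega Q f g}"
    by (rule card_halve(2)[where \<phi> = "omega Q f", OF fV _ _ h]) (use V in \<open>auto simp: f2_subspace_def omega_gadd[OF Q]\<close>)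
  then show ?thesis using False
    unfolding if_not_P[OF False] by (simp add: sum.If_cases fV Int_def)
qed auto

text \<open>Double counting of the signs (-1)^omega(f,g) over all f in G^n and g in V. Summing over
  V first leaves |V| for each f in the annihilator; summing over G^n first leaves only g = 0, by
  nondegeneracy. This is the counting form of dim V + dim V^perp = 2n.\<close>

lemma card_perp:
  assumes Q: "finite Q" and V: "f2_subspace Q V"
  shows "card V * card (perp Q V) = card (Gn Q)"
proof -
  have fV: "finite V" using V finite_Gn[OF Q] finite_subset by (auto simp: f2_subspace_def)
  let ?c = "\<lambda>f g. if omega Q f g then - 1 else (1::int)"
  have "(\<Sum>f\<in>Gn Q. \<Sum>g\<in>V. ?c f g) = (\<Sum>f\<in>Gn Q. if f \<in> perp Q V then int (card V) else 0)"
    by (rule sum.cong[OF refl]) (simp add: character_sum[OF assms] perp_def)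
  also have "\<dots> = int (card V * card (perp Q V))"
  proof -
    have "Gn Q \<inter> perp Q V = perp Q V" by (auto simp: perp_def)
    then show ?thesis by (simp add: sum.If_cases finite_Gn[OF Q])
  qed
  finally have 1: "(\<Sum>f\<in>Gn Q. \<Sum>g\<in>V. ?c f g) = int (card V * card (perp Q V))" .
  have 2: "(\<Sum>f\<in>Gn Q. ?c f g) = (if g = gzero then int (card (Gn Q)) else 0)" if "g \<in> V" for g
  proof (cases "g = gzero")
    case False
    have "g \<in> Gn Q" using that V by (auto simp: f2_subspace_def)
    then obtain j where "j \<in> Q" "omega Q (Xel j) g \<or> omega Q (Zel j) g"
      using False omega_nondegenerate by blast
    then have *: "(\<forall>f\<in>Gn Q. \<not> omega Q g f) = False"
      using XZ_Gn omega_commute by metis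
    show ?thesis
      using character_sum[OF Q f2_subspace_Gn, of g, unfolded *] False
      by (simp add: omega_commute[of Q _ g])
  qed simp
  have "(\<Sum>f\<in>Gn Q. \<Sum>g\<in>V. ?c f g) = (\<Sum>g\<in>V. \<Sum>f\<in>Gn Q. ?c f g)" by (rule sum.swap)
  also have "\<dots> = (\<Sum>g\<in>V. if g = gzero then int (card (Gn Q)) else 0)"
    by (rule sum.cong[OF refl 2])
  also have "\<dots> = int (card (Gn Q))" using V fV by (auto simp: f2_subspace_def)
  finally show ?thesis using 1 by linarith
qed

text \<open>One inclusion is symmetry of the form; two applications of \<open>card_perp\<close> show
  that the sizes agree.\<close>

lemma perp_perp:
  assumes Q: "finite Q" and V: "f2_subspace Q V"
  shows "perp Q (perp Q V) = V"
proof -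
  have fin: "finite (perp Q W)" for W
    by (rule finite_subset[OF _ finite_Gn[OF Q]]) (auto simp: perp_def)
  have "card V * card (perp Q V) = card (perp Q V) * card (perp Q (perp Q V))"
    using card_perp[OF Q V] card_perp[OF Q perp_subspace[OF Q]] by metis
  moreover have "card (perp Q V) \<noteq> 0"
    using perp_subspace[OF Q, of V] fin[of V] by (auto simp: f2_subspace_def)
  ultimately have "card V = card (perp Q (perp Q V))" by simp
  moreover have "V \<subseteq> perp Q (perp Q V)"
    using V by (auto simp: perp_def f2_subspace_def omega_commute)
  ultimately show ?thesis using card_subset_eq[OF fin] by metis
qed

lemma self_dual_perp: "self_dual Q S \<longleftrightarrow> f2_subspace Q S \<and> perp Q S = S"
  by (auto simp: self_dual_def perp_def)

lemma card_self_dual: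
  assumes "finite Q" "self_dual Q S" shows "card S = 2 ^ card Q"
proof -
  have "card S * card S = (2 ^ card Q)\<^sup>2"
    using assms card_perp[of Q S] card_Gn[of Q] by (simp add: self_dual_perp)
  then show ?thesis by (metis power2_eq_square power2_eq_iff_nonneg zero_le)
qed

lemma f2dim_eqI: "card V = 2 ^ d \<Longrightarrow> f2dim V = d"
  unfolding f2dim_def by (rule the_equality) auto

lemma f2_sum_space:
  assumes V: "f2_subspace Q V" and W: "f2_subspace Q W"
  shows "f2_subspace Q {gadd f g | f g. f \<in> V \<and> g \<in> W}" (is "f2_subspace Q ?U")
  unfolding f2_subspace_def
proof (intro conjI ballI)
  show "?U \<subseteq> Gn Q" using V W gadd_Gn by (fastforce simp: f2_subspace_def)
  have "gadd gzero gzero \<in> ?U" using V W unfolding f2_subspace_def by blast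
  then show "gzero \<in> ?U" by simp
next
  fix u u' assume "u \<in> ?U" "u' \<in> ?U"
  then obtain f g f' g' where *: "u = gadd f g" "u' = gadd f' g'" "f \<in> V" "f' \<in> V" "g \<in> W" "g' \<in> W"
    by blast
  have "gadd u u' = gadd (gadd f f') (gadd g g')"
    unfolding * by (rule pel_eqI) auto
  then show "gadd u u' \<in> ?U" using * V W unfolding f2_subspace_def by blast
qed

section \<open>Linear combinations and relative bases\<close>

primrec gcomb :: "nat \<Rightarrow> (nat \<Rightarrow> 'q pel) \<Rightarrow> (nat \<Rightarrow> bool) \<Rightarrow> 'q pel" where
  "gcomb 0 g c = gzero"
| "gcomb (Suc n) g c = gadd (gcomb n g c) (if c n then g n else gzero)"

lemma gcomb_mem: "f2_subspace Q V \<Longrightarrow> \<forall>k<n. c k \<longrightarrow> g k \<in> V \<Longrightarrow> gcomb n g c \<in> V"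
  by (induction n) (auto simp: f2_subspace_def)

text \<open>Pairing with a dual vector extracts one coefficient. With l at least n the hypothesis
  says that all relevant pairings vanish, and so does the conclusion; the lemma is also used in this
  form.\<close>

lemma omega_gcomb:
  assumes "finite Q" "\<forall>k<n. c k \<longrightarrow> omega Q f (z k) = (k = l)"
  shows "omega Q f (gcomb n z c) \<longleftrightarrow> l < n \<and> c l"
  using assms(2) by (induction n) (auto simp: omega_gadd[OF assms(1)] less_Suc_eq)

text \<open>The vectors \<open>y k\<close> represent, through \<open>omega\<close>, the functionals dual to the \<open>g k\<close>.\<close>

lemma relative_basis:
  assumes Q: "finite Q" and V: "f2_subspace Q V" and W: "f2_subspace Q W" and VW: "V \<subseteq> W"
  shows "\<exists>d g y. card W = 2 ^ d * card V \<and> (\<forall>k<d. g k \<in> W \<and> y k \<in> perp Q V)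
    \<and> (\<forall>k<d. \<forall>l<d. omega Q (y k) (g l) = (k = l))"
  using W VW
proof (induction "card W" arbitrary: W rule: less_induct)
  case less
  have fW: "finite W" using less.prems finite_Gn[OF Q] finite_subset by (auto simp: f2_subspace_def)
  show ?case
  proof (cases "V = W")
    case True
    then show ?thesis by (intro exI[of _ 0]) auto
  next
    case False
    then obtain h where h: "h \<in> W" "h \<notin> V" using less.prems by blast
    \<comment> \<open>By the double annihilator, an h outside V is detected by some y orthogonal to
      V; this y becomes the new dual vector.\<close>
    then have "h \<notin> perp Q (perp Q V)" "h \<in> Gn Q"
      using perp_perp[OF Q V] less.prems by (auto simp: f2_subspace_def)
    then obtain y where y: "y \<in> perp Q V" "omega Q y h"
      by (auto simp: perp_def omega_commute[of Q h])
    define W0 where "W0 = {w \<in> W. \<not> omega Q y w}"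
    have W0: "f2_subspace Q W0"
      using less.prems by (auto simp: f2_subspace_def W0_def omega_gadd[OF Q])
    have cW: "card W = 2 * card W0"
      unfolding W0_def
      by (rule card_halve(1)[where \<phi> = "omega Q y", OF fW _ _ h(1) y(2)])
        (use less.prems in \<open>auto simp: f2_subspace_def omega_gadd[OF Q]\<close>)
    have VW0: "V \<subseteq> W0" using less.prems y by (auto simp: W0_def perp_def)
    have "card W0 < card W"
      by (rule psubset_card_mono[OF fW]) (use h y in \<open>auto simp: W0_def\<close>)
    from less.hyps[OF this W0 VW0] obtain d g z where
      d: "card W0 = 2 ^ d * card V" and gz: "\<forall>k<d. g k \<in> W0 \<and> z k \<in> perp Q V"
      and dual: "\<forall>k<d. \<forall>l<d. omega Q (z k) (g l) = (k = l)"
      by (elim exE conjE)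
    \<comment> \<open>Removing from h its coefficients along the older g's makes the older dual
      vectors vanish on h'. The new y vanishes on W0, hence on the older g's and on the correction
      itself.\<close>
    define h' where "h' = gadd h (gcomb d g (\<lambda>k. omega Q (z k) h))"
    have c0: "gcomb d g (\<lambda>k. omega Q (z k) h) \<in> W0"
      using gcomb_mem[OF W0] gz by blast
    have zh: "\<not> omega Q (z k) h'" if "k < d" for k
    proof -
      have "omega Q (z k) (gcomb d g (\<lambda>k. omega Q (z k) h)) \<longleftrightarrow> k < d \<and> omega Q (z k) h"
        by (rule omega_gcomb[OF Q]) (use dual that in auto)
      with that show ?thesis by (simp add: h'_def omega_gadd[OF Q])
    qed
    have yh: "omega Q y h'" using y c0 by (simp add: h'_def omega_gadd[OF Q] W0_def)
    have hW: "h' \<in> W" using h c0 less.prems by (auto simp: h'_def f2_subspace_def W0_def)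
    have gW: "g k \<in> W" "\<not> omega Q y (g k)" if "k < d" for k
      using gz that by (auto simp: W0_def)
    show ?thesis
    proof (intro exI conjI)
      show "card W = 2 ^ Suc d * card V" using cW d by simp
      show "\<forall>k<Suc d. (g(d := h')) k \<in> W \<and> (z(d := y)) k \<in> perp Q V"
        using gW gz hW y by (simp add: less_Suc_eq)
      show "\<forall>k<Suc d. \<forall>l<Suc d. omega Q ((z(d := y)) k) ((g(d := h')) l) = (k = l)"
        using gW dual zh yh by (simp add: less_Suc_eq)
    qed
  qed
qed

text \<open>A basis relative to the zero subspace exhibits the power of two that the definite
  description in \<open>f2dim\<close> asks for.\<close>

lemma card_f2_subspace:
  assumes Q: "finite Q" and V: "f2_subspace Q V"
  shows "card V = 2 ^ f2dim V"
proof -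
  have "f2_subspace Q {gzero}" "{gzero} \<subseteq> V" using V by (auto simp: f2_subspace_def)
  from relative_basis[OF Q this(1) V this(2)] obtain d where "card V = 2 ^ d" by auto
  then show ?thesis using f2dim_eqI by metis
qed

section \<open>Operators on a register\<close>

text \<open>\<open>op_app\<close> ignores a vector off \<open>basis Q\<close> and returns zero
  there, so the identity operator acts as this truncation and not as the identity function.\<close>

definition trunc :: "'q set \<Rightarrow> (('q \<Rightarrow> bool) \<Rightarrow> complex) \<Rightarrow> ('q \<Rightarrow> bool) \<Rightarrow> complex" where
  "trunc Q \<psi> = (\<lambda>y. if y \<in> basis Q then \<psi> y else 0)"

lemma is_vec_trunc: "is_vec Q \<psi> \<longleftrightarrow> trunc Q \<psi> = \<psi>"
  by (auto simp: is_vec_def trunc_def fun_eq_iff)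

lemma is_vec_op_app [simp]: "is_vec Q (op_app Q K \<psi>)"
  by (auto simp: is_vec_def op_app_def)

lemma trunc_op_app [simp]: "trunc Q (op_app Q K \<psi>) = op_app Q K \<psi>"
  using is_vec_op_app is_vec_trunc by blast

lemma op_app_trunc [simp]: "op_app Q K (trunc Q \<psi>) = op_app Q K \<psi>"
  by (auto simp: op_app_def trunc_def fun_eq_iff intro!: sum.cong)

lemma op_app_smult: "op_app Q K (\<lambda>y. c * \<psi> y) = (\<lambda>y. c * op_app Q K \<psi> y)"
  by (auto simp: op_app_def fun_eq_iff sum_distrib_left algebra_simps)

lemma op_app_add: "op_app Q K (\<lambda>y. \<psi> y + \<chi> y) = (\<lambda>y. op_app Q K \<psi> y + op_app Q K \<chi> y)"
  by (auto simp: op_app_def fun_eq_iff sum.distrib algebra_simps)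

lemma op_app_smult_kernel: "op_app Q (\<lambda>y x. c * K y x) \<psi> = (\<lambda>y. c * op_app Q K \<psi> y)"
  by (auto simp: op_app_def fun_eq_iff sum_distrib_left algebra_simps)

lemma op_app_add_kernel: "op_app Q (\<lambda>y x. K y x + L y x) \<psi> = (\<lambda>y. op_app Q K \<psi> y + op_app Q L \<psi> y)"
  by (auto simp: op_app_def fun_eq_iff sum.distrib algebra_simps)

lemma op_app_zero [simp]: "op_app Q K (\<lambda>_. 0) = (\<lambda>_. 0)"
  by (rule ext) (simp add: op_app_def)

lemma op_app_id [simp]: "finite Q \<Longrightarrow> op_app Q op_id \<psi> = trunc Q \<psi>"
  by (rule ext) (simp add: op_app_def op_id_def trunc_def finite_basis if_distrib[of "\<lambda>c. c * _"] cong: if_cong)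

lemma op_app_mult: "finite Q \<Longrightarrow> op_app Q (op_mult Q K L) \<psi> = op_app Q K (op_app Q L \<psi>)"
proof -
  assume "finite Q"
  have "(\<Sum>x\<in>basis Q. (\<Sum>z\<in>basis Q. K y z * L z x) * \<psi> x)
      = (\<Sum>z\<in>basis Q. K y z * (\<Sum>x\<in>basis Q. L z x * \<psi> x))" for y
    by (simp add: sum_distrib_left sum_distrib_right mult.assoc) (rule sum.swap)
  then show ?thesis by (auto simp: op_app_def op_mult_def fun_eq_iff)
qed

text \<open>The indicator of a single bit string extracts a column of the kernel. Unitarity and
  Clifford conditions can thus be treated as rewrite rules for \<open>op_app\<close>.\<close>

lemma op_eq_iff:
  assumes "finite Q"
  shows "op_eq Q K L \<longleftrightarrow> (\<forall>\<psi>. op_app Q K \<psi> = op_app Q L \<psi>)"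
proof
  assume "op_eq Q K L"
  then show "\<forall>\<psi>. op_app Q K \<psi> = op_app Q L \<psi>"
    by (auto simp: op_eq_def op_app_def fun_eq_iff intro!: sum.cong)
next
  assume *: "\<forall>\<psi>. op_app Q K \<psi> = op_app Q L \<psi>"
  have col: "op_app Q K (\<lambda>z. if z = x then 1 else 0) y = K y x" if "y \<in> basis Q" "x \<in> basis Q" for K x y
    using that by (simp add: op_app_def finite_basis[OF assms] if_distrib cong: if_cong)
  show "op_eq Q K L"
    unfolding op_eq_def using * col by metis
qed

lemma unitary_op_iff:
  assumes "finite Q"
  shows "unitary_op Q U \<longleftrightarrow> (\<forall>\<psi>. op_app Q (op_adj U) (op_app Q U \<psi>) = trunc Q \<psi>)
    \<and> (\<forall>\<psi>. op_app Q U (op_app Q (op_adj U) \<psi>) = trunc Q \<psi>)"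
  using assms by (simp add: unitary_op_def op_eq_iff op_app_mult)

lemma op_adj_inner:
  assumes "finite Q"
  shows "(\<Sum>y\<in>basis Q. cnj (op_app Q U \<phi> y) * \<chi> y) = (\<Sum>x\<in>basis Q. cnj (\<phi> x) * op_app Q (op_adj U) \<chi> x)"
proof -
  have "(\<Sum>y\<in>basis Q. cnj (op_app Q U \<phi> y) * \<chi> y)
      = (\<Sum>y\<in>basis Q. \<Sum>x\<in>basis Q. cnj (U y x) * cnj (\<phi> x) * \<chi> y)"
    by (rule sum.cong) (auto simp: op_app_def sum_distrib_right)
  also have "\<dots> = (\<Sum>x\<in>basis Q. \<Sum>y\<in>basis Q. cnj (U y x) * cnj (\<phi> x) * \<chi> y)"
    by (rule sum.swap)
  also have "\<dots> = (\<Sum>x\<in>basis Q. cnj (\<phi> x) * op_app Q (op_adj U) \<chi> x)"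
    by (rule sum.cong) (auto simp: op_app_def op_adj_def sum_distrib_left algebra_simps)
  finally show ?thesis .
qed

lemma unitary_norm:
  assumes "finite Q" "unitary_op Q U"
  shows "(\<Sum>x\<in>basis Q. (cmod (op_app Q U \<psi> x))\<^sup>2) = (\<Sum>x\<in>basis Q. (cmod (\<psi> x))\<^sup>2)"
proof -
  have "complex_of_real (\<Sum>x\<in>basis Q. (cmod (op_app Q U \<psi> x))\<^sup>2)
      = (\<Sum>x\<in>basis Q. cnj (op_app Q U \<psi> x) * op_app Q U \<psi> x)"
    by (simp add: complex_norm_square mult.commute del: of_real_power)
  also have "\<dots> = (\<Sum>x\<in>basis Q. cnj (\<psi> x) * trunc Q \<psi> x)"
    using assms by (simp add: op_adj_inner unitary_op_iff)
  also have "\<dots> = complex_of_real (\<Sum>x\<in>basis Q. (cmod (\<psi> x))\<^sup>2)"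
    by (simp add: complex_norm_square mult.commute trunc_def del: of_real_power)
  finally show ?thesis using of_real_eq_iff by blast
qed

section \<open>Pauli operators\<close>

text \<open>The one-qubit factor i^(ab) (-1)^(bx) of a Pauli operator. Products of such factors
  reduce operator identities to finite checks on booleans, qubit by qubit.\<close>

definition phase1 :: "bool \<Rightarrow> bool \<Rightarrow> bool \<Rightarrow> complex" where
  "phase1 a b x = (if a \<and> b then \<i> else 1) * (if b \<and> x then - 1 else 1)"

text \<open>The scalar relating the product of two one-qubit Pauli operators to the operator of the
  sum, computed on the zero state. The conjugate serves as inverse of a phase of modulus
  one.\<close>

definition cocycle1 :: "bool \<Rightarrow> bool \<Rightarrow> bool \<Rightarrow> bool \<Rightarrow> complex" where
  "cocycle1 a b a' b' = phase1 a b a' * phase1 a' b' False * cnj (phase1 (a \<noteq> a') (b \<noteq> b') False)"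

definition cocycle :: "'q set \<Rightarrow> 'q pel \<Rightarrow> 'q pel \<Rightarrow> complex" where
  "cocycle Q f g = (\<Prod>j\<in>Q. cocycle1 (fst f j) (snd f j) (fst g j) (snd g j))"

definition flip :: "'q pel \<Rightarrow> ('q \<Rightarrow> bool) \<Rightarrow> 'q \<Rightarrow> bool" where
  "flip f x = (\<lambda>j. x j \<noteq> fst f j)"

lemma flip_flip [simp]: "flip f (flip f x) = x" by (auto simp: flip_def)

lemma flip_gadd: "flip g (flip f x) = flip (gadd f g) x" by (auto simp: flip_def gadd_def)

lemma flip_basis: "f \<in> Gn Q \<Longrightarrow> flip f x \<in> basis Q \<longleftrightarrow> x \<in> basis Q"
  by (auto simp: flip_def basis_def Gn_iff)

lemma prod_if_card: "finite Q \<Longrightarrow> (\<Prod>j\<in>Q. if P j then c else 1) = c ^ card {j \<in> Q. P j}"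
  for c :: "'a :: comm_monoid_mult"
  by (simp add: prod.If_cases Int_def)

lemma pauli_prod:
  "finite Q \<Longrightarrow> pauli Q f y x = (if y = flip f x then \<Prod>j\<in>Q. phase1 (fst f j) (snd f j) (x j) else 0)"
  by (simp add: pauli_def flip_def phase1_def prod.distrib prod_if_card)

lemma pauli_app:
  assumes "finite Q" "f \<in> Gn Q"
  shows "op_app Q (pauli Q f) \<psi> y = (if y \<in> basis Q then
    (\<Prod>j\<in>Q. phase1 (fst f j) (snd f j) (flip f y j)) * \<psi> (flip f y) else 0)"
proof -
  let ?c = "\<lambda>x. \<Prod>j\<in>Q. phase1 (fst f j) (snd f j) (x j)"
  have "pauli Q f y x * \<psi> x = (if x = flip f y then ?c x * \<psi> x else 0)" for x
    using flip_flip[of f] by (auto simp: pauli_prod[OF assms(1)])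
  then show ?thesis
    by (simp add: op_app_def flip_basis[OF assms(2)] finite_basis[OF assms(1)])
qed

lemma sign_omega:
  "finite Q \<Longrightarrow> (if omega Q f g then - 1 else 1 :: complex) =
     (\<Prod>j\<in>Q. if (fst f j \<and> snd g j) \<noteq> (snd f j \<and> fst g j) then - 1 else 1)"
  by (simp add: prod_if_card omega_def)

lemma cocycle_swap:
  "finite Q \<Longrightarrow> cocycle Q f g = (if omega Q f g then - 1 else 1) * cocycle Q g f"
  unfolding sign_omega cocycle_def prod.distrib[symmetric]
  by (rule prod.cong) (auto simp: cocycle1_def phase1_def)

lemma cocycle1_square:
  "cocycle1 a b a' b' * cocycle1 a b a' b' = (if (a \<and> b') \<noteq> (b \<and> a') then - 1 else 1)"
  by (cases a; cases b; cases a'; cases b'; simp add: cocycle1_def phase1_def)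

text \<open>A product of two Hermitian Pauli operators is Hermitian or anti-Hermitian according to
  whether they commute, so its phase is a sign or \<i> times a sign. The second case supplies the
  sign in \<open>pauli_map_transvection\<close>.\<close>

lemma cocycle_square: "finite Q \<Longrightarrow> cocycle Q f g * cocycle Q f g = (if omega Q f g then - 1 else 1)"
  by (simp only: sign_omega cocycle_def prod.distrib[symmetric] cocycle1_square)

lemma cocycle_self: "cocycle Q f f = 1"
  unfolding cocycle_def by (rule prod.neutral) (auto simp: cocycle1_def phase1_def)

lemma cocycle_nonzero: "finite Q \<Longrightarrow> cocycle Q f g \<noteq> 0"
  using cocycle_square[of Q f g] by (auto split: if_splits)

text \<open>On each qubit both sides depend on the input bit through the same sign, so the quotient
  of the phases is the constant \<open>cocycle1\<close>.\<close>

lemma pauli_mult: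
  assumes Q: "finite Q" and f: "f \<in> Gn Q" and g: "g \<in> Gn Q"
  shows "op_app Q (pauli Q f) (op_app Q (pauli Q g) \<psi>) = (\<lambda>y. cocycle Q f g * op_app Q (pauli Q (gadd f g)) \<psi> y)"
proof
  fix y
  have "(\<Prod>j\<in>Q. phase1 (fst f j) (snd f j) (flip f y j)) * (\<Prod>j\<in>Q. phase1 (fst g j) (snd g j) (flip g (flip f y) j))
    = cocycle Q f g * (\<Prod>j\<in>Q. phase1 (fst (gadd f g) j) (snd (gadd f g) j) (flip g (flip f y) j))"
    unfolding cocycle_def prod.distrib[symmetric]
    by (rule prod.cong) (auto simp: cocycle1_def phase1_def flip_def)
  then show "op_app Q (pauli Q f) (op_app Q (pauli Q g) \<psi>) y = cocycle Q f g * op_app Q (pauli Q (gadd f g)) \<psi> y"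
    using f g gadd_Gn[OF f g]
    by (simp add: pauli_app[OF Q] flip_basis flip_gadd flip: mult.assoc)
qed

lemma pauli_zero:
  assumes "finite Q" shows "op_app Q (pauli Q gzero) \<psi> = trunc Q \<psi>"
proof -
  have *: "flip gzero x = x" for x :: "'a \<Rightarrow> bool" by (simp add: flip_def)
  show ?thesis by (rule ext) (simp add: pauli_app[OF assms gzero_Gn] trunc_def phase1_def *)
qed

lemma pauli_pauli:
  "finite Q \<Longrightarrow> f \<in> Gn Q \<Longrightarrow> op_app Q (pauli Q f) (op_app Q (pauli Q f) \<psi>) = trunc Q \<psi>"
  by (simp add: pauli_mult cocycle_self pauli_zero)

lemma pauli_commute:
  assumes "finite Q" "f \<in> Gn Q" "g \<in> Gn Q"
  shows "op_app Q (pauli Q f) (op_app Q (pauli Q g) \<psi>)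
    = (\<lambda>y. (if omega Q f g then - 1 else 1) * op_app Q (pauli Q g) (op_app Q (pauli Q f) \<psi>) y)"
  using assms by (simp add: pauli_mult cocycle_swap[of Q f g] gadd_commute[of f])

lemma pauli_adj:
  assumes "finite Q" "f \<in> Gn Q" shows "op_adj (pauli Q f) = pauli Q f"
proof -
  have *: "cnj (phase1 a b x) = phase1 a b (x \<noteq> a)" for a b x by (auto simp: phase1_def)
  have "cnj (pauli Q f x y) = pauli Q f y x" for x y
  proof (cases "x = flip f y")
    case True
    then have "x j = (y j \<noteq> fst f j)" for j by (simp add: flip_def)
    with True show ?thesis by (simp add: pauli_prod[OF assms(1)] *)
  next
    case False
    then have "y \<noteq> flip f x" by (metis flip_flip)
    with False show ?thesis by (simp add: pauli_prod[OF assms(1)])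
  qed
  then show ?thesis by (simp add: op_adj_def)
qed

lemma pauli_inj0: "finite Q \<Longrightarrow> f \<in> Gn Q \<Longrightarrow> op_app Q (pauli Q f) \<psi> = (\<lambda>_. 0) \<Longrightarrow> trunc Q \<psi> = (\<lambda>_. 0)"
  using pauli_pauli[of Q f \<psi>] by simp

text \<open>If f and g differ, some h anticommutes with exactly one of them. Moving its operator
  past the two proportional operators produces different signs, so they vanish, which contradicts
  invertibility.\<close>

lemma pauli_inj:
  assumes Q: "finite Q" and f: "f \<in> Gn Q" and g: "g \<in> Gn Q"
    and eq: "\<And>\<psi>. op_app Q (pauli Q f) \<psi> = (\<lambda>y. c * op_app Q (pauli Q g) \<psi> y)"
  shows "f = g"
proof (rule ccontr)
  assume "f \<noteq> g"
  then have "gadd f g \<noteq> gzero" by (metis gadd_self(2) gadd_zero(1))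
  then obtain h where h: "h \<in> Gn Q" "omega Q h (gadd f g)"
    using omega_nondegenerate[of "gadd f g" Q] f g XZ_Gn by (metis gadd_Gn)
  let ?P = "\<lambda>f \<psi>. op_app Q (pauli Q f) \<psi>" and ?s = "\<lambda>f. if omega Q f h then - 1 else 1 :: complex"
  have s: "?s f \<noteq> ?s g" using h by (auto simp: omega_gadd[OF Q] omega_commute[of Q h])
  have z: "trunc Q \<psi> = (\<lambda>_. 0)" for \<psi>
  proof -
    have 1: "?P f (?P h \<psi>) = (\<lambda>y. ?s f * ?P h (?P f \<psi>) y)"
      by (rule pauli_commute[OF Q f h(1)])
    have "?P f (?P h \<psi>) = (\<lambda>y. c * (?s g * ?P h (?P g \<psi>) y))"
      unfolding eq pauli_commute[OF Q g h(1)] ..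
    also have "\<dots> = (\<lambda>y. ?s g * ?P h (?P f \<psi>) y)"
      unfolding eq op_app_smult by (simp add: fun_eq_iff)
    finally have "?P h (?P f \<psi>) = (\<lambda>_. 0)"
      using 1 s by (auto simp: fun_eq_iff split: if_splits)
    then show ?thesis using pauli_inj0[OF Q h(1), of "?P f \<psi>"] pauli_inj0[OF Q f] by simp
  qed
  have "(\<lambda>_. False) \<in> basis Q" by (simp add: basis_def)
  then show False using fun_cong[OF z[of "\<lambda>_. 1"], of "\<lambda>_. False"] by (simp add: trunc_def)
qed

section \<open>Clifford operators\<close>

text \<open>The conjugation rule is written as an intertwining relation on vectors: this form avoids
  the adjoint and composes by rewriting. Values of u matter on \<open>Gn Q\<close> only.\<close>

definition pauli_map :: "'q set \<Rightarrow> 'q op \<Rightarrow> ('q pel \<Rightarrow> 'q pel) \<Rightarrow> bool" where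
  "pauli_map Q U u \<longleftrightarrow> (\<forall>f\<in>Gn Q. u f \<in> Gn Q \<and> (\<exists>s\<in>{1, -1}. \<forall>\<psi>.
     op_app Q U (op_app Q (pauli Q f) \<psi>) = (\<lambda>y. s * op_app Q (pauli Q (u f)) (op_app Q U \<psi>) y)))"

definition symplectic_map :: "'q set \<Rightarrow> ('q pel \<Rightarrow> 'q pel) \<Rightarrow> bool" where
  "symplectic_map Q u \<longleftrightarrow> (\<forall>f\<in>Gn Q. u f \<in> Gn Q) \<and>
     (\<forall>f\<in>Gn Q. \<forall>g\<in>Gn Q. u (gadd f g) = gadd (u f) (u g) \<and> omega Q (u f) (u g) = omega Q f g)"

text \<open>Substituting U \<psi> for the vector trades conjugation for intertwining, and UU^dagger
  = 1 gives the way back. Bounded choice then collects the images of single elements into one map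
  u.\<close>

lemma clifford_iff:
  assumes Q: "finite Q"
  shows "clifford Q U \<longleftrightarrow> unitary_op Q U \<and> (\<exists>u. pauli_map Q U u)"
proof -
  have *: "(\<forall>\<psi>. op_app Q U (op_app Q (pauli Q f) (op_app Q (op_adj U) \<psi>)) = (\<lambda>y. s * op_app Q (pauli Q g) \<psi> y))
     \<longleftrightarrow> (\<forall>\<psi>. op_app Q U (op_app Q (pauli Q f) \<psi>) = (\<lambda>y. s * op_app Q (pauli Q g) (op_app Q U \<psi>) y))"
    if U: "unitary_op Q U" for f g s
  proof (intro iffI allI)
    fix \<psi>
    assume *: "\<forall>\<psi>. op_app Q U (op_app Q (pauli Q f) (op_app Q (op_adj U) \<psi>)) = (\<lambda>y. s * op_app Q (pauli Q g) \<psi> y)"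
    show "op_app Q U (op_app Q (pauli Q f) \<psi>) = (\<lambda>y. s * op_app Q (pauli Q g) (op_app Q U \<psi>) y)"
      using *[rule_format, of "op_app Q U \<psi>"] U[unfolded unitary_op_iff[OF Q]] by simp
  next
    fix \<psi>
    assume *: "\<forall>\<psi>. op_app Q U (op_app Q (pauli Q f) \<psi>) = (\<lambda>y. s * op_app Q (pauli Q g) (op_app Q U \<psi>) y)"
    show "op_app Q U (op_app Q (pauli Q f) (op_app Q (op_adj U) \<psi>)) = (\<lambda>y. s * op_app Q (pauli Q g) \<psi> y)"
      using * U[unfolded unitary_op_iff[OF Q]] by simp
  qed
  have "clifford Q U \<longleftrightarrow> unitary_op Q U \<and> (\<forall>f\<in>Gn Q. \<exists>g\<in>Gn Q. \<exists>s\<in>{1, -1}. \<forall>\<psi>.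
     op_app Q U (op_app Q (pauli Q f) \<psi>) = (\<lambda>y. s * op_app Q (pauli Q g) (op_app Q U \<psi>) y))"
    unfolding clifford_def op_eq_iff[OF Q] op_app_mult[OF Q] op_app_smult_kernel
    by (rule conj_cong[OF refl]) (simp only: *)
  also have "\<dots> \<longleftrightarrow> unitary_op Q U \<and> (\<exists>u. pauli_map Q U u)"
    unfolding pauli_map_def Bex_def[of "Gn Q"]
    by (rule conj_cong[OF refl], rule bchoice_iff)
  finally show ?thesis .
qed

lemma unitary_inj0:
  "finite Q \<Longrightarrow> unitary_op Q U \<Longrightarrow> op_app Q U \<psi> = (\<lambda>_. 0) \<Longrightarrow> trunc Q \<psi> = (\<lambda>_. 0)"
  by (metis unitary_op_iff op_app_zero)

lemma pauli_mapD:
  assumes "pauli_map Q U u" "f \<in> Gn Q"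
  obtains s where "s \<noteq> 0"
    "\<And>\<psi>. op_app Q U (op_app Q (pauli Q f) \<psi>) = (\<lambda>y. s * op_app Q (pauli Q (u f)) (op_app Q U \<psi>) y)"
    and "s \<in> {1, -1}"
proof -
  from assms obtain s where "s \<in> {1, -1}"
    "\<forall>\<psi>. op_app Q U (op_app Q (pauli Q f) \<psi>) = (\<lambda>y. s * op_app Q (pauli Q (u f)) (op_app Q U \<psi>) y)"
    unfolding pauli_map_def by blast
  then show ?thesis by (intro that) auto
qed

text \<open>The image of a product of two Pauli operators can be computed before or after
  multiplying; since Pauli operators are determined by their rays (\<open>pauli_inj\<close>), u is
  additive. Commutation signs survive conjugation, so u preserves the form.\<close>

lemma pauli_map_symplectic:
  assumes Q: "finite Q" and U: "unitary_op Q U" and u: "pauli_map Q U u"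
  shows "symplectic_map Q u"
proof -
  let ?P = "\<lambda>f \<psi>. op_app Q (pauli Q f) \<psi>" and ?U = "op_app Q U"
  have mem: "u f \<in> Gn Q" if "f \<in> Gn Q" for f using u that by (simp add: pauli_map_def)
  have "u (gadd f g) = gadd (u f) (u g) \<and> omega Q (u f) (u g) = omega Q f g"
    if f: "f \<in> Gn Q" and g: "g \<in> Gn Q" for f g
  proof
  obtain s where s: "s \<noteq> 0" "\<And>\<psi>. ?U (?P f \<psi>) = (\<lambda>y. s * ?P (u f) (?U \<psi>) y)" and "s \<in> {1, -1}"
    using pauli_mapD[OF u f] by blast
  obtain t where t: "t \<noteq> 0" "\<And>\<psi>. ?U (?P g \<psi>) = (\<lambda>y. t * ?P (u g) (?U \<psi>) y)" and "t \<in> {1, -1}"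
    using pauli_mapD[OF u g] by blast
  obtain r where r: "r \<noteq> 0" "\<And>\<psi>. ?U (?P (gadd f g) \<psi>) = (\<lambda>y. r * ?P (u (gadd f g)) (?U \<psi>) y)" and "r \<in> {1, -1}"
    using pauli_mapD[OF u gadd_Gn[OF f g]] by blast
  let ?c = "cocycle Q f g" and ?c' = "cocycle Q (u f) (u g)"
  have fg: "?U (?P f (?P g \<psi>)) = (\<lambda>y. s * t * ?P (u f) (?P (u g) (?U \<psi>)) y)" for \<psi>
    unfolding s t op_app_smult by (simp add: mult.assoc)
  have gf: "?U (?P g (?P f \<psi>)) = (\<lambda>y. s * t * ?P (u g) (?P (u f) (?U \<psi>)) y)" for \<psi>
    unfolding s t op_app_smult by (simp add: algebra_simps)
  show "u (gadd f g) = gadd (u f) (u g)"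
  proof (rule pauli_inj[OF Q mem[OF gadd_Gn[OF f g]] gadd_Gn[OF mem[OF f] mem[OF g]]])
    fix \<chi>
    \<comment> \<open>\<open>pauli_inj\<close> quantifies over all vectors, while the intertwining
      relations speak only of vectors in the range of U.\<close>
    define \<psi> where "\<psi> = op_app Q (op_adj U) \<chi>"
    have *: "?P h (?U \<psi>) = ?P h \<chi>" for h
      using U by (simp add: \<psi>_def unitary_op_iff[OF Q])
    have "(\<lambda>y. ?c * (r * ?P (u (gadd f g)) (?U \<psi>) y)) = (\<lambda>y. s * t * (?c' * ?P (gadd (u f) (u g)) (?U \<psi>) y))"
      using fg[of \<psi>] unfolding pauli_mult[OF Q f g] pauli_mult[OF Q mem[OF f] mem[OF g]] op_app_smult r .
    then show "?P (u (gadd f g)) \<chi> = (\<lambda>y. (s * t * ?c' / (?c * r)) * ?P (gadd (u f) (u g)) \<chi> y)"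
      unfolding * using r cocycle_nonzero[OF Q, of f g] by (auto simp: fun_eq_iff field_simps)
  qed
  show "omega Q (u f) (u g) = omega Q f g"
  proof (rule ccontr)
    assume ne: "omega Q (u f) (u g) \<noteq> omega Q f g"
    let ?s = "if omega Q f g then - 1 else 1 :: complex" and ?s' = "if omega Q (u f) (u g) then - 1 else 1 :: complex"
    have ss: "?s \<noteq> ?s'" using ne by auto
    have z: "trunc Q \<psi> = (\<lambda>_. 0)" for \<psi>
    proof -
      have "(\<lambda>y. ?s * (s * t * ?P (u g) (?P (u f) (?U \<psi>)) y)) = (\<lambda>y. s * t * (?s' * ?P (u g) (?P (u f) (?U \<psi>)) y))"
        using fg[of \<psi>] unfolding pauli_commute[OF Q f g] pauli_commute[OF Q mem[OF f] mem[OF g]] op_app_smult gf .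
      then have "?P (u g) (?P (u f) (?U \<psi>)) = (\<lambda>_. 0)"
        using ss s(1) t(1) by (auto simp: fun_eq_iff split: if_splits)
      then have "?U \<psi> = (\<lambda>_. 0)"
        using pauli_inj0[OF Q mem[OF g], of "?P (u f) (?U \<psi>)"] pauli_inj0[OF Q mem[OF f], of "?U \<psi>"] by simp
      then show ?thesis using unitary_inj0[OF Q U] by blast
    qed
    have "(\<lambda>_. False) \<in> basis Q" by (simp add: basis_def)
    then show False using fun_cong[OF z[of "\<lambda>_. 1"], of "\<lambda>_. False"] by (simp add: trunc_def)
  qed
  qed
  then show ?thesis using mem by (simp add: symplectic_map_def)
qed

lemma symplectic_zero: "symplectic_map Q u \<Longrightarrow> u gzero = gzero"
  unfolding symplectic_map_def by (metis gadd_self(1) gzero_Gn)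

text \<open>Elements with equal images differ by something orthogonal to all of G^n, hence by zero;
  finiteness turns injectivity into surjectivity.\<close>

lemma symplectic_bij:
  assumes Q: "finite Q" and u: "symplectic_map Q u"
  shows "bij_betw u (Gn Q) (Gn Q)"
proof -
  have "inj_on u (Gn Q)"
  proof (rule inj_onI)
    fix f g assume f: "f \<in> Gn Q" and g: "g \<in> Gn Q" and eq: "u f = u g"
    have "omega Q h (gadd f g) = omega Q (u h) gzero" if "h \<in> Gn Q" for h
      using that f g eq u unfolding symplectic_map_def by (metis gadd_Gn gadd_self(1))
    then have "gadd f g = gzero"
      using omega_nondegenerate[OF gadd_Gn[OF f g]] XZ_Gn by (metis omega_zero(1))
    then show "f = g" by (metis gadd_self(2) gadd_zero(1))
  qed
  moreover have "u ` Gn Q \<subseteq> Gn Q" using u by (auto simp: symplectic_map_def)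
  ultimately show ?thesis
    using endo_inj_surj[OF finite_Gn[OF Q]] by (auto simp: bij_betw_def)
qed

text \<open>Maximality needs surjectivity: an element orthogonal to the image has a preimage, which
  is orthogonal to S and so belongs to it.\<close>

lemma symplectic_self_dual:
  assumes Q: "finite Q" and u: "symplectic_map Q u" and S: "self_dual Q S"
  shows "self_dual Q (u ` S)"
proof -
  have S': "S \<subseteq> Gn Q" "gzero \<in> S" "\<And>f g. f \<in> S \<Longrightarrow> g \<in> S \<Longrightarrow> gadd f g \<in> S"
    "\<And>f. f \<in> Gn Q \<Longrightarrow> (\<forall>g\<in>S. \<not> omega Q f g) \<longleftrightarrow> f \<in> S"
    using S by (auto simp: self_dual_def f2_subspace_def)
  have u': "u f \<in> Gn Q" if "f \<in> Gn Q" for f using u that by (auto simp: symplectic_map_def)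
  have om: "omega Q (u f) (u g) = omega Q f g" if "f \<in> Gn Q" "g \<in> Gn Q" for f g
    using u that by (auto simp: symplectic_map_def)
  have "f2_subspace Q (u ` S)"
    unfolding f2_subspace_def
  proof (intro conjI ballI)
    show "gzero \<in> u ` S" using symplectic_zero[OF u] S' by force
    fix f g assume "f \<in> u ` S" "g \<in> u ` S"
    then show "gadd f g \<in> u ` S"
      using S' u unfolding symplectic_map_def by (smt (verit) image_iff subsetD)
  qed (use S' u' in auto)
  moreover have "u ` S = {f \<in> Gn Q. \<forall>g\<in>u ` S. \<not> omega Q f g}"
  proof (intro equalityI subsetI)
    fix f assume "f \<in> u ` S"
    then obtain h where h: "h \<in> S" "f = u h" by blast
    then have "\<not> omega Q (u h) (u g)" if "g \<in> S" for g
      using om[of h g] S'(4)[of h] S'(1) that by blast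
    then show "f \<in> {f \<in> Gn Q. \<forall>g\<in>u ` S. \<not> omega Q f g}"
      using h S'(1) u' by blast
  next
    fix f assume f: "f \<in> {f \<in> Gn Q. \<forall>g\<in>u ` S. \<not> omega Q f g}"
    then obtain h where h: "h \<in> Gn Q" "f = u h"
      using symplectic_bij[OF Q u] unfolding bij_betw_def by blast
    have "\<not> omega Q h g" if "g \<in> S" for g
      using f h that S'(1) om[of h g] by blast
    then have "h \<in> S" using S'(4)[OF h(1)] by blast
    then show "f \<in> u ` S" using h by blast
  qed
  ultimately show ?thesis unfolding self_dual_def by blast
qed

lemma stab_group_eigen:
  "stab_group Q S \<psi> \<Longrightarrow> f \<in> S \<Longrightarrow> \<exists>e\<in>{1, -1}. op_app Q (pauli Q f) \<psi> = (\<lambda>x. e * \<psi> x)"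
  by (simp only: stab_group_def)

lemma stab_group_map:
  assumes Q: "finite Q" and U: "unitary_op Q U" and u: "pauli_map Q U u" and S: "stab_group Q S \<psi>"
  shows "stab_group Q (u ` S) (op_app Q U \<psi>)"
proof -
  have uS: "self_dual Q (u ` S)"
    using symplectic_self_dual[OF Q pauli_map_symplectic[OF Q U u]] S by (simp add: stab_group_def)
  have "\<exists>e\<in>{1, -1}. op_app Q (pauli Q f) (op_app Q U \<psi>) = (\<lambda>x. e * op_app Q U \<psi> x)" if "f \<in> u ` S" for f
  proof -
    obtain g where g: "g \<in> S" "f = u g" using \<open>f \<in> u ` S\<close> by auto
    then have "g \<in> Gn Q" using S by (auto simp: stab_group_def self_dual_def f2_subspace_def)
    then obtain s where s: "s \<in> {1, -1}"
      "op_app Q U (op_app Q (pauli Q g) \<psi>) = (\<lambda>y. s * op_app Q (pauli Q (u g)) (op_app Q U \<psi>) y)"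
      using u unfolding pauli_map_def by blast
    obtain e where e: "e \<in> {1, -1}" "op_app Q (pauli Q g) \<psi> = (\<lambda>x. e * \<psi> x)"
      using stab_group_eigen[OF S g(1)] by blast
    have "op_app Q (pauli Q (u g)) (op_app Q U \<psi>) y = s * e * op_app Q U \<psi> y" for y
      using fun_cong[OF s(2), of y] s(1) unfolding e(2) op_app_smult by auto
    moreover have "s * e \<in> {1, -1}" using s(1) e(1) by auto
    ultimately show ?thesis using g by blast
  qed
  moreover have "unit_vec Q (op_app Q U \<psi>)"
    using S unitary_norm[OF Q U] by (simp add: unit_vec_def stab_group_def)
  moreover have "f2dim (u ` S) = card Q" using card_self_dual[OF Q uS] by (rule f2dim_eqI)
  ultimately show ?thesis using uS by (simp add: stab_group_def)
qed

text \<open>A nonzero eigenvalue is incompatible with anticommuting with some stabilizer element, as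
  this would force \<psi> = 0; self-duality does the rest. It recovers group elements from the
  explicit form of a state.\<close>

lemma stab_group_memI:
  assumes Q: "finite Q" and S: "stab_group Q S \<psi>" and f: "f \<in> Gn Q"
    and c: "op_app Q (pauli Q f) \<psi> = (\<lambda>x. c * \<psi> x)" "c \<noteq> 0"
  shows "f \<in> S"
proof -
  have "\<not> omega Q f g" if "g \<in> S" for g
  proof
    assume w: "omega Q f g"
    have g: "g \<in> Gn Q" using S that by (auto simp: stab_group_def self_dual_def f2_subspace_def)
    obtain e where e: "e \<in> {1, -1}" "op_app Q (pauli Q g) \<psi> = (\<lambda>x. e * \<psi> x)"
      using stab_group_eigen[OF S \<open>g \<in> S\<close>] by blast
    have "(\<lambda>y. e * (c * \<psi> y)) = (\<lambda>y. - (c * (e * \<psi> y)))"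
      using pauli_commute[OF Q f g, of \<psi>] w unfolding c e(2) op_app_smult by simp
    then have "\<psi> = (\<lambda>_. 0)" using c(2) e(1) by (auto simp: fun_eq_iff)
    then show False using S by (simp add: stab_group_def unit_vec_def)
  qed
  then show ?thesis using S f by (auto simp: stab_group_def self_dual_def)
qed

section \<open>Realizing symplectic maps by Clifford operators\<close>

definition transvection :: "'q set \<Rightarrow> 'q pel \<Rightarrow> 'q pel \<Rightarrow> 'q pel" where
  "transvection Q h f = (if omega Q f h then gadd f h else f)"

text \<open>This is exp(i pi sigma(h) / 4). Conjugation by it fixes the Pauli operators commuting
  with sigma(h) and multiplies the others by \<i> sigma(h), which is a transvection up to
  sign.\<close>

definition transvection_op :: "'q set \<Rightarrow> 'q pel \<Rightarrow> 'q op" where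
  "transvection_op Q h = (\<lambda>y x. of_real (1 / sqrt 2) * (op_id y x + \<i> * pauli Q h y x))"

lemma transvection_op_app:
  "finite Q \<Longrightarrow> op_app Q (transvection_op Q h) \<psi>
    = (\<lambda>y. of_real (1 / sqrt 2) * (trunc Q \<psi> y + \<i> * op_app Q (pauli Q h) \<psi> y))"
  unfolding transvection_op_def op_app_smult_kernel op_app_add_kernel by simp

lemma transvection_op_adj:
  assumes "finite Q" "h \<in> Gn Q"
  shows "op_app Q (op_adj (transvection_op Q h)) \<psi>
    = (\<lambda>y. of_real (1 / sqrt 2) * (trunc Q \<psi> y + (- \<i>) * op_app Q (pauli Q h) \<psi> y))"
proof -
  have "cnj (pauli Q h x y) = pauli Q h y x" for x y
    using fun_cong[OF fun_cong[OF pauli_adj[OF assms]], of y x] by (simp add: op_adj_def)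
  then have "op_adj (transvection_op Q h)
      = (\<lambda>y x. of_real (1 / sqrt 2) * (op_id y x + (- \<i>) * pauli Q h y x))"
    by (simp add: op_adj_def transvection_op_def op_id_def fun_eq_iff)
  then show ?thesis using assms(1) by (simp only: op_app_smult_kernel op_app_add_kernel op_app_id)
qed

lemma unitary_transvection_op:
  assumes Q: "finite Q" and h: "h \<in> Gn Q"
  shows "unitary_op Q (transvection_op Q h)"
proof -
  have half: "complex_of_real (1 / sqrt 2) * complex_of_real (1 / sqrt 2) = 1 / 2"
    by (simp flip: of_real_mult)
  \<comment> \<open>The scalar content of (1 - iP)(1 + iP) = 2 for P^2 = 1, with t and p the values
    of \<psi> and P \<psi> at one bit string. Taking i' to be \<i> or -\<i> covers both orders of
    multiplication.\<close>
  have key: "a * (a * (t + i' * p) + j * (a * (p + i' * t))) = t"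
    if "a * a = 1 / 2" "j = - i'" "i' * i' = - 1" for a t i' p j :: complex
  proof -
    have "a * (a * (t + i' * p) + j * (a * (p + i' * t))) = (a * a) * (t - (i' * i') * t)"
      using that(2) by (simp add: algebra_simps)
    then show ?thesis using that by simp
  qed
  have P: "op_app Q (pauli Q h) (\<lambda>y. c * (trunc Q \<psi> y + d * op_app Q (pauli Q h) \<psi> y))
      = (\<lambda>y. c * (op_app Q (pauli Q h) \<psi> y + d * trunc Q \<psi> y))" for c d \<psi>
    unfolding op_app_smult op_app_add pauli_pauli[OF Q h] by simp
  have T: "trunc Q (\<lambda>y. c * (trunc Q \<psi> y + d * op_app Q (pauli Q h) \<psi> y))
      = (\<lambda>y. c * (trunc Q \<psi> y + d * op_app Q (pauli Q h) \<psi> y))" for c d \<psi>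
    by (auto simp: trunc_def fun_eq_iff op_app_def)
  show ?thesis
    unfolding unitary_op_iff[OF Q] transvection_op_app[OF Q] transvection_op_adj[OF Q h] P T
    by (intro conjI allI ext key) (use half in simp_all)
qed

lemma pauli_map_transvection:
  assumes Q: "finite Q" and h: "h \<in> Gn Q"
  shows "pauli_map Q (transvection_op Q h) (transvection Q h)"
  unfolding pauli_map_def
proof (intro ballI conjI)
  fix f assume f: "f \<in> Gn Q"
  let ?P = "\<lambda>f \<psi>. op_app Q (pauli Q f) \<psi>" and ?a = "complex_of_real (1 / sqrt 2)"
  show "transvection Q h f \<in> Gn Q" using f h by (auto simp: transvection_def)
  have U: "op_app Q (transvection_op Q h) (?P f \<psi>) = (\<lambda>y. ?a * (?P f \<psi> y + \<i> * ?P h (?P f \<psi>) y))" for \<psi>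
    by (simp add: transvection_op_app[OF Q])
  have V: "?P g (op_app Q (transvection_op Q h) \<psi>) = (\<lambda>y. ?a * (?P g \<psi> y + \<i> * ?P g (?P h \<psi>) y))" for g \<psi>
    unfolding transvection_op_app[OF Q] op_app_smult op_app_add by simp
  show "\<exists>s\<in>{1, -1}. \<forall>\<psi>. op_app Q (transvection_op Q h) (?P f \<psi>)
      = (\<lambda>y. s * ?P (transvection Q h f) (op_app Q (transvection_op Q h) \<psi>) y)"
  proof (cases "omega Q f h")
    case False
    then have "?P h (?P f \<psi>) = ?P f (?P h \<psi>)" for \<psi>
      using pauli_commute[OF Q h f] by (simp add: omega_commute[of Q h])
    then show ?thesis using False unfolding U V by (simp add: transvection_def)
  next
    case True
    let ?c = "cocycle Q h f"
    have c: "?c * ?c = - 1" using cocycle_square[OF Q, of h f] True by (simp add: omega_commute[of Q h])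
    \<comment> \<open>For an anticommuting pair the cocycle squares to -1, so its multiple by \<i>
      is a genuine sign.\<close>
    define s where "s = \<i> * ?c"
    have "s * s = 1" using c by (simp add: s_def algebra_simps)
    then have s: "s \<in> {1, -1}" using power2_eq_1_iff[of s] by (simp add: power2_eq_square)
    have cs: "\<i> * ?c = s" "s * s = 1" using \<open>s * s = 1\<close> by (simp_all add: s_def)
    \<comment> \<open>The inverse of \<open>?c\<close> is \<open>- ?c\<close>, which solves the
      product formula for the operator of f + h.\<close>
    have g: "?P (gadd f h) \<psi> = (\<lambda>y. - ?c * ?P h (?P f \<psi>) y)" for \<psi>
      unfolding pauli_mult[OF Q h f] using c by (auto simp: gadd_commute[of f] fun_eq_iff mult.assoc[symmetric])
    have hfh: "?P h (?P f (?P h \<psi>)) = (\<lambda>y. - ?P f \<psi> y)" for \<psi>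
    proof -
      have "?P h (?P f (?P h \<psi>)) = (\<lambda>y. - 1 * ?P f (?P h (?P h \<psi>)) y)"
        using pauli_commute[OF Q h f, of "?P h \<psi>"] True by (simp add: omega_commute[of Q h])
      then show ?thesis by (simp add: pauli_pauli[OF Q h])
    qed
    have "?a * (F + \<i> * H) = s * (?a * (- ?c * H + \<i> * (- ?c * - F)))" for F H
    proof -
      have "s * (?a * (- ?c * H + \<i> * (- ?c * - F))) = ?a * (s * (\<i> * ?c) * F + \<i> * ((\<i> * ?c) * s) * H)"
        by (simp add: algebra_simps)
      then show ?thesis unfolding cs by simp
    qed
    then have "op_app Q (transvection_op Q h) (?P f \<psi>)
      = (\<lambda>y. s * ?P (gadd f h) (op_app Q (transvection_op Q h) \<psi>) y)" for \<psi>
      unfolding U V g hfh by blast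
    then show ?thesis using s True by (auto simp: transvection_def)
  qed
qed

text \<open>W confines u: whatever is orthogonal to W stays fixed. This is all that needs to be
  remembered about a product of transvections along elements of W.\<close>

definition realizable :: "'q set \<Rightarrow> 'q pel set \<Rightarrow> ('q pel \<Rightarrow> 'q pel) \<Rightarrow> bool" where
  "realizable Q W u \<longleftrightarrow> (\<exists>U. unitary_op Q U \<and> pauli_map Q U u) \<and>
     (\<forall>f\<in>Gn Q. (\<forall>h\<in>W. \<not> omega Q f h) \<longrightarrow> u f = f)"

lemma unitary_mult:
  assumes Q: "finite Q" and "unitary_op Q U" "unitary_op Q V"
  shows "unitary_op Q (op_mult Q U V)"
proof -
  have "op_adj (op_mult Q U V) = op_mult Q (op_adj V) (op_adj U)"
    by (simp add: op_adj_def op_mult_def fun_eq_iff mult.commute)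
  then show ?thesis
    using assms by (simp add: unitary_op_iff op_app_mult)
qed

lemma pauli_map_mult:
  assumes Q: "finite Q" and u: "pauli_map Q U u" and v: "pauli_map Q V v"
  shows "pauli_map Q (op_mult Q U V) (u \<circ> v)"
  unfolding pauli_map_def
proof (intro ballI conjI)
  fix f assume f: "f \<in> Gn Q"
  have vf: "v f \<in> Gn Q" using v f by (simp add: pauli_map_def)
  then show "(u \<circ> v) f \<in> Gn Q" using u by (simp add: pauli_map_def)
  obtain s where s: "\<And>\<psi>. op_app Q V (op_app Q (pauli Q f) \<psi>) = (\<lambda>y. s * op_app Q (pauli Q (v f)) (op_app Q V \<psi>) y)"
    and s1: "s \<in> {1, -1}"
    using pauli_mapD[OF v f] by blast
  obtain t where t: "\<And>\<psi>. op_app Q U (op_app Q (pauli Q (v f)) \<psi>) = (\<lambda>y. t * op_app Q (pauli Q (u (v f))) (op_app Q U \<psi>) y)"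
    and t1: "t \<in> {1, -1}"
    using pauli_mapD[OF u vf] by blast
  show "\<exists>s\<in>{1, -1}. \<forall>\<psi>. op_app Q (op_mult Q U V) (op_app Q (pauli Q f) \<psi>) =
    (\<lambda>y. s * op_app Q (pauli Q ((u \<circ> v) f)) (op_app Q (op_mult Q U V) \<psi>) y)"
    unfolding op_app_mult[OF Q] s op_app_smult t
    by (rule bexI[of _ "s * t"]) (use s1 t1 in auto)
qed

lemma realizable_comp:
  assumes Q: "finite Q" and u: "realizable Q W u" and v: "realizable Q W v"
  shows "realizable Q W (u \<circ> v)"
proof -
  obtain U V where "unitary_op Q U" "pauli_map Q U u" "unitary_op Q V" "pauli_map Q V v"
    using u v by (auto simp: realizable_def)
  then have "unitary_op Q (op_mult Q U V) \<and> pauli_map Q (op_mult Q U V) (u \<circ> v)"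
    using unitary_mult[OF Q] pauli_map_mult[OF Q] by blast
  then show ?thesis using u v unfolding realizable_def by (metis comp_apply)
qed

lemma realizable_transvection:
  "finite Q \<Longrightarrow> h \<in> Gn Q \<Longrightarrow> h \<in> W \<Longrightarrow> realizable Q W (transvection Q h)"
  unfolding realizable_def using unitary_transvection_op pauli_map_transvection
  by (metis transvection_def)

lemma realizable_id: "finite Q \<Longrightarrow> realizable Q {} id"
proof -
  assume Q: "finite Q"
  have adj: "op_adj op_id = (op_id :: 'a op)" by (auto simp: op_adj_def op_id_def fun_eq_iff)
  have "unitary_op Q op_id" using Q by (simp add: unitary_op_iff adj trunc_def fun_eq_iff)
  moreover have "pauli_map Q op_id id"
    unfolding pauli_map_def using Q by simp
  ultimately show ?thesis by (auto simp: realizable_def)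
qed

lemma realizable_mono: "realizable Q W u \<Longrightarrow> W \<subseteq> W' \<Longrightarrow> realizable Q W' u"
  unfolding realizable_def by blast

text \<open>The subspace of elements vanishing on \<open>K\<close> is nondegenerate, so transvections inside it
  suffice to move one hyperbolic pair to another.\<close>

lemma transvection_step:
  "omega Q v w \<Longrightarrow> finite Q \<Longrightarrow> transvection Q (gadd v w) v = w"
  by (simp add: transvection_def omega_gadd)

text \<open>Choose a pairing with v and b pairing with w. If neither of them pairs with both
  vectors, then their sum does.\<close>

lemma common_partner:
  assumes Q: "finite Q" and v: "v \<in> Gn (Q - K)" "v \<noteq> gzero" and w: "w \<in> Gn (Q - K)" "w \<noteq> gzero"
  obtains z where "z \<in> Gn (Q - K)" "omega Q v z" "omega Q w z"
proof -
  have ex: "\<exists>z\<in>Gn (Q - K). omega Q v z" if v: "v \<in> Gn (Q - K)" "v \<noteq> gzero" for v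
  proof -
    obtain j where j: "j \<in> Q - K" "fst v j \<or> snd v j"
      using omega_nondegenerate[OF v] by blast
    then have "omega Q (Xel j) v \<or> omega Q (Zel j) v" by (auto simp: omega_Xel omega_Zel)
    then show ?thesis using j(1) XZ_Gn omega_commute by metis
  qed
  obtain a where a: "a \<in> Gn (Q - K)" "omega Q v a" using ex[OF v] by blast
  obtain b where b: "b \<in> Gn (Q - K)" "omega Q w b" using ex[OF w] by blast
  show ?thesis
    using that[OF a] that[OF b(1) _ b(2)] that[OF gadd_Gn[OF a(1) b(1)]] a b
    by (auto simp: omega_gadd[OF Q])
qed

lemma Gn_mono: "f \<in> Gn (Q - K) \<Longrightarrow> f \<in> Gn Q" by (auto simp: Gn_iff)

lemma realizable_transvection_sub:
  "finite Q \<Longrightarrow> h \<in> Gn (Q - K) \<Longrightarrow> realizable Q (Gn (Q - K)) (transvection Q h)"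
  using realizable_transvection Gn_mono by blast

text \<open>A transvection along v + w moves v to w only if the two are not orthogonal, so the path
  goes through a common partner z.\<close>

lemma move_vector:
  assumes Q: "finite Q" and v: "v \<in> Gn (Q - K)" "v \<noteq> gzero" and w: "w \<in> Gn (Q - K)" "w \<noteq> gzero"
  shows "\<exists>u. realizable Q (Gn (Q - K)) u \<and> u v = w"
proof -
  obtain z where z: "z \<in> Gn (Q - K)" "omega Q v z" "omega Q w z"
    using common_partner[OF assms] by blast
  let ?h = "gadd v z" and ?k = "gadd z w"
  have "(transvection Q ?k \<circ> transvection Q ?h) v = w"
    using z transvection_step[OF z(2) Q] transvection_step[of Q z w] Q omega_commute[of Q w z] by simp
  moreover have "realizable Q (Gn (Q - K)) (transvection Q ?k \<circ> transvection Q ?h)"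
    using v w z by (intro realizable_comp[OF Q] realizable_transvection_sub[OF Q]) auto
  ultimately show ?thesis by blast
qed

text \<open>The difference w + w' is orthogonal to v, so a transvection along it fixes v. If w and
  w' are orthogonal, w is first replaced by w + v, which does pair with w'; the vectors used, v and
  w + v + w', are again orthogonal to v.\<close>

lemma move_partner:
  assumes Q: "finite Q" and v: "v \<in> Gn (Q - K)" and w: "w \<in> Gn (Q - K)" "w' \<in> Gn (Q - K)"
    and om: "omega Q v w" "omega Q v w'"
  shows "\<exists>u. realizable Q (Gn (Q - K)) u \<and> u v = v \<and> u w = w'"
proof (cases "omega Q w w'")
  case True
  have "transvection Q (gadd w w') v = v" using om by (simp add: transvection_def omega_gadd[OF Q])
  moreover have "transvection Q (gadd w w') w = w'" using transvection_step[OF True Q] .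
  moreover have "realizable Q (Gn (Q - K)) (transvection Q (gadd w w'))"
    using w by (intro realizable_transvection_sub[OF Q]) auto
  ultimately show ?thesis by blast
next
  case False
  let ?t = "transvection Q (gadd (gadd w v) w') \<circ> transvection Q v"
  have 1: "omega Q w v" using om omega_commute by metis
  have 2: "omega Q (gadd w v) w'" using False om by (simp add: omega_gadd'[OF Q])
  have "?t v = v" using om by (simp add: transvection_def omega_gadd[OF Q])
  moreover have "?t w = w'"
    using transvection_step[OF 2 Q] 1 by (simp add: transvection_def)
  moreover have "realizable Q (Gn (Q - K)) ?t"
    using v w by (intro realizable_comp[OF Q] realizable_transvection_sub[OF Q]) auto
  ultimately show ?thesis by blast
qed

text \<open>Witt's extension theorem for hyperbolic pairs, realized by Clifford operators. Each new
  pair is moved by transvections living away from the qubits already settled. The bound on k is part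
  of the conclusion because it later shows that a party holds enough qubits.\<close>

theorem clifford_witt:
  fixes e :: "nat \<Rightarrow> 'q"
  assumes Q: "Q = e ` {..<n}" and e: "inj_on e {..<n}"
    and mem: "\<forall>i<k. x i \<in> Gn Q \<and> z i \<in> Gn Q"
    and om: "\<forall>i<k. \<forall>j<k. \<not> omega Q (x i) (x j) \<and> \<not> omega Q (z i) (z j) \<and> omega Q (x i) (z j) = (i = j)"
  shows "k \<le> n \<and> (\<exists>u. realizable Q (Gn Q) u \<and> (\<forall>i<k. u (x i) = Xel (e i) \<and> u (z i) = Zel (e i)))"
  using mem om
proof (induction k)
  case 0
  have "finite Q" using Q by simp
  then show ?case using realizable_mono[OF realizable_id] by blast
next
  case (Suc k)
  have fQ: "finite Q" using Q by simp
  from Suc obtain u where kn: "k \<le> n" and u: "realizable Q (Gn Q) u"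
    and ui: "\<And>i. i < k \<Longrightarrow> u (x i) = Xel (e i)" "\<And>i. i < k \<Longrightarrow> u (z i) = Zel (e i)"
    by (auto simp: less_Suc_eq)
  have sym: "symplectic_map Q u" using u pauli_map_symplectic[OF fQ] by (auto simp: realizable_def)
  have uG: "u f \<in> Gn Q" if "f \<in> Gn Q" for f using sym that by (simp add: symplectic_map_def)
  have uo: "omega Q (u f) (u g) = omega Q f g" if "f \<in> Gn Q" "g \<in> Gn Q" for f g
    using sym that by (simp add: symplectic_map_def)
  define K where "K = e ` {..<k}"
  have eQ: "e i \<in> Q" if "i < k" for i using Q kn that by auto
  have G: "x i \<in> Gn Q" "z i \<in> Gn Q" if "i \<le> k" for i using Suc.prems(1) that by auto
  \<comment> \<open>Orthogonality to the settled pairs means orthogonality of the image to their X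
    and Z unit vectors, so the image is supported off K.\<close>
  have Gk: "u f \<in> Gn (Q - K)" if f: "f \<in> Gn Q" "\<And>i. i < k \<Longrightarrow> \<not> omega Q (x i) f \<and> \<not> omega Q (z i) f" for f
  proof -
    have "\<not> fst (u f) (e i) \<and> \<not> snd (u f) (e i)" if "i < k" for i
      using f(2)[OF that] uo[of "x i" f] uo[of "z i" f] f(1) G[of i] ui[OF that] that
        omega_Xel[OF eQ[OF that]] omega_Zel[OF eQ[OF that]] by auto
    then show ?thesis using uG[OF f(1)] by (auto simp: Gn_iff K_def)
  qed
  have vw: "u (x k) \<in> Gn (Q - K)" "u (z k) \<in> Gn (Q - K)"
    using Suc.prems(2) by (auto intro!: Gk G simp: omega_commute[of Q "z _" "x k"])
  have sub: "Gn (Q - K) \<subseteq> Gn Q" using Gn_mono by blast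
  have vw': "u (x k) \<in> Gn Q" "u (z k) \<in> Gn Q" using vw sub by blast+
  have o: "omega Q (u (x k)) (u (z k))" using uo G Suc.prems(2) by simp
  then have nz: "u (x k) \<noteq> gzero" by auto
  \<comment> \<open>The image of the next vector is nonzero and supported off K, so a qubit with
    index at least k must exist.\<close>
  obtain j where j: "j \<in> Q - K" using omega_nondegenerate[OF vw(1) nz] by blast
  then obtain l where "l < n" "j = e l" "\<not> l < k" unfolding Q K_def by blast
  then have kn': "k < n" by simp
  have "e k \<noteq> e i" if "i < k" for i using inj_onD[OF e, of k i] that kn' by auto
  then have ek: "e k \<in> Q - K" using kn' by (auto simp: Q K_def)
  have Xnz: "Xel (e k) \<noteq> gzero" by (metis XZ_simps(1) gadd_simps(3))
  obtain t where t: "realizable Q (Gn (Q - K)) t" "t (u (x k)) = Xel (e k)"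
    using move_vector[OF fQ vw(1) nz _ Xnz] ek by auto
  have symt: "symplectic_map Q t" using t pauli_map_symplectic[OF fQ] by (auto simp: realizable_def)
  \<comment> \<open>Stated for an arbitrary r because it serves twice: for the move of the X vector
    and for the subsequent move of its partner.\<close>
  have fix_t: "r (Xel (e i)) = Xel (e i) \<and> r (Zel (e i)) = Zel (e i)"
    if "i < k" "realizable Q (Gn (Q - K)) r" for i r
  proof -
    have "\<not> omega Q (Xel (e i)) h \<and> \<not> omega Q (Zel (e i)) h" if "h \<in> Gn (Q - K)" for h
      using that eQ[OF \<open>i < k\<close>] \<open>i < k\<close> by (auto simp: omega_Xel omega_Zel Gn_iff K_def)
    then show ?thesis using that eQ[OF that(1)] unfolding realizable_def by (metis XZ_Gn)
  qed
  have to: "omega Q (t f) (t g) = omega Q f g" if "f \<in> Gn Q" "g \<in> Gn Q" for f g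
    using symt that by (simp add: symplectic_map_def)
  define w where "w = t (u (z k))"
  have ow: "omega Q (Xel (e k)) w"
    using to[OF vw'] t(2) o unfolding w_def by simp
  have wG: "w \<in> Gn (Q - K)"
  proof -
    have "w \<in> Gn Q" using symt vw' by (simp add: w_def symplectic_map_def)
    moreover have "\<not> fst w (e i) \<and> \<not> snd w (e i)" if "i < k" for i
    proof -
      have "omega Q (Xel (e i)) w = omega Q (Xel (e i)) (u (z k))" "omega Q (Zel (e i)) w = omega Q (Zel (e i)) (u (z k))"
        using to[of "Xel (e i)" "u (z k)"] to[of "Zel (e i)" "u (z k)"] fix_t[OF that t(1)] eQ[OF that] vw'(2)
        unfolding w_def by simp_all
      then show ?thesis using vw(2) that eQ[OF that] by (auto simp: omega_Xel omega_Zel Gn_iff K_def)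
    qed
    ultimately show ?thesis by (auto simp: Gn_iff K_def)
  qed
  obtain r where r: "realizable Q (Gn (Q - K)) r" "r (Xel (e k)) = Xel (e k)" "r w = Zel (e k)"
    using move_partner[OF fQ _ wG _ ow, of "Zel (e k)"] ek by (auto simp: omega_Xel)
  have "realizable Q (Gn Q) (r \<circ> t \<circ> u)"
    using r(1) t(1) u by (intro realizable_comp[OF fQ]) (auto intro: realizable_mono[OF _ sub])
  moreover have "(r \<circ> t \<circ> u) (x i) = Xel (e i) \<and> (r \<circ> t \<circ> u) (z i) = Zel (e i)" if "i < Suc k" for i
  proof (cases "i = k")
    case True
    then show ?thesis using t(2) r by (simp add: w_def)
  next
    case False
    then have "i < k" using that by simp
    then show ?thesis using ui fix_t[OF _ r(1)] fix_t[OF _ t(1)] by simp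
  qed
  ultimately show ?case using kn' by (intro conjI) auto
qed

section \<open>Local operators\<close>

definition pr :: "('p \<Rightarrow> nat) \<Rightarrow> 'p \<Rightarrow> ('p \<times> nat) pel \<Rightarrow> ('p \<times> nat) pel" where
  "pr N \<alpha> f = (restr (Qpart N \<alpha>) (fst f), restr (Qpart N \<alpha>) (snd f))"

definition join :: "'p set \<Rightarrow> ('p \<Rightarrow> ('p \<times> nat) pel) \<Rightarrow> ('p \<times> nat) pel" where
  "join M h = (\<lambda>j. fst j \<in> M \<and> fst (h (fst j)) j, \<lambda>j. fst j \<in> M \<and> snd (h (fst j)) j)"

lemma Qpart_iff: "j \<in> Qpart N \<alpha> \<longleftrightarrow> fst j = \<alpha> \<and> snd j < N \<alpha>"
  by (cases j) (auto simp: Qpart_def)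

lemma Qall_iff: "j \<in> Qall N M \<longleftrightarrow> fst j \<in> M \<and> snd j < N (fst j)"
  by (auto simp: Qall_def Qpart_iff)

lemma finite_Qpart [simp]: "finite (Qpart N \<alpha>)"
proof -
  have "Qpart N \<alpha> = Pair \<alpha> ` {..<N \<alpha>}" by (auto simp: Qpart_def)
  then show ?thesis by simp
qed

lemma finite_Qall: "finite M \<Longrightarrow> finite (Qall N M)" by (simp add: Qall_def)

lemma card_Qall: "finite M \<Longrightarrow> card (Qall N M) = (\<Sum>\<alpha>\<in>M. N \<alpha>)"
proof -
  assume "finite M"
  have "Qpart N \<alpha> = Pair \<alpha> ` {..<N \<alpha>}" for \<alpha> by (auto simp: Qpart_def)
  then have "card (Qpart N \<alpha>) = N \<alpha>" for \<alpha> by (simp add: card_image inj_on_def)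
  moreover have "card (Qall N M) = (\<Sum>\<alpha>\<in>M. card (Qpart N \<alpha>))"
    unfolding Qall_def by (rule card_UN_disjoint) (use \<open>finite M\<close> in \<open>auto simp: Qpart_iff\<close>)
  ultimately show ?thesis by simp
qed

lemma restr_basis [simp]: "restr A x \<in> basis A" by (simp add: restr_def basis_def)

lemma restr_apply [simp]: "restr A x j \<longleftrightarrow> j \<in> A \<and> x j" by (simp add: restr_def)

lemma pr_simps [simp]: "fst (pr N \<alpha> f) j \<longleftrightarrow> j \<in> Qpart N \<alpha> \<and> fst f j"
  "snd (pr N \<alpha> f) j \<longleftrightarrow> j \<in> Qpart N \<alpha> \<and> snd f j"
  by (simp_all add: pr_def)

lemma pr_Gn [simp]: "pr N \<alpha> f \<in> Gn (Qpart N \<alpha>)" by (simp add: Gn_iff)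

lemma join_simps [simp]: "fst (join M h) j \<longleftrightarrow> fst j \<in> M \<and> fst (h (fst j)) j"
  "snd (join M h) j \<longleftrightarrow> fst j \<in> M \<and> snd (h (fst j)) j"
  by (simp_all add: join_def)

lemma join_Gn: "(\<And>\<alpha>. \<alpha> \<in> M \<Longrightarrow> h \<alpha> \<in> Gn (Qpart N \<alpha>)) \<Longrightarrow> join M h \<in> Gn (Qall N M)"
  by (auto simp: Gn_iff Qall_iff Qpart_iff)

lemma Gn_QpartD: "f \<in> Gn (Qpart N \<alpha>) \<Longrightarrow> fst f j \<or> snd f j \<Longrightarrow> fst j = \<alpha> \<and> snd j < N \<alpha>"
  unfolding Gn_iff Qpart_iff by blast

lemma pr_join:
  assumes "\<alpha> \<in> M" "h \<alpha> \<in> Gn (Qpart N \<alpha>)"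
  shows "pr N \<alpha> (join M h) = h \<alpha>"
proof (rule pel_eqI)
  fix j
  show "fst (pr N \<alpha> (join M h)) j = fst (h \<alpha>) j" "snd (pr N \<alpha> (join M h)) j = snd (h \<alpha>) j"
    using Gn_QpartD[OF assms(2), of j] assms(1) by (auto simp: Qpart_iff)
qed

lemma Qpart_subset: "\<alpha> \<in> M \<Longrightarrow> Qpart N \<alpha> \<subseteq> Qall N M"
  by (auto simp: Qall_iff Qpart_iff)

lemma Gn_Qpart: "\<alpha> \<in> M \<Longrightarrow> f \<in> Gn (Qpart N \<alpha>) \<Longrightarrow> f \<in> Gn (Qall N M)"
  using Qpart_subset[of \<alpha> M N] by (auto simp: Gn_iff)

lemma prod_Qall: "finite M \<Longrightarrow> (\<Prod>j\<in>Qall N M. F j) = (\<Prod>\<alpha>\<in>M. \<Prod>j\<in>Qpart N \<alpha>. F j)"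
  unfolding Qall_def by (rule prod.UNION_disjoint) (auto simp: Qpart_iff)

lemma omega_parties:
  assumes M: "finite M"
  shows "omega (Qall N M) f g \<longleftrightarrow> odd (card {\<alpha> \<in> M. omega (Qpart N \<alpha>) f g})"
proof -
  let ?P = "\<lambda>j. (fst f j \<and> snd g j) \<noteq> (snd f j \<and> fst g j)"
  have "{j \<in> Qall N M. ?P j} = (\<Union>\<alpha>\<in>M. {j \<in> Qpart N \<alpha>. ?P j})" by (auto simp: Qall_def)
  moreover have "card (\<Union>\<alpha>\<in>M. {j \<in> Qpart N \<alpha>. ?P j}) = (\<Sum>\<alpha>\<in>M. card {j \<in> Qpart N \<alpha>. ?P j})"
    by (rule card_UN_disjoint[OF M]) (simp, auto simp: Qpart_iff)
  ultimately show ?thesis using even_sum_iff[OF M] by (simp add: omega_def)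
qed

lemma omega_cong:
  "(\<And>j. j \<in> Q \<Longrightarrow> fst f j = fst f' j \<and> snd f j = snd f' j) \<Longrightarrow>
   (\<And>j. j \<in> Q \<Longrightarrow> fst g j = fst g' j \<and> snd g j = snd g' j) \<Longrightarrow> omega Q f g = omega Q f' g'"
  unfolding omega_def by (rule arg_cong[where f = "\<lambda>A. odd (card A)"]) auto

lemma omega_one_party:
  assumes M: "finite M" and "\<alpha> \<in> M" and f: "f \<in> Gn (Qpart N \<alpha>)"
  shows "omega (Qall N M) f g \<longleftrightarrow> omega (Qpart N \<alpha>) f g"
proof -
  have other: "\<not> omega (Qpart N \<beta>) f g" if "\<beta> \<noteq> \<alpha>" for \<beta>
  proof -
    have "fst f j = fst gzero j \<and> snd f j = snd gzero j" if "j \<in> Qpart N \<beta>" for j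
      using Gn_QpartD[OF f, of j] \<open>\<beta> \<noteq> \<alpha>\<close> that by (auto simp: Qpart_iff)
    then have "omega (Qpart N \<beta>) f g = omega (Qpart N \<beta>) gzero g"
      by (rule omega_cong) simp_all
    then show ?thesis by simp
  qed
  show ?thesis
  proof (cases "omega (Qpart N \<alpha>) f g")
    case True
    then have "{\<beta> \<in> M. omega (Qpart N \<beta>) f g} = {\<alpha>}" using other \<open>\<alpha> \<in> M\<close> by blast
    then show ?thesis using True by (simp add: omega_parties[OF M])
  next
    case False
    then have "\<not> omega (Qpart N \<beta>) f g" for \<beta> using other by (cases "\<beta> = \<alpha>") simp_all
    then show ?thesis by (simp add: omega_parties[OF M])
  qed
qed

text \<open>A global bit string is a tuple of party strings, so a sum of products distributes. This
  makes \<open>local_op\<close> multiplicative.\<close>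

lemma sum_basis_Qall:
  fixes F :: "'p \<Rightarrow> ('p \<times> nat \<Rightarrow> bool) \<Rightarrow> complex"
  assumes M: "finite M"
  shows "(\<Sum>x\<in>basis (Qall N M). \<Prod>\<alpha>\<in>M. F \<alpha> (restr (Qpart N \<alpha>) x)) = (\<Prod>\<alpha>\<in>M. \<Sum>x\<in>basis (Qpart N \<alpha>). F \<alpha> x)"
proof -
  let ?i = "\<lambda>x. \<lambda>\<alpha>\<in>M. restr (Qpart N \<alpha>) x"
  have bij: "bij_betw ?i (basis (Qall N M)) (Pi\<^sub>E M (\<lambda>\<alpha>. basis (Qpart N \<alpha>)))"
  proof (rule bij_betwI[where g = "\<lambda>h j. fst j \<in> M \<and> h (fst j) j"])
    show "(\<lambda>j. fst j \<in> M \<and> ?i x (fst j) j) = x" if "x \<in> basis (Qall N M)" for x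
      using that by (auto simp: fun_eq_iff basis_def Qall_iff Qpart_iff)
    show "?i (\<lambda>j. fst j \<in> M \<and> h (fst j) j) = h" if h: "h \<in> Pi\<^sub>E M (\<lambda>\<alpha>. basis (Qpart N \<alpha>))" for h
    proof
      fix \<alpha>
      show "?i (\<lambda>j. fst j \<in> M \<and> h (fst j) j) \<alpha> = h \<alpha>"
      proof (cases "\<alpha> \<in> M")
        case True
        then have "h \<alpha> \<in> basis (Qpart N \<alpha>)" using h by auto
        then show ?thesis using True by (auto simp: fun_eq_iff basis_def Qpart_iff)
      next
        case False
        then show ?thesis using h by (simp add: PiE_arb[OF h])
      qed
    qed
  qed (auto simp: basis_def Qall_iff Qpart_iff PiE_iff)
  have "(\<Sum>x\<in>basis (Qall N M). \<Prod>\<alpha>\<in>M. F \<alpha> (restr (Qpart N \<alpha>) x))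
      = (\<Sum>x\<in>basis (Qall N M). (\<lambda>h. \<Prod>\<alpha>\<in>M. F \<alpha> (h \<alpha>)) (?i x))"
    by (intro sum.cong prod.cong) auto
  also have "\<dots> = (\<Sum>h\<in>Pi\<^sub>E M (\<lambda>\<alpha>. basis (Qpart N \<alpha>)). \<Prod>\<alpha>\<in>M. F \<alpha> (h \<alpha>))"
    by (rule sum.reindex_bij_betw[OF bij])
  also have "\<dots> = (\<Prod>\<alpha>\<in>M. \<Sum>x\<in>basis (Qpart N \<alpha>). F \<alpha> x)"
    by (rule prod_sum_PiE[symmetric]) (simp_all add: M finite_basis)
  finally show ?thesis .
qed

section \<open>Tensor products of operators and their action on Pauli elements\<close>

lemma local_op_mult:
  assumes "finite M"
  shows "op_mult (Qall N M) (local_op N M U) (local_op N M V)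
    = local_op N M (\<lambda>\<alpha>. op_mult (Qpart N \<alpha>) (U \<alpha>) (V \<alpha>))"
proof (intro ext)
  fix y z
  show "op_mult (Qall N M) (local_op N M U) (local_op N M V) y z
      = local_op N M (\<lambda>\<alpha>. op_mult (Qpart N \<alpha>) (U \<alpha>) (V \<alpha>)) y z"
    using sum_basis_Qall[OF assms, of "\<lambda>\<alpha> x. U \<alpha> (restr (Qpart N \<alpha>) y) x * V \<alpha> x (restr (Qpart N \<alpha>) z)" N]
    by (simp add: op_mult_def local_op_def prod.distrib)
qed

lemma local_op_cong:
  "(\<And>\<alpha>. \<alpha> \<in> M \<Longrightarrow> op_eq (Qpart N \<alpha>) (U \<alpha>) (V \<alpha>)) \<Longrightarrow> local_op N M U = local_op N M V"
  unfolding local_op_def by (intro ext prod.cong) (auto simp: op_eq_def)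

lemma local_op_smult:
  "local_op N M (\<lambda>\<alpha> y x. s \<alpha> * U \<alpha> y x) = (\<lambda>y x. (\<Prod>\<alpha>\<in>M. s \<alpha>) * local_op N M U y x)"
  unfolding local_op_def by (simp add: prod.distrib)

lemma op_adj_local: "op_adj (local_op N M U) = local_op N M (\<lambda>\<alpha>. op_adj (U \<alpha>))"
  unfolding local_op_def op_adj_def by simp

lemma basis_Qall_eqI:
  assumes "x \<in> basis (Qall N M)" "y \<in> basis (Qall N M)"
    and "\<And>\<alpha>. \<alpha> \<in> M \<Longrightarrow> restr (Qpart N \<alpha>) x = restr (Qpart N \<alpha>) y"
  shows "x = y"
proof
  fix j
  show "x j = y j"
  proof (cases "j \<in> Qall N M")
    case True
    then have "restr (Qpart N (fst j)) x j = restr (Qpart N (fst j)) y j"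
      using assms(3) by (simp add: Qall_iff)
    with True show ?thesis by (simp add: Qall_iff Qpart_iff)
  next
    case False
    with assms(1,2) show ?thesis unfolding basis_def by blast
  qed
qed

lemma prod_of_bool: "finite M \<Longrightarrow> (\<Prod>\<alpha>\<in>M. if P \<alpha> then F \<alpha> else 0) = (if \<forall>\<alpha>\<in>M. P \<alpha> then \<Prod>\<alpha>\<in>M. F \<alpha> else (0 :: complex))"
  by (auto intro!: prod.cong)

lemma local_op_id:
  assumes M: "finite M"
  shows "op_eq (Qall N M) (local_op N M (\<lambda>_. op_id)) op_id"
proof -
  have "(\<forall>\<alpha>\<in>M. restr (Qpart N \<alpha>) y = restr (Qpart N \<alpha>) x) \<longleftrightarrow> y = x"
    if "y \<in> basis (Qall N M)" "x \<in> basis (Qall N M)" for x y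
    using basis_Qall_eqI[OF that] by auto
  then show ?thesis by (simp add: op_eq_def local_op_def op_id_def prod_of_bool[OF M])
qed

lemma unitary_local_op:
  assumes M: "finite M" and U: "\<forall>\<alpha>\<in>M. unitary_op (Qpart N \<alpha>) (U \<alpha>)"
  shows "unitary_op (Qall N M) (local_op N M U)"
proof -
  have "local_op N M (\<lambda>\<alpha>. op_mult (Qpart N \<alpha>) (op_adj (U \<alpha>)) (U \<alpha>)) = local_op N M (\<lambda>_. op_id)"
    "local_op N M (\<lambda>\<alpha>. op_mult (Qpart N \<alpha>) (U \<alpha>) (op_adj (U \<alpha>))) = local_op N M (\<lambda>_. op_id)"
    using U by (auto intro!: local_op_cong simp: unitary_op_def)
  then show ?thesis
    using local_op_id[OF M] by (simp add: unitary_op_def op_adj_local local_op_mult[OF M])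
qed

text \<open>The condition that y is x shifted by the X part of f splits into one condition per
  party, and the phases are products over qubits.\<close>

lemma pauli_local:
  assumes M: "finite M" and f: "f \<in> Gn (Qall N M)"
  shows "op_eq (Qall N M) (pauli (Qall N M) f) (local_op N M (\<lambda>\<alpha>. pauli (Qpart N \<alpha>) (pr N \<alpha> f)))"
  unfolding op_eq_def
proof (intro ballI)
  fix y x assume y: "y \<in> basis (Qall N M)" and x: "x \<in> basis (Qall N M)"
  have fx: "flip f x \<in> basis (Qall N M)" using x flip_basis[OF f] by simp
  have "restr (Qpart N \<alpha>) (flip f x) = flip (pr N \<alpha> f) (restr (Qpart N \<alpha>) x)" for \<alpha>
    by (auto simp: flip_def fun_eq_iff)
  then have eq: "y = flip f x \<longleftrightarrow> (\<forall>\<alpha>\<in>M. restr (Qpart N \<alpha>) y = flip (pr N \<alpha> f) (restr (Qpart N \<alpha>) x))"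
    using basis_Qall_eqI[OF y fx] by auto
  show "pauli (Qall N M) f y x = local_op N M (\<lambda>\<alpha>. pauli (Qpart N \<alpha>) (pr N \<alpha> f)) y x"
    unfolding local_op_def pauli_prod[OF finite_Qall[OF M]] pauli_prod[OF finite_Qpart] prod_of_bool[OF M] eq prod_Qall[OF M]
    by (intro if_cong prod.cong) auto
qed

text \<open>The local intertwining relations multiply. Their signs combine into one global sign, and
  the local images are pasted together by \<open>join\<close>.\<close>

lemma pauli_map_local:
  assumes M: "finite M" and u: "\<forall>\<alpha>\<in>M. pauli_map (Qpart N \<alpha>) (U \<alpha>) (u \<alpha>)"
  shows "pauli_map (Qall N M) (local_op N M U) (\<lambda>f. join M (\<lambda>\<alpha>. u \<alpha> (pr N \<alpha> f)))"
  unfolding pauli_map_def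
proof (intro ballI conjI)
  let ?Q = "Qall N M"
  fix f assume f: "f \<in> Gn ?Q"
  let ?u = "\<lambda>\<alpha>. u \<alpha> (pr N \<alpha> f)"
  have uG: "?u \<alpha> \<in> Gn (Qpart N \<alpha>)" if "\<alpha> \<in> M" for \<alpha> using u that by (simp add: pauli_map_def)
  then show jG: "join M ?u \<in> Gn ?Q" by (rule join_Gn)
  note Q = finite_Qall[OF M, of N]
  have "\<forall>\<alpha>\<in>M. \<exists>s. s \<in> {1, -1} \<and> op_eq (Qpart N \<alpha>) (op_mult (Qpart N \<alpha>) (U \<alpha>) (pauli (Qpart N \<alpha>) (pr N \<alpha> f)))
      (\<lambda>y x. s * op_mult (Qpart N \<alpha>) (pauli (Qpart N \<alpha>) (?u \<alpha>)) (U \<alpha>) y x)"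
  proof
    fix \<alpha> assume "\<alpha> \<in> M"
    with u have "pauli_map (Qpart N \<alpha>) (U \<alpha>) (u \<alpha>)" by blast
    from pauli_mapD[OF this pr_Gn] obtain t where "t \<in> {1, -1}"
      "\<And>\<psi>. op_app (Qpart N \<alpha>) (U \<alpha>) (op_app (Qpart N \<alpha>) (pauli (Qpart N \<alpha>) (pr N \<alpha> f)) \<psi>)
        = (\<lambda>y. t * op_app (Qpart N \<alpha>) (pauli (Qpart N \<alpha>) (?u \<alpha>)) (op_app (Qpart N \<alpha>) (U \<alpha>) \<psi>) y)"
      by blast
    then show "\<exists>s. s \<in> {1, -1} \<and> op_eq (Qpart N \<alpha>) (op_mult (Qpart N \<alpha>) (U \<alpha>) (pauli (Qpart N \<alpha>) (pr N \<alpha> f)))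
      (\<lambda>y x. s * op_mult (Qpart N \<alpha>) (pauli (Qpart N \<alpha>) (?u \<alpha>)) (U \<alpha>) y x)"
      by (intro exI[of _ t]) (simp only: op_eq_iff[OF finite_Qpart] op_app_smult_kernel op_app_mult[OF finite_Qpart] simp_thms)
  qed
  then obtain s where s: "\<And>\<alpha>. \<alpha> \<in> M \<Longrightarrow> s \<alpha> \<in> {1, -1}"
    and eq: "\<And>\<alpha>. \<alpha> \<in> M \<Longrightarrow> op_eq (Qpart N \<alpha>) (op_mult (Qpart N \<alpha>) (U \<alpha>) (pauli (Qpart N \<alpha>) (pr N \<alpha> f)))
      (\<lambda>y x. s \<alpha> * op_mult (Qpart N \<alpha>) (pauli (Qpart N \<alpha>) (?u \<alpha>)) (U \<alpha>) y x)"
    unfolding bchoice_iff by (elim exE) blast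
  have "local_op N M (\<lambda>\<alpha>. pauli (Qpart N \<alpha>) (?u \<alpha>)) = local_op N M (\<lambda>\<alpha>. pauli (Qpart N \<alpha>) (pr N \<alpha> (join M ?u)))"
    by (rule local_op_cong) (simp add: pr_join[OF _ uG] op_eq_def)
  then have P: "op_app ?Q (local_op N M (\<lambda>\<alpha>. pauli (Qpart N \<alpha>) (?u \<alpha>))) \<psi> = op_app ?Q (pauli ?Q (join M ?u)) \<psi>" for \<psi>
    using pauli_local[OF M jG] by (simp only: op_eq_iff[OF Q])
  have "op_app ?Q (local_op N M U) (op_app ?Q (pauli ?Q f) \<psi>)
      = (\<lambda>y. (\<Prod>\<alpha>\<in>M. s \<alpha>) * op_app ?Q (pauli ?Q (join M ?u)) (op_app ?Q (local_op N M U) \<psi>) y)" for \<psi>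
  proof -
    have "op_app ?Q (local_op N M U) (op_app ?Q (pauli ?Q f) \<psi>)
      = op_app ?Q (local_op N M U) (op_app ?Q (local_op N M (\<lambda>\<alpha>. pauli (Qpart N \<alpha>) (pr N \<alpha> f))) \<psi>)"
      using pauli_local[OF M f] by (simp only: op_eq_iff[OF Q])
    also have "\<dots> = op_app ?Q (local_op N M (\<lambda>\<alpha>. op_mult (Qpart N \<alpha>) (U \<alpha>) (pauli (Qpart N \<alpha>) (pr N \<alpha> f)))) \<psi>"
      by (simp only: op_app_mult[OF Q, symmetric] local_op_mult[OF M])
    also have "\<dots> = op_app ?Q (\<lambda>y x. (\<Prod>\<alpha>\<in>M. s \<alpha>) *
        local_op N M (\<lambda>\<alpha>. op_mult (Qpart N \<alpha>) (pauli (Qpart N \<alpha>) (?u \<alpha>)) (U \<alpha>)) y x) \<psi>"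
      unfolding local_op_smult[symmetric] by (simp only: local_op_cong[OF eq])
    also have "\<dots> = (\<lambda>y. (\<Prod>\<alpha>\<in>M. s \<alpha>) * op_app ?Q (pauli ?Q (join M ?u)) (op_app ?Q (local_op N M U) \<psi>) y)"
      unfolding op_app_smult_kernel local_op_mult[OF M, symmetric] op_app_mult[OF Q] P ..
    finally show ?thesis .
  qed
  moreover have "(\<Prod>\<alpha>\<in>M. s \<alpha>) \<in> {1, -1}"
  proof -
    have "(\<Prod>\<alpha>\<in>M. s \<alpha>)\<^sup>2 = (\<Prod>\<alpha>\<in>M. 1)"
      unfolding prod_power_distrib by (rule prod.cong) (use s in \<open>simp_all add: power2_eq_1_iff\<close>)
    then show ?thesis by (simp add: power2_eq_1_iff)
  qed
  ultimately show "\<exists>s\<in>{1, -1}. \<forall>\<psi>. op_app ?Q (local_op N M U) (op_app ?Q (pauli ?Q f) \<psi>)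
      = (\<lambda>y. s * op_app ?Q (pauli ?Q (join M ?u)) (op_app ?Q (local_op N M U) \<psi>) y)"
    by blast
qed

section \<open>The co-local subgroups\<close>

lemma gsum_insert:
  "finite F \<Longrightarrow> \<alpha> \<notin> F \<Longrightarrow> gsum (insert \<alpha> F) h = gadd (h \<alpha>) (gsum F h)"
proof (rule pel_eqI)
  fix j assume F: "finite F" "\<alpha> \<notin> F"
  have *: "{\<beta> \<in> insert \<alpha> F. P \<beta>} = (if P \<alpha> then insert \<alpha> {\<beta> \<in> F. P \<beta>} else {\<beta> \<in> F. P \<beta>})" for P
    by auto
  show "fst (gsum (insert \<alpha> F) h) j = fst (gadd (h \<alpha>) (gsum F h)) j"
    "snd (gsum (insert \<alpha> F) h) j = snd (gadd (h \<alpha>) (gsum F h)) j"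
    using F unfolding gsum_def fst_conv snd_conv * by simp_all
qed

lemma gsum_mem:
  assumes "f2_subspace Q V" "finite M" "\<And>\<alpha>. \<alpha> \<in> M \<Longrightarrow> h \<alpha> \<in> V"
  shows "gsum M h \<in> V"
  using assms(2,3)
proof (induction M rule: finite_induct)
  case empty
  have "gsum {} h = gzero" by (simp add: gsum_def gzero_def)
  then show ?case using assms(1) by (simp add: f2_subspace_def)
next
  case (insert \<alpha> F)
  then show ?case using assms(1) by (simp add: gsum_insert f2_subspace_def)
qed

lemma gsum_gadd:
  assumes "finite M"
  shows "gsum M (\<lambda>\<alpha>. gadd (h \<alpha>) (h' \<alpha>)) = gadd (gsum M h) (gsum M h')"
  unfolding gsum_def gadd_def fst_conv snd_conv odd_card_xor[OF assms] ..

lemma colocal_subspace: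
  assumes "f2_subspace Q S"
  shows "f2_subspace Q (colocal N S \<alpha>)"
proof -
  have S: "S \<subseteq> Gn Q" "gzero \<in> S" "\<forall>f\<in>S. \<forall>g\<in>S. gadd f g \<in> S"
    using assms unfolding f2_subspace_def by blast+
  have "colocal N S \<alpha> \<subseteq> Gn Q" unfolding colocal_def using S(1) by blast
  moreover have "gzero \<in> colocal N S \<alpha>" using S(2) by (simp add: colocal_def)
  moreover have "gadd f g \<in> colocal N S \<alpha>" if "f \<in> colocal N S \<alpha>" "g \<in> colocal N S \<alpha>" for f g
    using that S(3) by (simp add: colocal_def)
  ultimately show ?thesis unfolding f2_subspace_def by blast
qed

lemma Sloc_subspace:
  assumes M: "finite M" and S: "f2_subspace Q S"
  shows "f2_subspace Q (Sloc N M S)" "Sloc N M S \<subseteq> S"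
proof -
  show sub: "Sloc N M S \<subseteq> S"
  proof
    fix f assume "f \<in> Sloc N M S"
    then obtain h where h: "f = gsum M h" "\<forall>\<alpha>\<in>M. h \<alpha> \<in> colocal N S \<alpha>" unfolding Sloc_def by blast
    then show "f \<in> S" using gsum_mem[OF S M, of h] by (simp add: colocal_def)
  qed
  have zero: "gzero \<in> colocal N S \<alpha>" for \<alpha>
    using colocal_subspace[OF S] by (simp add: f2_subspace_def)
  have "gsum M (\<lambda>_. gzero) = gzero" by (rule pel_eqI) (simp_all add: gsum_def)
  then have "gzero \<in> Sloc N M S" using zero unfolding Sloc_def by (intro CollectI exI conjI) (rule sym, assumption, blast)
  moreover have "gadd f g \<in> Sloc N M S" if fg: "f \<in> Sloc N M S" "g \<in> Sloc N M S" for f g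
  proof -
    obtain h where h: "f = gsum M h" "\<forall>\<alpha>\<in>M. h \<alpha> \<in> colocal N S \<alpha>"
      using fg(1) unfolding Sloc_def by blast
    obtain h' where h': "g = gsum M h'" "\<forall>\<alpha>\<in>M. h' \<alpha> \<in> colocal N S \<alpha>"
      using fg(2) unfolding Sloc_def by blast
    have "\<forall>\<alpha>\<in>M. gadd (h \<alpha>) (h' \<alpha>) \<in> colocal N S \<alpha>"
      using h(2) h'(2) colocal_subspace[OF S] by (simp add: f2_subspace_def)
    then show ?thesis unfolding Sloc_def h(1) h'(1) gsum_gadd[OF M, symmetric] by blast
  qed
  ultimately show "f2_subspace Q (Sloc N M S)"
    using sub S unfolding f2_subspace_def by blast
qed

lemma colocal_Sloc:
  assumes M: "finite M" and S: "f2_subspace Q S" and \<alpha>: "\<alpha> \<in> M"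
  shows "colocal N S \<alpha> \<subseteq> Sloc N M S"
proof
  fix f assume f: "f \<in> colocal N S \<alpha>"
  have "{\<beta> \<in> M. fst (if \<beta> = \<alpha> then f else gzero) j} = (if fst f j then {\<alpha>} else {})"
    "{\<beta> \<in> M. snd (if \<beta> = \<alpha> then f else gzero) j} = (if snd f j then {\<alpha>} else {})" for j
    using \<alpha> by auto
  then have "gsum M (\<lambda>\<beta>. if \<beta> = \<alpha> then f else gzero) = f"
    unfolding gsum_def by (intro pel_eqI) simp_all
  moreover have "\<forall>\<beta>\<in>M. (if \<beta> = \<alpha> then f else gzero) \<in> colocal N S \<beta>"
    using f colocal_subspace[OF S] by (simp add: f2_subspace_def)
  ultimately show "f \<in> Sloc N M S" unfolding Sloc_def by (intro CollectI exI conjI) (rule sym, assumption, blast)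
qed

text \<open>Double annihilator: \<open>colocal N S \<alpha>\<close> is the annihilator of \<open>S + G\<^sub>\<alpha>\<close>.\<close>

lemma perp_colocal:
  assumes M: "finite M" and S: "self_dual (Qall N M) S" and \<alpha>: "\<alpha> \<in> M" and y: "y \<in> perp (Qall N M) (colocal N S \<alpha>)"
  obtains s z where "s \<in> S" "z \<in> Gn (Qpart N \<alpha>)" "y = gadd s z"
proof -
  let ?Q = "Qall N M"
  note Q = finite_Qall[OF M, of N]
  have sub: "f2_subspace ?Q S" and SS: "perp ?Q S = S" using S by (simp_all add: self_dual_perp)
  have G: "f2_subspace ?Q (Gn (Qpart N \<alpha>))"
    using Gn_Qpart[OF \<alpha>] by (auto simp only: f2_subspace_def gzero_Gn gadd_Gn)
  let ?V = "{gadd f g | f g. f \<in> S \<and> g \<in> Gn (Qpart N \<alpha>)}"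
  have V: "f2_subspace ?Q ?V" by (rule f2_sum_space[OF sub G])
  have "perp ?Q ?V \<subseteq> colocal N S \<alpha>"
  proof
    fix f assume f: "f \<in> perp ?Q ?V"
    have "\<not> omega ?Q f g" if "g \<in> S" for g
    proof -
      have "gadd g gzero \<in> ?V" using that gzero_Gn by blast
      then show ?thesis using perpD[OF f] by fastforce
    qed
    then have "f \<in> S" using f SS by (auto simp only: perp_def mem_Collect_eq)
    have z: "\<not> omega ?Q f g" if "g \<in> Gn (Qpart N \<alpha>)" for g
    proof -
      have "gadd gzero g \<in> ?V" using that sub by (auto simp only: f2_subspace_def)
      then show ?thesis using perpD[OF f] by fastforce
    qed
    have "\<not> fst f j \<and> \<not> snd f j" if "j \<in> Qpart N \<alpha>" for j
      using z[of "Xel j"] z[of "Zel j"] that Qpart_subset[OF \<alpha>, of N]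
      by (auto simp only: omega_commute[of ?Q f] omega_Xel omega_Zel XZ_Gn subset_iff)
    then show "f \<in> colocal N S \<alpha>" using \<open>f \<in> S\<close> by (simp add: colocal_def)
  qed
  then have "perp ?Q (colocal N S \<alpha>) \<subseteq> perp ?Q (perp ?Q ?V)" unfolding perp_def by blast
  then have "y \<in> ?V" using y perp_perp[OF Q V] by blast
  then show ?thesis using that by blast
qed

lemma omega_join:
  assumes M: "finite M" and "\<alpha> \<in> M"
  shows "omega (Qpart N \<alpha>) (join M h) f \<longleftrightarrow> omega (Qpart N \<alpha>) (h \<alpha>) f"
  by (rule omega_cong) (use assms in \<open>simp_all add: Qpart_iff\<close>)

text \<open>The \<open>z k \<alpha>\<close> represent the dual functionals of the \<open>g k\<close> locally at each party; the even
  combinations of the \<open>z k \<alpha>\<close> over \<open>\<alpha>\<close> lie in \<open>S\<close> and are used to make the \<open>g k\<close> commute locally.\<close>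

lemma ghz_generators:
  assumes M: "finite M" "card M \<ge> 3" and S: "self_dual (Qall N M) S"
  defines "D \<equiv> f2dim S - f2dim (Sloc N M S)"
  shows "\<exists>g z. (\<forall>k<D. g k \<in> S) \<and> (\<forall>k<D. \<forall>\<alpha>\<in>M. z k \<alpha> \<in> Gn (Qpart N \<alpha>))
    \<and> (\<forall>k<D. \<forall>\<alpha>\<in>M. \<forall>\<beta>\<in>M. gadd (z k \<alpha>) (z k \<beta>) \<in> S)
    \<and> (\<forall>k<D. \<forall>l<D. \<forall>\<alpha>\<in>M. \<not> omega (Qpart N \<alpha>) (g k) (g l)
      \<and> \<not> omega (Qpart N \<alpha>) (z k \<alpha>) (z l \<alpha>) \<and> omega (Qpart N \<alpha>) (g k) (z l \<alpha>) = (k = l))"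
proof -
  let ?Q = "Qall N M" and ?w = "\<lambda>\<alpha>. omega (Qpart N \<alpha>)"
  note Q = finite_Qall[OF M(1), of N]
  have sub: "f2_subspace ?Q S" and SS: "perp ?Q S = S" using S by (simp_all add: self_dual_perp)
  have S_Gn: "f \<in> Gn ?Q" if "f \<in> S" for f using sub that by (auto simp only: f2_subspace_def)
  have S_om: "\<not> omega ?Q f f'" if "f \<in> S" "f' \<in> S" for f f'
    using SS that unfolding perp_def by blast
  have S_add: "gadd f f' \<in> S" if "f \<in> S" "f' \<in> S" for f f' using sub that by (simp add: f2_subspace_def)
  have S_mem: "f \<in> S" if "f \<in> Gn ?Q" "\<And>f'. f' \<in> S \<Longrightarrow> \<not> omega ?Q f f'" for f
    using SS that unfolding perp_def by blast
  note L = Sloc_subspace[OF M(1) sub, of N]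
  obtain d g0 y where d: "card S = 2 ^ d * card (Sloc N M S)"
    and gy: "\<forall>k<d. g0 k \<in> S \<and> y k \<in> perp ?Q (Sloc N M S)"
    and dual: "\<forall>k<d. \<forall>l<d. omega ?Q (y k) (g0 l) = (k = l)"
    using relative_basis[OF Q L(1) sub L(2)] by (elim exE conjE)
  have "(2::nat) ^ f2dim S = 2 ^ (d + f2dim (Sloc N M S))"
    using d card_f2_subspace[OF Q sub] card_f2_subspace[OF Q L(1)] by (simp add: power_add)
  then have D: "D = d" by (simp add: D_def)
  \<comment> \<open>y_k annihilates S_loc and therefore each co-local subgroup, so modulo S it can
    be represented at any single party.\<close>
  have "\<exists>s z. s \<in> S \<and> z \<in> Gn (Qpart N \<alpha>) \<and> y k = gadd s z" if "k < d" "\<alpha> \<in> M" for k \<alpha>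
  proof -
    have "y k \<in> perp ?Q (colocal N S \<alpha>)"
      using gy that colocal_Sloc[OF M(1) sub that(2), of N] unfolding perp_def by blast
    then show ?thesis using perp_colocal[OF M(1) S that(2)] by metis
  qed
  then obtain s z where sz: "\<And>k \<alpha>. k < d \<Longrightarrow> \<alpha> \<in> M \<Longrightarrow> s k \<alpha> \<in> S \<and> z k \<alpha> \<in> Gn (Qpart N \<alpha>) \<and> y k = gadd (s k \<alpha>) (z k \<alpha>)"
    by metis
  have zG: "z k \<alpha> \<in> Gn ?Q" if "k < d" "\<alpha> \<in> M" for k \<alpha> using sz[OF that] Gn_Qpart[OF that(2)] by blast
  \<comment> \<open>The summand in S pairs trivially with S, so the local summand alone carries the
    functional, whichever party is chosen.\<close>
  have yz: "omega ?Q (y k) f \<longleftrightarrow> ?w \<alpha> (z k \<alpha>) f" if "k < d" "\<alpha> \<in> M" "f \<in> S" for k \<alpha> f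
    using sz[OF that(1,2)] S_om[of "s k \<alpha>" f] that(3) omega_one_party[OF M(1) that(2)]
    by (simp add: omega_gadd'[OF Q])
  have zz: "gadd (z k \<alpha>) (z k \<beta>) \<in> S" if "k < d" "\<alpha> \<in> M" "\<beta> \<in> M" for k \<alpha> \<beta>
  proof (rule S_mem)
    show "gadd (z k \<alpha>) (z k \<beta>) \<in> Gn ?Q" using zG that by blast
    show "\<not> omega ?Q (gadd (z k \<alpha>) (z k \<beta>)) f" if f: "f \<in> S" for f
      using yz[of k \<alpha> f] yz[of k \<beta> f] f \<open>k < d\<close> \<open>\<alpha> \<in> M\<close> \<open>\<beta> \<in> M\<close> sz omega_one_party[OF M(1), of _ _ N f]
      by (simp add: omega_gadd'[OF Q])
  qed
  \<comment> \<open>The bound of three on the number of parties enters here: \<gamma> is a party at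
    which the sum is trivial.\<close>
  have y_zz: "\<not> omega ?Q (y l) (gadd (z k \<alpha>) (z k \<beta>))" if "k < d" "l < d" "\<alpha> \<in> M" "\<beta> \<in> M" for k l \<alpha> \<beta>
  proof -
    have "card {\<alpha>, \<beta>} < card M" using M(2) card_insert_le_m1[of 2 "{\<beta>}" \<alpha>] by simp
    then have "\<not> M \<subseteq> {\<alpha>, \<beta>}" using card_mono[of "{\<alpha>, \<beta>}" M] by auto
    then obtain \<gamma> where \<gamma>: "\<gamma> \<in> M" "\<gamma> \<noteq> \<alpha>" "\<gamma> \<noteq> \<beta>" by blast
    have "gadd (z k \<alpha>) (z k \<beta>) \<in> colocal N S \<gamma>"
      using zz[OF that(1,3,4)] sz[OF that(1,3)] sz[OF that(1,4)] \<gamma>(2,3)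
      by (auto simp: colocal_def Qpart_iff dest!: Gn_QpartD)
    then have "gadd (z k \<alpha>) (z k \<beta>) \<in> Sloc N M S" using colocal_Sloc[OF M(1) sub \<gamma>(1)] by blast
    then show ?thesis using gy that(2) unfolding perp_def by blast
  qed
  \<comment> \<open>The pairing of z_l at \<alpha> with z_k equals its pairing with the sum of z_k
    over \<alpha> and \<beta>, an element of S on which y_l vanishes.\<close>
  have comm: "\<not> ?w \<alpha> (z l \<alpha>) (z k \<alpha>)" if kl: "k < d" "l < d" and \<alpha>: "\<alpha> \<in> M" for k l \<alpha>
  proof -
    have "\<not> M \<subseteq> {\<alpha>}" using card_mono[of "{\<alpha>}" M] M(2) by auto
    then obtain \<beta> where \<beta>: "\<beta> \<in> M" "\<beta> \<noteq> \<alpha>" by blast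
    have "?w \<alpha> (z l \<alpha>) (gadd (z k \<alpha>) (z k \<beta>)) = ?w \<alpha> (z l \<alpha>) (z k \<alpha>)"
    proof (rule omega_cong)
      fix j assume j: "j \<in> Qpart N \<alpha>"
      then have "\<not> fst (z k \<beta>) j \<and> \<not> snd (z k \<beta>) j"
        using sz[OF kl(1) \<beta>(1)] Gn_QpartD[of "z k \<beta>" N \<beta> j] \<beta>(2) by (auto simp: Qpart_iff)
      then show "fst (gadd (z k \<alpha>) (z k \<beta>)) j = fst (z k \<alpha>) j \<and> snd (gadd (z k \<alpha>) (z k \<beta>)) j = snd (z k \<alpha>) j"
        by simp
    qed simp
    then show ?thesis
      using yz[OF kl(2) \<alpha> zz[OF kl(1) \<alpha> \<beta>(1)]] y_zz[OF kl \<alpha> \<beta>(1)] by simp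
  qed
  \<comment> \<open>c records the commutation defect of two generators at one party. The combination
    h_k uses only indices l < k, so each pair is corrected exactly once; on the diagonal the defect
    is zero.\<close>
  define c where "c k \<alpha> l \<longleftrightarrow> ?w \<alpha> (g0 k) (g0 l)" for k \<alpha> l
  define h where "h k \<alpha> = gcomb k (\<lambda>l. z l \<alpha>) (c k \<alpha>)" for k \<alpha>
  define g where "g k = gadd (g0 k) (join M (h k))" for k
  \<comment> \<open>The generators commute globally, so they anticommute at an even number of
    parties.\<close>
  have c_even: "even (card {\<alpha> \<in> M. c k \<alpha> l})" if "k < d" "l < d" for k l
    using S_om[of "g0 k" "g0 l"] gy that omega_parties[OF M(1)] unfolding c_def by blast
  \<comment> \<open>At every selected party z_l pairs with f in S to the same value, so an even
    number of selected parties gives total pairing zero.\<close>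
  have join_S: "join M (\<lambda>\<alpha>. if P \<alpha> then z l \<alpha> else gzero) \<in> S" if "l < d" "even (card {\<alpha> \<in> M. P \<alpha>})" for P l
  proof (rule S_mem)
    show "join M (\<lambda>\<alpha>. if P \<alpha> then z l \<alpha> else gzero) \<in> Gn ?Q"
      by (rule join_Gn) (use sz that(1) in simp)
    fix f assume f: "f \<in> S"
    have "{\<alpha> \<in> M. ?w \<alpha> (join M (\<lambda>\<alpha>. if P \<alpha> then z l \<alpha> else gzero)) f}
        = (if omega ?Q (y l) f then {\<alpha> \<in> M. P \<alpha>} else {})"
      using yz[OF that(1) _ f] by (auto simp: omega_join[OF M(1)] split: if_splits)
    then show "\<not> omega ?Q (join M (\<lambda>\<alpha>. if P \<alpha> then z l \<alpha> else gzero)) f"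
      using that(2) by (simp add: omega_parties[OF M(1)])
  qed
  have h_S: "join M (h k) \<in> S" if k: "k < d" for k
  proof -
    have "join M (\<lambda>\<alpha>. gcomb n (\<lambda>l. z l \<alpha>) (c k \<alpha>)) \<in> S" if "n \<le> d" for n
      using that
    proof (induction n)
      case 0
      have "join M (\<lambda>\<alpha>. gzero) = gzero" by (rule pel_eqI) simp_all
      then show ?case using sub by (simp add: f2_subspace_def)
    next
      case (Suc n)
      have "join M (\<lambda>\<alpha>. gcomb (Suc n) (\<lambda>l. z l \<alpha>) (c k \<alpha>))
        = gadd (join M (\<lambda>\<alpha>. gcomb n (\<lambda>l. z l \<alpha>) (c k \<alpha>))) (join M (\<lambda>\<alpha>. if c k \<alpha> n then z n \<alpha> else gzero))"
        by (rule pel_eqI) auto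
      then show ?case using Suc join_S[of n "\<lambda>\<alpha>. c k \<alpha> n"] c_even[OF k, of n] S_add by simp
    qed
    then show ?thesis unfolding h_def using k by simp
  qed
  \<comment> \<open>Instantiating the index of \<open>omega_gcomb\<close> with the length k encodes
    that all z's at a party commute: the index is out of range, so the pairing is zero.\<close>
  have wz_h: "\<not> ?w \<alpha> (z l \<alpha>) (h k \<alpha>)" if "k < d" "l < d" "\<alpha> \<in> M" for k l \<alpha>
    unfolding h_def using omega_gcomb[OF finite_Qpart, of k "c k \<alpha>" N \<alpha> "z l \<alpha>" "\<lambda>l. z l \<alpha>" k] comm that by simp
  have wg0_z: "?w \<alpha> (g0 k) (z l \<alpha>) = (k = l)" if "k < d" "l < d" "\<alpha> \<in> M" for k l \<alpha>
    using yz[OF that(2,3), of "g0 k"] gy dual that by (auto simp: omega_commute[of _ "g0 k"])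
  have wg0_h: "?w \<alpha> (g0 l) (h k \<alpha>) \<longleftrightarrow> l < k \<and> c k \<alpha> l" if "k < d" "l < d" "\<alpha> \<in> M" for k l \<alpha>
    unfolding h_def using wg0_z that by (intro omega_gcomb[OF finite_Qpart]) auto
  have wh_h: "\<not> ?w \<alpha> (h l \<alpha>) (h k \<alpha>)" if "k < d" "l < d" "\<alpha> \<in> M" for k l \<alpha>
  proof -
    have "\<not> ?w \<alpha> (h l \<alpha>) (z j \<alpha>)" if "j < d" for j
      using wz_h[OF \<open>l < d\<close> that \<open>\<alpha> \<in> M\<close>] by (simp add: omega_commute)
    then show ?thesis
      unfolding h_def[of k] using omega_gcomb[OF finite_Qpart, of k "c k \<alpha>" N \<alpha> "h l \<alpha>" "\<lambda>l. z l \<alpha>" k] that by simp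
  qed
  show ?thesis
    unfolding D
  proof (intro exI[of _ g] exI[of _ z] conjI allI impI ballI)
    show "g k \<in> S" if "k < d" for k unfolding g_def using S_add gy h_S that by blast
    show "z k \<alpha> \<in> Gn (Qpart N \<alpha>)" if "k < d" "\<alpha> \<in> M" for k \<alpha> using sz that by blast
    show "gadd (z k \<alpha>) (z k \<beta>) \<in> S" if "k < d" "\<alpha> \<in> M" "\<beta> \<in> M" for k \<alpha> \<beta> using zz that by blast
    fix k l \<alpha> assume that: "k < d" "l < d" "\<alpha> \<in> M"
    have wj: "?w \<alpha> f (join M (h l)) = ?w \<alpha> f (h l \<alpha>)" "?w \<alpha> (join M (h l)) f = ?w \<alpha> (h l \<alpha>) f" for f l
      using omega_join[OF M(1) that(3)] omega_commute by metis+
    have "c k \<alpha> k = False" "c k \<alpha> l = c l \<alpha> k" unfolding c_def using omega_commute[of _ "g0 k"] by auto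
    \<comment> \<open>The defect c meets one equal term from the correction of the larger index; the
      smaller index contributes nothing, and the two corrections commute.\<close>
    then have "\<not> ?w \<alpha> (g k) (g l)"
      using wg0_h[OF that(2,1,3)] wg0_h[OF that] wh_h[OF that(2,1,3)] that
      unfolding g_def
      by (cases k l rule: linorder_cases)
        (auto simp: omega_gadd omega_gadd' wj omega_commute[of _ "h k \<alpha>" "g0 l"] c_def[symmetric])
    moreover have "?w \<alpha> (g k) (z l \<alpha>) = (k = l)"
      unfolding g_def using wg0_z[OF that] wz_h[OF that]
      by (simp add: omega_gadd' wj omega_commute[of _ "h k \<alpha>"])
    ultimately show "\<not> ?w \<alpha> (g k) (g l)" "\<not> ?w \<alpha> (z k \<alpha>) (z l \<alpha>)" "?w \<alpha> (g k) (z l \<alpha>) = (k = l)"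
      using comm that by blast+
  qed
qed

section \<open>Recognizing GHZ factors\<close>

definition XX :: "'p set \<Rightarrow> nat \<Rightarrow> ('p \<times> nat) pel" where
  "XX M k = join M (\<lambda>\<alpha>. Xel (\<alpha>, k))"

text \<open>Qubit (\<alpha>, i) of the residual state is qubit (\<alpha>, i + q) of the full
  register. Strings are embedded with zeros on the GHZ copies, and \<open>drp\<close> forgets those
  copies.\<close>

definition lft :: "nat \<Rightarrow> ('p \<times> nat \<Rightarrow> bool) \<Rightarrow> 'p \<times> nat \<Rightarrow> bool" where
  "lft q w = (\<lambda>j. q \<le> snd j \<and> w (fst j, snd j - q))"

definition drp :: "nat \<Rightarrow> ('p \<times> nat \<Rightarrow> bool) \<Rightarrow> 'p \<times> nat \<Rightarrow> bool" where
  "drp q y = (\<lambda>(\<alpha>, i). y (\<alpha>, i + q))"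

definition lftp :: "nat \<Rightarrow> ('p \<times> nat) pel \<Rightarrow> ('p \<times> nat) pel" where
  "lftp q f = (lft q (fst f), lft q (snd f))"

definition drpp :: "nat \<Rightarrow> ('p \<times> nat) pel \<Rightarrow> ('p \<times> nat) pel" where
  "drpp q f = (drp q (fst f), drp q (snd f))"

lemma lft_apply [simp]: "lft q w j \<longleftrightarrow> q \<le> snd j \<and> w (fst j, snd j - q)"
  by (simp add: lft_def)

lemma drp_apply [simp]: "drp q y j \<longleftrightarrow> y (fst j, snd j + q)"
  by (simp add: drp_def split: prod.split)

lemma lftp_simps [simp]: "fst (lftp q f) = lft q (fst f)" "snd (lftp q f) = lft q (snd f)"
  by (simp_all add: lftp_def)

lemma drpp_simps [simp]: "fst (drpp q f) = drp q (fst f)" "snd (drpp q f) = drp q (snd f)"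
  by (simp_all add: drpp_def)

lemma drp_lft [simp]: "drp q (lft q w) = w" by (simp add: fun_eq_iff)

lemma lft_drp: "lft q (drp q y) = (\<lambda>j. y j \<and> q \<le> snd j)" by (auto simp: fun_eq_iff)

lemma XX_simps [simp]: "fst (XX M k) j \<longleftrightarrow> fst j \<in> M \<and> snd j = k" "snd (XX M k) j \<longleftrightarrow> False"
  by (auto simp: XX_def prod_eq_iff)

lemma lft_basis: "\<forall>\<alpha>\<in>M. q \<le> N \<alpha> \<Longrightarrow> lft q w \<in> basis (Qall N M) \<longleftrightarrow> w \<in> basis (Qall (\<lambda>\<alpha>. N \<alpha> - q) M)"
proof
  assume q: "\<forall>\<alpha>\<in>M. q \<le> N \<alpha>" and l: "lft q w \<in> basis (Qall N M)"
  have "\<not> w j" if "j \<notin> Qall (\<lambda>\<alpha>. N \<alpha> - q) M" for j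
  proof -
    have "(fst j, snd j + q) \<notin> Qall N M" using that q by (auto simp: Qall_iff)
    then have "\<not> lft q w (fst j, snd j + q)" using l unfolding basis_def by blast
    then show ?thesis by simp
  qed
  then show "w \<in> basis (Qall (\<lambda>\<alpha>. N \<alpha> - q) M)" unfolding basis_def by blast
next
  assume w: "w \<in> basis (Qall (\<lambda>\<alpha>. N \<alpha> - q) M)"
  have "\<not> lft q w j" if "j \<notin> Qall N M" for j
  proof -
    have "\<not> w (fst j, snd j - q)" if "q \<le> snd j"
    proof -
      have "(fst j, snd j - q) \<notin> Qall (\<lambda>\<alpha>. N \<alpha> - q) M" using that \<open>j \<notin> Qall N M\<close> by (auto simp: Qall_iff)
      then show ?thesis using w unfolding basis_def by blast
    qed
    then show ?thesis by simp
  qed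
  then show "lft q w \<in> basis (Qall N M)" unfolding basis_def by blast
qed

lemma Gn_basis: "f \<in> Gn Q \<longleftrightarrow> fst f \<in> basis Q \<and> snd f \<in> basis Q"
  unfolding Gn_iff basis_def by blast

lemma lftp_Gn: "\<forall>\<alpha>\<in>M. q \<le> N \<alpha> \<Longrightarrow> lftp q f \<in> Gn (Qall N M) \<longleftrightarrow> f \<in> Gn (Qall (\<lambda>\<alpha>. N \<alpha> - q) M)"
  by (simp add: Gn_basis lft_basis)

lemma drp_basis:
  assumes "\<forall>\<alpha>\<in>M. q \<le> N \<alpha>" "y \<in> basis (Qall N M)"
  shows "drp q y \<in> basis (Qall (\<lambda>\<alpha>. N \<alpha> - q) M)"
proof -
  have "lft q (drp q y) \<in> basis (Qall N M)" using assms(2) unfolding lft_drp basis_def by blast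
  then show ?thesis using lft_basis[OF assms(1)] by blast
qed

lemma drpp_Gn: "\<forall>\<alpha>\<in>M. q \<le> N \<alpha> \<Longrightarrow> f \<in> Gn (Qall N M) \<Longrightarrow> drpp q f \<in> Gn (Qall (\<lambda>\<alpha>. N \<alpha> - q) M)"
  by (simp add: Gn_basis drp_basis)

section \<open>Separating the GHZ qubits from the residual register\<close>

abbreviation low :: "'p set \<Rightarrow> nat \<Rightarrow> ('p \<times> nat) set" where
  "low M q \<equiv> M \<times> {..<q}"

abbreviation high :: "('p \<Rightarrow> nat) \<Rightarrow> 'p set \<Rightarrow> nat \<Rightarrow> ('p \<times> nat) set" where
  "high N M q \<equiv> {j \<in> Qall N M. q \<le> snd j}"

lemma Qall_split: "\<forall>\<alpha>\<in>M. q \<le> N \<alpha> \<Longrightarrow> Qall N M = low M q \<union> high N M q"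
  by (auto simp: Qall_iff)

lemma high_bij: "bij_betw (\<lambda>j. (fst j, snd j + q)) (Qall (\<lambda>\<alpha>. N \<alpha> - q) M) (high N M q)"
  by (rule bij_betwI[where g = "\<lambda>j. (fst j, snd j - q)"]) (auto simp: Qall_iff)

lemma omega_Un:
  assumes "finite A" "finite B" "A \<inter> B = {}"
  shows "omega (A \<union> B) f g \<longleftrightarrow> omega A f g \<noteq> omega B f g"
proof -
  let ?P = "\<lambda>j. (fst f j \<and> snd g j) \<noteq> (snd f j \<and> fst g j)"
  have "{j \<in> A \<union> B. ?P j} = {j \<in> A. ?P j} \<union> {j \<in> B. ?P j}" by blast
  moreover have "card ({j \<in> A. ?P j} \<union> {j \<in> B. ?P j}) = card {j \<in> A. ?P j} + card {j \<in> B. ?P j}"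
    using assms by (intro card_Un_disjoint) auto
  ultimately show ?thesis unfolding omega_def by (simp only: even_add) blast
qed

lemma omega_high:
  "omega (high N M q) f g = omega (Qall (\<lambda>\<alpha>. N \<alpha> - q) M) (drpp q f) (drpp q g)"
proof -
  let ?P = "\<lambda>j. (fst f j \<and> snd g j) \<noteq> (snd f j \<and> fst g j)" and ?s = "\<lambda>j. (fst j, snd j + q)"
    and ?Q = "Qall (\<lambda>\<alpha>. N \<alpha> - q) M"
  have "card {j \<in> high N M q. ?P j} = card (?s ` {j \<in> ?Q. ?P (?s j)})"
    using high_bij[of q N M] unfolding bij_betw_def
    by (intro arg_cong[where f = card]) (elim conjE, erule subst, blast)
  also have "\<dots> = card {j \<in> ?Q. ?P (?s j)}"
    by (rule card_image, rule inj_on_subset[OF bij_betw_imp_inj_on[OF high_bij[of q N M]]]) blast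
  finally show ?thesis unfolding omega_def drpp_simps drp_apply by simp
qed

text \<open>Extension by zero and restriction are adjoint for the two forms, since the extended
  element is trivial on the GHZ qubits.\<close>

lemma omega_lftp:
  assumes M: "finite M" and q: "\<forall>\<alpha>\<in>M. q \<le> N \<alpha>"
  shows "omega (Qall N M) (lftp q f) g = omega (Qall (\<lambda>\<alpha>. N \<alpha> - q) M) f (drpp q g)"
proof -
  have fin: "finite (low M q)" "finite (high N M q)" using M by (simp_all add: finite_Qall)
  have dis: "low M q \<inter> high N M q = {}" by auto
  have "omega (low M q) (lftp q f) g = omega (low M q) gzero g"
    by (rule omega_cong) (simp_all add: mem_Times_iff)
  moreover have "drpp q (lftp q f) = f" by (rule pel_eqI) simp_all
  ultimately show ?thesis
    using omega_Un[OF fin, of "lftp q f" g] omega_high[of N M q "lftp q f" g] dis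
    unfolding Qall_split[OF q, symmetric] by simp
qed

section \<open>Commutation and action of the GHZ generators\<close>

lemma omega_XX:
  assumes M: "finite M" and k: "\<forall>\<alpha>\<in>M. k < N \<alpha>"
  shows "omega (Qall N M) (XX M k) f \<longleftrightarrow> odd (card {\<alpha> \<in> M. snd f (\<alpha>, k)})"
proof -
  have "omega (Qpart N \<alpha>) (XX M k) f \<longleftrightarrow> snd f (\<alpha>, k)" if "\<alpha> \<in> M" for \<alpha>
    using omega_join[OF M that, of N] omega_Xel[of "(\<alpha>, k)" "Qpart N \<alpha>" f] k that
    unfolding XX_def by (simp add: Qpart_iff)
  then have "{\<alpha> \<in> M. omega (Qpart N \<alpha>) (XX M k) f} = {\<alpha> \<in> M. snd f (\<alpha>, k)}" by blast
  then show ?thesis by (simp add: omega_parties[OF M])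
qed

lemma omega_ZZ:
  assumes "finite Q" "a \<in> Q" "b \<in> Q"
  shows "omega Q (gadd (Zel a) (Zel b)) f \<longleftrightarrow> fst f a \<noteq> fst f b"
  using assms by (simp add: omega_gadd' omega_Zel)

text \<open>On copy k the pairing is A times the Z parity of g plus B times the Z parity of f, and
  both parities are even. In other words, what commutes with the GHZ generators is isotropic on the
  GHZ qubits.\<close>

lemma not_omega_low:
  assumes M: "finite M"
    and a: "\<And>k. k < q \<Longrightarrow> \<exists>A B. \<forall>\<alpha>\<in>M. fst f (\<alpha>, k) = A \<and> fst g (\<alpha>, k) = B"
    and b: "\<And>k. k < q \<Longrightarrow> even (card {\<alpha> \<in> M. snd f (\<alpha>, k)}) \<and> even (card {\<alpha> \<in> M. snd g (\<alpha>, k)})"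
  shows "\<not> omega (low M q) f g"
  using a b
proof (induction q)
  case (Suc q)
  let ?P = "\<lambda>j. (fst f j \<and> snd g j) \<noteq> (snd f j \<and> fst g j)"
  obtain A B where AB: "\<forall>\<alpha>\<in>M. fst f (\<alpha>, q) = A \<and> fst g (\<alpha>, q) = B" using Suc.prems(1)[of q] by auto
  have ev: "even (card {\<alpha> \<in> M. snd f (\<alpha>, q)})" "even (card {\<alpha> \<in> M. snd g (\<alpha>, q)})" using Suc.prems(2) by auto
  have "{j \<in> (\<lambda>\<alpha>. (\<alpha>, q)) ` M. ?P j} = (\<lambda>\<alpha>. (\<alpha>, q)) ` {\<alpha> \<in> M. (A \<and> snd g (\<alpha>, q)) \<noteq> (B \<and> snd f (\<alpha>, q))}"
    using AB by auto
  then have "card {j \<in> (\<lambda>\<alpha>. (\<alpha>, q)) ` M. ?P j} = card {\<alpha> \<in> M. (A \<and> snd g (\<alpha>, q)) \<noteq> (B \<and> snd f (\<alpha>, q))}"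
    by (simp add: card_image inj_on_def)
  then have 2: "\<not> omega ((\<lambda>\<alpha>. (\<alpha>, q)) ` M) f g"
    unfolding omega_def using ev odd_card_xor[OF M, of "\<lambda>\<alpha>. A \<and> snd g (\<alpha>, q)" "\<lambda>\<alpha>. B \<and> snd f (\<alpha>, q)"]
    by (cases A; cases B) simp_all
  have "low M (Suc q) = low M q \<union> (\<lambda>\<alpha>. (\<alpha>, q)) ` M" by auto
  moreover have "omega (low M q \<union> (\<lambda>\<alpha>. (\<alpha>, q)) ` M) f g \<longleftrightarrow> omega (low M q) f g \<noteq> omega ((\<lambda>\<alpha>. (\<alpha>, q)) ` M) f g"
    using M by (intro omega_Un) auto
  ultimately show ?case using 2 Suc by simp
qed (simp add: omega_def)

lemma pauli_Zel:
  assumes "finite Q" "a \<in> Q"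
  shows "op_app Q (pauli Q (Zel a)) \<psi> y = (if y \<in> basis Q then (if y a then - 1 else 1) * \<psi> y else 0)"
proof -
  have "flip (Zel a) y = y" by (simp add: flip_def)
  moreover have "(\<Prod>j\<in>Q. phase1 False (j = a) (y j)) = (\<Prod>j\<in>Q. if a = j then (if y a then - 1 else 1) else 1)"
    by (rule prod.cong) (auto simp: phase1_def)
  ultimately show ?thesis using assms by (simp add: pauli_app)
qed

lemma pauli_ZZ:
  assumes "finite Q" "a \<in> Q" "b \<in> Q"
  shows "op_app Q (pauli Q (gadd (Zel a) (Zel b))) \<psi> y
    = (if y \<in> basis Q then (if y a = y b then 1 else - 1) * \<psi> y else 0)"
proof -
  have "cocycle Q (Zel a) (Zel b) = 1"
    unfolding cocycle_def by (rule prod.neutral) (auto simp: cocycle1_def phase1_def)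
  then have "op_app Q (pauli Q (gadd (Zel a) (Zel b))) \<psi> y = op_app Q (pauli Q (Zel a)) (op_app Q (pauli Q (Zel b)) \<psi>) y"
    using assms by (simp add: pauli_mult)
  then show ?thesis using assms by (simp add: pauli_Zel)
qed

lemma XX_Gn: "\<forall>\<alpha>\<in>M. k < N \<alpha> \<Longrightarrow> XX M k \<in> Gn (Qall N M)"
  unfolding Gn_iff by (auto simp: Qall_iff)

lemma pauli_XX:
  assumes "finite M" "\<forall>\<alpha>\<in>M. k < N \<alpha>"
  shows "op_app (Qall N M) (pauli (Qall N M) (XX M k)) \<psi> y
    = (if y \<in> basis (Qall N M) then \<psi> (flip (XX M k) y) else 0)"
  using pauli_app[OF finite_Qall[OF assms(1)] XX_Gn[OF assms(2)]] by (simp add: phase1_def)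

definition ghz_cond :: "'p set \<Rightarrow> nat \<Rightarrow> ('p \<times> nat \<Rightarrow> bool) \<Rightarrow> bool" where
  "ghz_cond M q y \<longleftrightarrow> (\<forall>k<q. \<forall>\<alpha>\<in>M. \<forall>\<beta>\<in>M. y (\<alpha>, k) = y (\<beta>, k))"

lemma ghz_times_eq: "ghz_times M q \<psi>'' y = (if ghz_cond M q y then of_real ((1 / sqrt 2) ^ q) else 0) * \<psi>'' (drp q y)"
  by (simp only: ghz_times_def ghz_cond_def drp_def)

lemma ghz_cond_flip: "ghz_cond M q (flip (XX M k) y) \<longleftrightarrow> ghz_cond M q y"
  unfolding ghz_cond_def flip_def by auto

lemma drp_flip: "k < q \<Longrightarrow> drp q (flip (XX M k) y) = drp q y"
  by (auto simp: flip_def)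

text \<open>A string constant on each copy is a choice of q common bits together with a residual
  string. The factor 2^q matches the normalization of the GHZ amplitudes.\<close>

lemma sum_ghz_cond:
  fixes F :: "('p \<times> nat \<Rightarrow> bool) \<Rightarrow> real"
  assumes M: "finite M" "M \<noteq> {}" and q: "\<forall>\<alpha>\<in>M. q \<le> N \<alpha>"
  shows "(\<Sum>y\<in>{y \<in> basis (Qall N M). ghz_cond M q y}. F (drp q y)) = 2 ^ q * (\<Sum>w\<in>basis (Qall (\<lambda>\<alpha>. N \<alpha> - q) M). F w)"
proof -
  obtain \<alpha>0 where \<alpha>0: "\<alpha>0 \<in> M" using M(2) by blast
  let ?g = "\<lambda>p j. fst j \<in> M \<and> (if snd j < q then snd j \<in> fst p else lft q (snd p) j)"
  let ?f = "\<lambda>y. ({k. k < q \<and> y (\<alpha>0, k)}, drp q y)"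
  let ?B = "Pow {..<q} \<times> basis (Qall (\<lambda>\<alpha>. N \<alpha> - q) M)"
  let ?C = "{y \<in> basis (Qall N M). ghz_cond M q y}"
  have "bij_betw ?f ?C ?B"
  proof (rule bij_betwI[where g = ?g])
    show "?f \<in> ?C \<rightarrow> ?B" using drp_basis[OF q] by auto
    show "?g \<in> ?B \<rightarrow> ?C"
    proof
      fix p assume p: "p \<in> ?B"
      have l: "lft q (snd p) \<in> basis (Qall N M)" using p lft_basis[OF q] by auto
      have "\<not> ?g p j" if "j \<notin> Qall N M" for j
      proof (cases "snd j < q")
        case True
        then show ?thesis using that q by (auto simp only: Qall_iff less_le_trans)
      next
        case False
        have "\<not> lft q (snd p) j" using l that unfolding basis_def by blast
        with False show ?thesis by simp
      qed
      then have "?g p \<in> basis (Qall N M)" unfolding basis_def by blast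
      moreover have "ghz_cond M q (?g p)" unfolding ghz_cond_def by simp
      ultimately show "?g p \<in> ?C" by blast
    qed
    show "?g (?f y) = y" if y: "y \<in> ?C" for y
    proof
      fix j
      have "y j \<Longrightarrow> fst j \<in> M" using y Qall_iff[of j N M] unfolding basis_def by blast
      moreover have "y j = y (\<alpha>0, snd j)" if "fst j \<in> M" "snd j < q"
        using y \<alpha>0 that unfolding ghz_cond_def by (metis (mono_tags, lifting) mem_Collect_eq prod.collapse)
      ultimately show "?g (?f y) j = y j" by (auto simp: lft_drp)
    qed
    show "?f (?g p) = p" if p: "p \<in> ?B" for p
    proof -
      have "fst j \<in> M" if "snd p j" for j
      proof -
        have "snd p \<in> basis (Qall (\<lambda>\<alpha>. N \<alpha> - q) M)" using p by auto
        then have "j \<in> Qall (\<lambda>\<alpha>. N \<alpha> - q) M" using that unfolding basis_def by blast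
        then show ?thesis by (simp add: Qall_iff)
      qed
      then have "drp q (?g p) = snd p" by (auto simp: fun_eq_iff)
      moreover have "{k. k < q \<and> ?g p (\<alpha>0, k)} = fst p" using p \<alpha>0 by auto
      ultimately show ?thesis by (metis prod.collapse)
    qed
  qed
  then have "(\<Sum>y\<in>?C. F (snd (?f y))) = (\<Sum>p\<in>?B. F (snd p))" by (rule sum.reindex_bij_betw)
  also have "\<dots> = (\<Sum>A\<in>Pow {..<q}. \<Sum>w\<in>basis (Qall (\<lambda>\<alpha>. N \<alpha> - q) M). F w)"
    by (simp only: sum.cartesian_product split_def)
  also have "\<dots> = 2 ^ q * (\<Sum>w\<in>basis (Qall (\<lambda>\<alpha>. N \<alpha> - q) M). F w)"
    by (simp add: card_Pow)
  finally show ?thesis by simp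
qed

text \<open>The ZZ eigenvalues kill all amplitudes off the strings constant on each copy, and the XX
  eigenvalues make the remaining ones independent of the common bits. So \<phi> is determined by its
  values on strings with zero GHZ bits, which give the residual state.\<close>

lemma ghz_factor:
  assumes M: "finite M" and \<alpha>0: "\<alpha>0 \<in> M" and q: "\<forall>\<alpha>\<in>M. q \<le> N \<alpha>"
    and T: "stab_group (Qall N M) T \<phi>"
    and ZT: "\<And>k \<alpha>. k < q \<Longrightarrow> \<alpha> \<in> M \<Longrightarrow> gadd (Zel (\<alpha>, k)) (Zel (\<alpha>0, k)) \<in> T"
    and XT: "\<And>k. k < q \<Longrightarrow> XX M k \<in> T"
    and Z: "\<And>k \<alpha>. k < q \<Longrightarrow> \<alpha> \<in> M \<Longrightarrow>
      op_app (Qall N M) (pauli (Qall N M) (gadd (Zel (\<alpha>, k)) (Zel (\<alpha>0, k)))) \<phi> = \<phi>"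
    and X: "\<And>k. k < q \<Longrightarrow> op_app (Qall N M) (pauli (Qall N M) (XX M k)) \<phi> = \<phi>"
  obtains \<psi>'' where "stabilizer_state (Qall (\<lambda>\<alpha>. N \<alpha> - q) M) \<psi>''"
    "\<And>y. y \<in> basis (Qall N M) \<Longrightarrow> \<phi> y = ghz_times M q \<psi>'' y"
proof -
  let ?Q = "Qall N M" and ?Q' = "Qall (\<lambda>\<alpha>. N \<alpha> - q) M"
  note Q = finite_Qall[OF M, of N] and Q' = finite_Qall[OF M, of "\<lambda>\<alpha>. N \<alpha> - q"]
  have kN: "\<forall>\<alpha>\<in>M. k < N \<alpha>" if "k < q" for k using q that by auto
  have inQ: "(\<alpha>, k) \<in> ?Q" if "k < q" "\<alpha> \<in> M" for \<alpha> k using kN that by (simp add: Qall_iff)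
  have sub: "f2_subspace ?Q T" and TT: "perp ?Q T = T" and vec: "is_vec ?Q \<phi>"
    and norm: "(\<Sum>x\<in>basis ?Q. (cmod (\<phi> x))\<^sup>2) = 1"
    using T by (simp_all add: stab_group_def self_dual_perp unit_vec_def)
  have T_Gn: "f \<in> Gn ?Q" if "f \<in> T" for f using sub that unfolding f2_subspace_def by blast
  have T_om: "\<not> omega ?Q f g" if "f \<in> T" "g \<in> T" for f g using TT that perpD by blast
  have off: "\<phi> y = 0" if y: "y \<in> basis ?Q" "\<not> ghz_cond M q y" for y
  proof -
    obtain k \<alpha> where k: "k < q" "\<alpha> \<in> M" "y (\<alpha>, k) \<noteq> y (\<alpha>0, k)"
      using y(2) \<alpha>0 unfolding ghz_cond_def by metis
    then have "\<phi> y = - \<phi> y"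
      using fun_cong[OF Z[OF k(1,2)], of y] pauli_ZZ[OF Q inQ[OF k(1,2)] inQ[OF k(1) \<alpha>0], of \<phi> y] y(1) by simp
    then show ?thesis by simp
  qed
  have flip: "\<phi> (flip (XX M k) y) = \<phi> y" if "y \<in> basis ?Q" "k < q" for k y
    using fun_cong[OF X[OF that(2)], of y] pauli_XX[OF M kN[OF that(2)], of \<phi> y] that(1) by simp
  have on: "\<phi> y = \<phi> (lft q (drp q y))" if y: "y \<in> basis ?Q" "ghz_cond M q y" for y
  proof -
    \<comment> \<open>The copies are cleared one at a time. Copy n is either already zero or all
      ones, and in the latter case the operator of \<open>XX M n\<close> clears it without changing
      the amplitude.\<close>
    have "\<phi> (\<lambda>j. y j \<and> n \<le> snd j) = \<phi> y" if "n \<le> q" for n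
      using that
    proof (induction n)
      case (Suc n)
      let ?y = "\<lambda>j. y j \<and> n \<le> snd j" and ?y' = "\<lambda>j. y j \<and> Suc n \<le> snd j"
      have yb: "?y \<in> basis ?Q" using y(1) unfolding basis_def by blast
      have yM: "fst j \<in> M" if "y j" for j
        using y(1) that Qall_iff[of j N M] unfolding basis_def by blast
      have eq: "y (\<alpha>, n) = y (\<alpha>0, n)" if "\<alpha> \<in> M" for \<alpha>
        using y(2) that \<alpha>0 Suc.prems unfolding ghz_cond_def by (metis Suc_le_lessD)
      have "\<phi> ?y' = \<phi> ?y"
      proof (cases "y (\<alpha>0, n)")
        case True
        have "?y' = flip (XX M n) ?y"
        proof
          fix j
          show "?y' j = flip (XX M n) ?y j"
            using eq[of "fst j"] True yM[of j] by (cases j) (auto simp: flip_def)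
        qed
        then show ?thesis using flip[OF yb, of n] Suc.prems by simp
      next
        case False
        have "?y' = ?y"
        proof
          fix j
          show "?y' j = ?y j" using eq[of "fst j"] False yM[of j] by (cases j) (auto simp: le_less)
        qed
        then show ?thesis by simp
      qed
      then show ?case using Suc by simp
    qed simp
    then show ?thesis unfolding lft_drp by simp
  qed
  \<comment> \<open>The factor undoes the amplitude (1 / sqrt 2)^q of the GHZ copies.\<close>
  define \<psi> where "\<psi> w = of_real (sqrt 2 ^ q) * \<phi> (lft q w)" for w
  have ghz: "\<phi> y = ghz_times M q \<psi> y" if "y \<in> basis ?Q" for y
  proof -
    have "complex_of_real ((1 / sqrt 2) ^ q) * of_real (sqrt 2 ^ q) = 1"
      by (simp flip: of_real_mult power_mult_distrib)
    then have "complex_of_real ((1 / sqrt 2) ^ q) * \<psi> (drp q y) = \<phi> (lft q (drp q y))"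
      unfolding \<psi>_def mult.assoc[symmetric] by simp
    then show ?thesis using on[OF that] off[OF that] by (simp add: ghz_times_eq)
  qed
  have psi_vec: "is_vec ?Q' \<psi>"
    using vec lft_basis[OF q] unfolding is_vec_def \<psi>_def by simp
  have "(\<Sum>w\<in>basis ?Q'. (cmod (\<psi> w))\<^sup>2) = 2 ^ q * (\<Sum>w\<in>basis ?Q'. (cmod (\<phi> (lft q w)))\<^sup>2)"
  proof -
    have "(sqrt 2 ^ q)\<^sup>2 = ((sqrt 2)\<^sup>2) ^ q" by (simp only: power_mult[symmetric] mult.commute)
    then have "(cmod (\<psi> w))\<^sup>2 = 2 ^ q * (cmod (\<phi> (lft q w)))\<^sup>2" for w
      by (simp add: \<psi>_def norm_mult norm_power power_mult_distrib)
    then show ?thesis by (simp add: sum_distrib_left)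
  qed
  also have "\<dots> = (\<Sum>y\<in>{y \<in> basis ?Q. ghz_cond M q y}. (cmod (\<phi> (lft q (drp q y))))\<^sup>2)"
    by (rule sum_ghz_cond[OF M _ q, of "\<lambda>w. (cmod (\<phi> (lft q w)))\<^sup>2", symmetric]) (use \<alpha>0 in blast)
  also have "\<dots> = (\<Sum>y\<in>{y \<in> basis ?Q. ghz_cond M q y}. (cmod (\<phi> y))\<^sup>2)"
    by (rule sum.cong[OF refl]) (simp add: on[symmetric])
  also have "\<dots> = (\<Sum>y\<in>basis ?Q. (cmod (\<phi> y))\<^sup>2)"
    by (rule sum.mono_neutral_left[OF finite_basis[OF Q]]) (use off in auto)
  finally have unit: "unit_vec ?Q' \<psi>" using psi_vec norm by (simp add: unit_vec_def)
  \<comment> \<open>The stabilizer group of the residual state: elements acting trivially on the GHZ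
    qubits and stabilizing \<phi>.\<close>
  define R where "R = {f \<in> Gn ?Q'. lftp q f \<in> T}"
  have R_iff: "f \<in> R \<longleftrightarrow> f \<in> Gn ?Q' \<and> lftp q f \<in> T" for f by (simp add: R_def)
  have drpp_lftp: "drpp q (lftp q f) = f" for f :: "('a \<times> nat) pel" by (rule pel_eqI) simp_all
  have T_low: "\<not> omega (low M q) h t" if "h \<in> T" "t \<in> T" for h t
  proof (rule not_omega_low[OF M])
    fix k assume k: "k < q"
    have "fst f (\<alpha>, k) = fst f (\<alpha>0, k)" if "\<alpha> \<in> M" "f \<in> T" for \<alpha> f
      using T_om[OF ZT[OF k that(1)] that(2)] omega_ZZ[OF Q inQ[OF k that(1)] inQ[OF k \<alpha>0]] by simp
    then show "\<exists>A B. \<forall>\<alpha>\<in>M. fst h (\<alpha>, k) = A \<and> fst t (\<alpha>, k) = B" using that by blast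
    have "even (card {\<alpha> \<in> M. snd f (\<alpha>, k)})" if "f \<in> T" for f
      using T_om[OF XT[OF k] that] omega_XX[OF M kN[OF k]] by simp
    then show "even (card {\<alpha> \<in> M. snd h (\<alpha>, k)}) \<and> even (card {\<alpha> \<in> M. snd t (\<alpha>, k)})" using that by blast
  qed
  \<comment> \<open>Elements of T already commute with each other on the GHZ qubits, so their
    residual parts commute with T as well. With the adjointness in \<open>omega_lftp\<close> this
    yields the maximality of R.\<close>
  have drp_R: "drpp q h \<in> R" if h: "h \<in> T" for h
  proof -
    have dG: "drpp q h \<in> Gn ?Q'" using drpp_Gn[OF q T_Gn[OF h]] .
    have "\<not> omega ?Q (lftp q (drpp q h)) t" if t: "t \<in> T" for t
    proof -
      have fin: "finite (low M q)" "finite (high N M q)" using M Q by simp_all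
      have dis: "low M q \<inter> high N M q = {}" by auto
      have "omega ?Q h t \<longleftrightarrow> omega (low M q) h t \<noteq> omega (high N M q) h t"
        using omega_Un[OF fin dis] unfolding Qall_split[OF q, symmetric] .
      then show ?thesis
        using T_om[OF h t] T_low[OF h t] omega_high[of N M q h t] omega_lftp[OF M q, of "drpp q h" t] by simp
    qed
    then have "lftp q (drpp q h) \<in> perp ?Q T" using lftp_Gn[OF q] dG unfolding perp_def by blast
    then show ?thesis using TT dG by (simp add: R_iff)
  qed
  have R_om: "omega ?Q' f g = omega ?Q (lftp q f) (lftp q g)" for f g
    using omega_lftp[OF M q, of f "lftp q g"] drpp_lftp by simp
  have lftp_gadd: "lftp q (gadd f g) = gadd (lftp q f) (lftp q g)" for f g :: "('a \<times> nat) pel"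
    by (rule pel_eqI) auto
  have lftp_zero: "lftp q gzero = (gzero :: ('a \<times> nat) pel)" by (rule pel_eqI) auto
  have "f2_subspace ?Q' R"
    unfolding f2_subspace_def
  proof (intro conjI ballI)
    show "R \<subseteq> Gn ?Q'" unfolding R_def by blast
    show "gzero \<in> R" using sub by (simp add: R_iff lftp_zero f2_subspace_def)
    fix f g assume "f \<in> R" "g \<in> R"
    then show "gadd f g \<in> R" using sub gadd_Gn unfolding R_iff lftp_gadd f2_subspace_def by blast
  qed
  moreover have "perp ?Q' R = R"
  proof (intro equalityI subsetI)
    fix f assume f: "f \<in> perp ?Q' R"
    then have fG: "f \<in> Gn ?Q'" by (simp add: perp_def)
    have "\<not> omega ?Q (lftp q f) h" if "h \<in> T" for h
      using perpD[OF f drp_R[OF that]] omega_lftp[OF M q] by simp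
    then have "lftp q f \<in> perp ?Q T" using lftp_Gn[OF q] fG unfolding perp_def by blast
    then show "f \<in> R" using TT fG by (simp add: R_iff)
  next
    fix f assume "f \<in> R"
    moreover have "\<not> omega ?Q' f g" if "g \<in> R" for g
      using T_om \<open>f \<in> R\<close> that unfolding R_om R_iff by blast
    ultimately show "f \<in> perp ?Q' R" unfolding perp_def by (simp add: R_iff)
  qed
  ultimately have sd: "self_dual ?Q' R" by (simp add: self_dual_perp)
  have eigen: "\<exists>e\<in>{1, -1}. op_app ?Q' (pauli ?Q' f) \<psi> = (\<lambda>x. e * \<psi> x)" if "f \<in> R" for f
  proof -
    have fG: "f \<in> Gn ?Q'" and lT: "lftp q f \<in> T" using that by (simp_all add: R_iff)
    note lG = T_Gn[OF lT]
    obtain e where e: "e \<in> {1, -1}" "op_app ?Q (pauli ?Q (lftp q f)) \<phi> = (\<lambda>x. e * \<phi> x)"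
      using stab_group_eigen[OF T lT] by blast
    have "op_app ?Q' (pauli ?Q' f) \<psi> w = e * \<psi> w" for w
    proof (cases "w \<in> basis ?Q'")
      case True
      have fl: "flip (lftp q f) (lft q w) = lft q (flip f w)" by (auto simp: flip_def fun_eq_iff)
      let ?F = "\<lambda>j. phase1 (fst (lftp q f) j) (snd (lftp q f) j) (lft q (flip f w) j)"
      \<comment> \<open>The extension by zero contributes phase 1 on every GHZ qubit.\<close>
      have "(\<Prod>j\<in>?Q. ?F j) = (\<Prod>j\<in>high N M q. ?F j)"
        by (rule prod.mono_neutral_right[OF Q]) (auto simp: phase1_def)
      also have "\<dots> = (\<Prod>j\<in>?Q'. ?F (fst j, snd j + q))"
        using prod.reindex_bij_betw[OF high_bij[of q N M], of ?F] by simp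
      finally have "(\<Prod>j\<in>?Q. ?F j) = (\<Prod>j\<in>?Q'. phase1 (fst f j) (snd f j) (flip f w j))" by simp
      then show ?thesis
        using fun_cong[OF e(2), of "lft q w"] True lft_basis[OF q]
        unfolding pauli_app[OF Q lG] pauli_app[OF Q' fG] fl \<psi>_def by simp
    next
      case False
      then have "\<psi> w = 0" using psi_vec by (simp add: is_vec_def)
      then show ?thesis using False by (simp add: op_app_def)
    qed
    then show ?thesis using e(1) by blast
  qed
  have "stab_group ?Q' R \<psi>"
    using sd eigen unit f2dim_eqI[OF card_self_dual[OF Q' sd]] unfolding stab_group_def by blast
  then show ?thesis using that ghz unfolding stabilizer_state_def by blast
qed

text \<open>Flipping a whole copy changes neither the constancy condition nor the residual string,
  and ZZ acts as +1 on constant copies. With \<open>stab_group_memI\<close> these relations put the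
  GHZ generators into a stabilizer group.\<close>

lemma ghz_times_eigen:
  assumes M: "finite M" and q: "\<forall>\<alpha>\<in>M. q \<le> N \<alpha>" and k: "k < q"
    and vec: "is_vec (Qall N M) \<phi>" and eq: "\<And>y. y \<in> basis (Qall N M) \<Longrightarrow> \<phi> y = c * ghz_times M q \<psi>'' y"
  shows "op_app (Qall N M) (pauli (Qall N M) (XX M k)) \<phi> = \<phi>"
    and "\<alpha> \<in> M \<Longrightarrow> \<beta> \<in> M \<Longrightarrow> op_app (Qall N M) (pauli (Qall N M) (gadd (Zel (\<alpha>, k)) (Zel (\<beta>, k)))) \<phi> = \<phi>"
proof -
  note Q = finite_Qall[OF M, of N]
  have kN: "\<forall>\<alpha>\<in>M. k < N \<alpha>" using q k by auto
  have out: "\<phi> y = 0" if "y \<notin> basis (Qall N M)" for y using vec that by (simp add: is_vec_def)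
  show "op_app (Qall N M) (pauli (Qall N M) (XX M k)) \<phi> = \<phi>"
  proof
    fix y
    show "op_app (Qall N M) (pauli (Qall N M) (XX M k)) \<phi> y = \<phi> y"
      using out[of y] flip_basis[OF XX_Gn[OF kN], of y] eq
      by (simp add: pauli_XX[OF M kN] ghz_times_eq ghz_cond_flip drp_flip[OF k])
  qed
  assume ab: "\<alpha> \<in> M" "\<beta> \<in> M"
  then have in_Q: "(\<alpha>, k) \<in> Qall N M" "(\<beta>, k) \<in> Qall N M" using kN by (simp_all add: Qall_iff)
  show "op_app (Qall N M) (pauli (Qall N M) (gadd (Zel (\<alpha>, k)) (Zel (\<beta>, k)))) \<phi> = \<phi>"
  proof
    fix y
    have "y (\<alpha>, k) = y (\<beta>, k)" if "ghz_cond M q y" using that ab k unfolding ghz_cond_def by blast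
    then show "op_app (Qall N M) (pauli (Qall N M) (gadd (Zel (\<alpha>, k)) (Zel (\<beta>, k)))) \<phi> y = \<phi> y"
      using out[of y] eq[of y] by (simp add: pauli_ZZ[OF Q in_Q] ghz_times_eq)
  qed
qed

section \<open>Extraction of GHZ states\<close>

lemma stab_group_Gn: "stab_group Q S \<psi> \<Longrightarrow> f \<in> S \<Longrightarrow> f \<in> Gn Q"
  unfolding stab_group_def self_dual_def f2_subspace_def by blast

lemma symplectic_gadd:
  "symplectic_map Q u \<Longrightarrow> f \<in> Gn Q \<Longrightarrow> g \<in> Gn Q \<Longrightarrow> u (gadd f g) = gadd (u f) (u g)"
  by (simp add: symplectic_map_def)

lemma pauli_map_zero: "finite Q \<Longrightarrow> unitary_op Q U \<Longrightarrow> pauli_map Q U u \<Longrightarrow> u gzero = gzero"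
  using pauli_map_symplectic symplectic_zero by blast

text \<open>A Pauli operator changes only the signs of other Pauli operators, so it can adjust
  eigenvalues while the stabilizer group stays the same.\<close>

lemma pauli_map_pauli:
  assumes "finite Q" "p \<in> Gn Q"
  shows "unitary_op Q (pauli Q p)" "pauli_map Q (pauli Q p) id"
proof -
  show "unitary_op Q (pauli Q p)"
    using assms by (simp add: unitary_op_iff pauli_adj pauli_pauli)
  show "pauli_map Q (pauli Q p) id"
    unfolding pauli_map_def
  proof (intro ballI conjI)
    fix f assume f: "f \<in> Gn Q"
    then show "id f \<in> Gn Q" by simp
    show "\<exists>s\<in>{1, -1}. \<forall>\<psi>. op_app Q (pauli Q p) (op_app Q (pauli Q f) \<psi>)
        = (\<lambda>y. s * op_app Q (pauli Q (id f)) (op_app Q (pauli Q p) \<psi>) y)"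
      by (rule bexI[of _ "if omega Q p f then - 1 else 1"]) (use pauli_commute[OF assms f] in simp_all)
  qed
qed

definition local_map :: "('p \<Rightarrow> nat) \<Rightarrow> 'p set \<Rightarrow> ('p \<Rightarrow> ('p \<times> nat) pel \<Rightarrow> ('p \<times> nat) pel)
    \<Rightarrow> ('p \<times> nat) pel \<Rightarrow> ('p \<times> nat) pel" where
  "local_map N M u f = join M (\<lambda>\<alpha>. u \<alpha> (pr N \<alpha> f))"

lemma join_single:
  assumes "\<alpha> \<in> M" "f \<in> Gn (Qpart N \<alpha>)"
  shows "join M (\<lambda>\<beta>. if \<beta> = \<alpha> then f else gzero) = f"
proof (rule pel_eqI)
  fix j
  show "fst (join M (\<lambda>\<beta>. if \<beta> = \<alpha> then f else gzero)) j = fst f j"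
    "snd (join M (\<lambda>\<beta>. if \<beta> = \<alpha> then f else gzero)) j = snd f j"
    using Gn_QpartD[OF assms(2), of j] assms(1) by auto
qed

lemma pr_party:
  assumes "f \<in> Gn (Qpart N \<alpha>)"
  shows "pr N \<beta> f = (if \<beta> = \<alpha> then f else gzero)"
proof (rule pel_eqI)
  fix j
  show "fst (pr N \<beta> f) j = fst (if \<beta> = \<alpha> then f else gzero) j"
    "snd (pr N \<beta> f) j = snd (if \<beta> = \<alpha> then f else gzero) j"
    using Gn_QpartD[OF assms, of j] by (auto simp: Qpart_iff)
qed

lemma join_cong: "(\<And>\<alpha>. \<alpha> \<in> M \<Longrightarrow> h \<alpha> = h' \<alpha>) \<Longrightarrow> join M h = join M h'"
  by (rule pel_eqI) auto

lemma local_map_party: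
  assumes "\<alpha> \<in> M" "f \<in> Gn (Qpart N \<alpha>)" "u \<alpha> f \<in> Gn (Qpart N \<alpha>)" "\<forall>\<beta>\<in>M. u \<beta> gzero = gzero"
  shows "local_map N M u f = u \<alpha> f"
proof -
  have "join M (\<lambda>\<beta>. u \<beta> (pr N \<beta> f)) = join M (\<lambda>\<beta>. if \<beta> = \<alpha> then u \<alpha> f else gzero)"
    by (rule join_cong) (use assms(4) in \<open>simp add: pr_party[OF assms(2)]\<close>)
  then show ?thesis using join_single[of \<alpha> M "u \<alpha> f" N] assms(1,3) by (simp add: local_map_def)
qed

section \<open>Lower bound: \<Delta> copies can be extracted\<close>

lemma extractable_Delta:
  fixes N :: "'p \<Rightarrow> nat"
  assumes M: "finite M" "card M \<ge> 3" and S: "stab_group (Qall N M) S \<psi>"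
  shows "extractable N M \<psi> (f2dim S - f2dim (Sloc N M S))"
proof -
  let ?Q = "Qall N M"
  define D where "D = f2dim S - f2dim (Sloc N M S)"
  note Q = finite_Qall[OF M(1), of N]
  have sd: "self_dual ?Q S" using S by (simp add: stab_group_def)
  obtain g z where g: "\<forall>k<D. g k \<in> S"
    and z': "\<forall>k<D. \<forall>\<alpha>\<in>M. z k \<alpha> \<in> Gn (Qpart N \<alpha>)"
    and zz: "\<forall>k<D. \<forall>\<alpha>\<in>M. \<forall>\<beta>\<in>M. gadd (z k \<alpha>) (z k \<beta>) \<in> S"
    and om: "\<forall>k<D. \<forall>l<D. \<forall>\<alpha>\<in>M. \<not> omega (Qpart N \<alpha>) (g k) (g l) \<and> \<not> omega (Qpart N \<alpha>) (z k \<alpha>) (z l \<alpha>)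
      \<and> omega (Qpart N \<alpha>) (g k) (z l \<alpha>) = (k = l)"
    using ghz_generators[OF M sd, folded D_def] by (elim exE conjE)
  have z: "z k \<alpha> \<in> Gn (Qpart N \<alpha>)" if "k < D" "\<alpha> \<in> M" for k \<alpha> using z' that by blast
  have party: "D \<le> N \<alpha> \<and> (\<exists>U u. unitary_op (Qpart N \<alpha>) U \<and> pauli_map (Qpart N \<alpha>) U u
      \<and> (\<forall>k<D. u (pr N \<alpha> (g k)) = Xel (\<alpha>, k) \<and> u (z k \<alpha>) = Zel (\<alpha>, k)))" if \<alpha>: "\<alpha> \<in> M" for \<alpha>
  proof -
    have 1: "Qpart N \<alpha> = Pair \<alpha> ` {..<N \<alpha>}" by (auto simp: Qpart_def)
    have pr: "omega (Qpart N \<alpha>) (pr N \<alpha> f) h = omega (Qpart N \<alpha>) f h"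
      "omega (Qpart N \<alpha>) h (pr N \<alpha> f) = omega (Qpart N \<alpha>) h f" for f h
      by (rule omega_cong; simp)+
    have "D \<le> N \<alpha> \<and> (\<exists>u. realizable (Qpart N \<alpha>) (Gn (Qpart N \<alpha>)) u
      \<and> (\<forall>k<D. u (pr N \<alpha> (g k)) = Xel (\<alpha>, k) \<and> u (z k \<alpha>) = Zel (\<alpha>, k)))"
    proof (rule clifford_witt[OF 1])
      show "inj_on (Pair \<alpha>) {..<N \<alpha>}" by (simp add: inj_on_def)
      show "\<forall>i<D. pr N \<alpha> (g i) \<in> Gn (Qpart N \<alpha>) \<and> z i \<alpha> \<in> Gn (Qpart N \<alpha>)" using z \<alpha> by simp
      show "\<forall>i<D. \<forall>j<D. \<not> omega (Qpart N \<alpha>) (pr N \<alpha> (g i)) (pr N \<alpha> (g j)) \<and>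
          \<not> omega (Qpart N \<alpha>) (z i \<alpha>) (z j \<alpha>) \<and> omega (Qpart N \<alpha>) (pr N \<alpha> (g i)) (z j \<alpha>) = (i = j)"
        unfolding pr using om \<alpha> by blast
    qed
    then show ?thesis unfolding realizable_def by blast
  qed
  \<comment> \<open>Each party has room for its share of every copy because it carries D hyperbolic
    pairs.\<close>
  have DN: "\<forall>\<alpha>\<in>M. D \<le> N \<alpha>" using party by blast
  have "\<forall>\<alpha>\<in>M. \<exists>U u. unitary_op (Qpart N \<alpha>) U \<and> pauli_map (Qpart N \<alpha>) U u
      \<and> (\<forall>k<D. u (pr N \<alpha> (g k)) = Xel (\<alpha>, k) \<and> u (z k \<alpha>) = Zel (\<alpha>, k))"
    using party by blast
  then obtain U u where Uu: "\<forall>\<alpha>\<in>M. unitary_op (Qpart N \<alpha>) (U \<alpha>) \<and> pauli_map (Qpart N \<alpha>) (U \<alpha>) (u \<alpha>)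
      \<and> (\<forall>k<D. u \<alpha> (pr N \<alpha> (g k)) = Xel (\<alpha>, k) \<and> u \<alpha> (z k \<alpha>) = Zel (\<alpha>, k))"
    unfolding bchoice_iff by (elim exE)
  have U: "\<forall>\<alpha>\<in>M. unitary_op (Qpart N \<alpha>) (U \<alpha>)" and u: "\<forall>\<alpha>\<in>M. pauli_map (Qpart N \<alpha>) (U \<alpha>) (u \<alpha>)"
    and uX: "\<And>\<alpha> k. \<alpha> \<in> M \<Longrightarrow> k < D \<Longrightarrow> u \<alpha> (pr N \<alpha> (g k)) = Xel (\<alpha>, k)"
    and uZ: "\<And>\<alpha> k. \<alpha> \<in> M \<Longrightarrow> k < D \<Longrightarrow> u \<alpha> (z k \<alpha>) = Zel (\<alpha>, k)"
    using Uu by blast+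
  let ?V = "local_op N M U" and ?v = "local_map N M u"
  have V: "unitary_op ?Q ?V" by (rule unitary_local_op[OF M(1) U])
  have v: "pauli_map ?Q ?V ?v" unfolding local_map_def by (rule pauli_map_local[OF M(1) u])
  define T where "T = ?v ` S"
  define \<chi> where "\<chi> = op_app ?Q ?V \<psi>"
  have T: "stab_group ?Q T \<chi>" unfolding T_def \<chi>_def by (rule stab_group_map[OF Q V v S])
  have T_Gn: "f \<in> Gn ?Q" if "f \<in> T" for f
    using stab_group_Gn[OF T that] .
  note sym = pauli_map_symplectic[OF Q V v]
  have u0: "\<forall>\<beta>\<in>M. u \<beta> gzero = gzero"
    by (intro ballI pauli_map_zero[OF finite_Qpart]; (rule U[rule_format] | rule u[rule_format]); assumption)
  have kN: "\<forall>\<alpha>\<in>M. k < N \<alpha>" if "k < D" for k using DN that by auto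
  have inQ: "(\<alpha>, k) \<in> ?Q" if "k < D" "\<alpha> \<in> M" for \<alpha> k using kN that by (simp add: Qall_iff)
  have XT: "XX M k \<in> T" if "k < D" for k
  proof -
    have "?v (g k) = XX M k"
      unfolding local_map_def XX_def by (rule join_cong) (simp add: uX that)
    moreover have "?v (g k) \<in> T" unfolding T_def using g that by (intro imageI) blast
    ultimately show ?thesis by simp
  qed
  have ZT: "gadd (Zel (\<alpha>, k)) (Zel (\<beta>, k)) \<in> T" if k: "k < D" and ab: "\<alpha> \<in> M" "\<beta> \<in> M" for k \<alpha> \<beta>
  proof -
    have "?v (z k \<gamma>) = Zel (\<gamma>, k)" if "\<gamma> \<in> M" for \<gamma>
      using local_map_party[OF that z[OF k that], of u] uZ[OF that k] u0 kN[OF k] that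
      by (simp add: Qpart_iff)
    moreover have "?v (gadd (z k \<alpha>) (z k \<beta>)) = gadd (?v (z k \<alpha>)) (?v (z k \<beta>))"
      by (rule symplectic_gadd[OF sym]) (rule Gn_Qpart[OF _ z[OF k]]; fact)+
    ultimately have "?v (gadd (z k \<alpha>) (z k \<beta>)) = gadd (Zel (\<alpha>, k)) (Zel (\<beta>, k))" using ab by simp
    moreover have "?v (gadd (z k \<alpha>) (z k \<beta>)) \<in> T" unfolding T_def using zz k ab by (intro imageI) blast
    ultimately show ?thesis by simp
  qed
  obtain \<alpha>0 where \<alpha>0: "\<alpha>0 \<in> M" using M(2) by (cases "M = {}") auto
  text \<open>The Pauli operator of \<open>p\<close> turns all signs of the GHZ stabilizers into \<open>+1\<close>.\<close>
  define neg where "neg f \<longleftrightarrow> op_app ?Q (pauli ?Q f) \<chi> = (\<lambda>x. - \<chi> x)" for f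
  define p :: "('p \<times> nat) pel" where
    "p = (\<lambda>j. fst j \<in> M \<and> snd j < D \<and> neg (gadd (Zel j) (Zel (\<alpha>0, snd j))),
          \<lambda>j. fst j = \<alpha>0 \<and> snd j < D \<and> neg (XX M (snd j)))"
  have pG: "p \<in> Gn ?Q" unfolding Gn_iff p_def using inQ \<alpha>0 by auto
  \<comment> \<open>A Pauli operator is a tensor product over the parties, so the sign correction is
    absorbed into the local Clifford operators.\<close>
  let ?W = "\<lambda>\<alpha>. op_mult (Qpart N \<alpha>) (pauli (Qpart N \<alpha>) (pr N \<alpha> p)) (U \<alpha>)"
  have cliff: "\<forall>\<alpha>\<in>M. clifford (Qpart N \<alpha>) (?W \<alpha>)"
  proof
    fix \<alpha> assume "\<alpha> \<in> M"
    note P = pauli_map_pauli[OF finite_Qpart pr_Gn, of N \<alpha> p]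
    show "clifford (Qpart N \<alpha>) (?W \<alpha>)"
      unfolding clifford_iff[OF finite_Qpart]
      using unitary_mult[OF finite_Qpart P(1) U[rule_format, OF \<open>\<alpha> \<in> M\<close>]]
        pauli_map_mult[OF finite_Qpart P(2) u[rule_format, OF \<open>\<alpha> \<in> M\<close>]] by (intro conjI exI)
  qed
  define \<phi> where "\<phi> = op_app ?Q (pauli ?Q p) \<chi>"
  have W: "op_app ?Q (local_op N M ?W) \<psi> = \<phi>"
  proof -
    have "op_app ?Q (local_op N M ?W) \<psi> = op_app ?Q (local_op N M (\<lambda>\<alpha>. pauli (Qpart N \<alpha>) (pr N \<alpha> p))) \<chi>"
      by (simp only: local_op_mult[OF M(1), symmetric] op_app_mult[OF Q] \<chi>_def)
    also have "\<dots> = \<phi>" using pauli_local[OF M(1) pG] by (simp only: op_eq_iff[OF Q] \<phi>_def)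
    finally show ?thesis .
  qed
  have "stab_group ?Q (id ` T) \<phi>"
    unfolding \<phi>_def by (rule stab_group_map[OF Q pauli_map_pauli[OF Q pG] T])
  then have T': "stab_group ?Q T \<phi>" by simp
  have sign: "op_app ?Q (pauli ?Q f) \<phi> = \<phi>" if f: "f \<in> T" "omega ?Q f p = neg f" for f
  proof -
    obtain e where e: "e \<in> {1, -1}" "op_app ?Q (pauli ?Q f) \<chi> = (\<lambda>x. e * \<chi> x)"
      using stab_group_eigen[OF T f(1)] by blast
    have "e = (if omega ?Q f p then - 1 else 1)"
    proof (cases "neg f")
      case True
      have "\<chi> \<noteq> (\<lambda>_. 0)" using T by (auto simp only: stab_group_def unit_vec_def norm_zero power_zero_numeral sum.neutral_const zero_neq_one)
      then show ?thesis using True e f(2) unfolding neg_def by (auto simp: fun_eq_iff)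
    next
      case False
      then show ?thesis using e f(2) unfolding neg_def by auto
    qed
    then show ?thesis
      unfolding \<phi>_def pauli_commute[OF Q T_Gn[OF f(1)] pG] e(2) op_app_smult by auto
  qed
  have "op_app ?Q (pauli ?Q (XX M k)) \<phi> = \<phi>" if k: "k < D" for k
  proof (rule sign[OF XT[OF k]])
    \<comment> \<open>The Z part of p on copy k sits at the reference party only, so its parity is
      precisely the wanted sign of \<open>XX M k\<close>.\<close>
    have "{\<alpha> \<in> M. snd p (\<alpha>, k)} = (if neg (XX M k) then {\<alpha>0} else {})"
      using k \<alpha>0 by (auto simp: p_def)
    then show "omega ?Q (XX M k) p = neg (XX M k)" by (simp add: omega_XX[OF M(1) kN[OF k]])
  qed
  moreover have "op_app ?Q (pauli ?Q (gadd (Zel (\<alpha>, k)) (Zel (\<alpha>0, k)))) \<phi> = \<phi>" if k: "k < D" and \<alpha>: "\<alpha> \<in> M" for k \<alpha>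
  proof (rule sign[OF ZT[OF k \<alpha> \<alpha>0]])
    \<comment> \<open>At the reference party the ZZ generator degenerates to \<open>gzero\<close>,
      whose sign is +1. So the X part of p vanishes there, and at \<alpha> it gives the wanted
      sign.\<close>
    have "is_vec ?Q \<chi>" by (simp add: \<chi>_def)
    then have "op_app ?Q (pauli ?Q gzero) \<chi> = \<chi>" using pauli_zero[OF Q] is_vec_trunc by metis
    moreover have "\<chi> \<noteq> (\<lambda>_. 0)" using T by (auto simp only: stab_group_def unit_vec_def norm_zero power_zero_numeral sum.neutral_const zero_neq_one)
    ultimately have "\<not> neg gzero" unfolding neg_def by (auto simp: fun_eq_iff)
    then show "omega ?Q (gadd (Zel (\<alpha>, k)) (Zel (\<alpha>0, k))) p = neg (gadd (Zel (\<alpha>, k)) (Zel (\<alpha>0, k)))"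
      using k \<alpha> \<alpha>0 by (simp add: omega_ZZ[OF Q inQ[OF k \<alpha>] inQ[OF k \<alpha>0]] p_def)
  qed
  ultimately obtain \<psi>'' where s: "stabilizer_state (Qall (\<lambda>\<alpha>. N \<alpha> - D) M) \<psi>''"
    and eq: "\<And>y. y \<in> basis ?Q \<Longrightarrow> \<phi> y = ghz_times M D \<psi>'' y"
    using ghz_factor[OF M(1) \<alpha>0 DN T' ZT[OF _ _ \<alpha>0] XT] by blast
  have "\<forall>y\<in>basis ?Q. op_app ?Q (local_op N M ?W) \<psi> y = 1 * ghz_times M D \<psi>'' y"
    using eq unfolding W by simp
  then have "extractable N M \<psi> D"
    unfolding extractable_def using DN cliff s by (intro conjI exI[of _ ?W] exI[of _ \<psi>''] exI[of _ 1]) simp_all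
  then show ?thesis by (simp only: D_def)
qed

section \<open>Upper bound: no more than \<Delta> copies can be extracted\<close>

lemma extractable_le_Delta:
  fixes N :: "'p \<Rightarrow> nat"
  assumes M: "finite M" "M \<noteq> {}" and S: "stab_group (Qall N M) S \<psi>" and ex: "extractable N M \<psi> q"
  shows "q \<le> f2dim S - f2dim (Sloc N M S)"
proof -
  let ?Q = "Qall N M"
  note Q = finite_Qall[OF M(1), of N]
  have sub: "f2_subspace ?Q S" using S by (simp add: stab_group_def self_dual_def)
  have S_Gn: "f \<in> Gn ?Q" if "f \<in> S" for f using stab_group_Gn[OF S that] .
  have S_add: "gadd f g \<in> S" if "f \<in> S" "g \<in> S" for f g using sub that unfolding f2_subspace_def by blast
  obtain U \<psi>'' c where q: "\<forall>\<alpha>\<in>M. q \<le> N \<alpha>" and U: "\<forall>\<alpha>\<in>M. clifford (Qpart N \<alpha>) (U \<alpha>)"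
    and eq: "\<And>y. y \<in> basis ?Q \<Longrightarrow> op_app ?Q (local_op N M U) \<psi> y = c * ghz_times M q \<psi>'' y"
    using ex unfolding extractable_def by blast
  obtain u where u: "\<forall>\<alpha>\<in>M. pauli_map (Qpart N \<alpha>) (U \<alpha>) (u \<alpha>)"
    using U unfolding clifford_iff[OF finite_Qpart] by metis
  have Un: "\<forall>\<alpha>\<in>M. unitary_op (Qpart N \<alpha>) (U \<alpha>)" using U by (simp add: clifford_iff)
  let ?V = "local_op N M U" and ?v = "local_map N M u"
  have V: "unitary_op ?Q ?V" by (rule unitary_local_op[OF M(1) Un])
  have v: "pauli_map ?Q ?V ?v" unfolding local_map_def by (rule pauli_map_local[OF M(1) u])
  have u0: "\<forall>\<beta>\<in>M. u \<beta> gzero = gzero"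
    by (intro ballI pauli_map_zero[OF finite_Qpart]; (rule Un[rule_format] | rule u[rule_format]); assumption)
  note sym = pauli_map_symplectic[OF Q V v]
  have v_add: "?v (gadd f g) = gadd (?v f) (?v g)" if "f \<in> S" "g \<in> S" for f g
    using sym S_Gn that unfolding symplectic_map_def by blast
  note T = stab_group_map[OF Q V v S]
  have T_om: "\<not> omega ?Q f g" if "f \<in> ?v ` S" "g \<in> ?v ` S" for f g
    using T that unfolding stab_group_def self_dual_def by blast
  have kN: "\<forall>\<alpha>\<in>M. k < N \<alpha>" if "k < q" for k using q that by auto
  have inQ: "(\<alpha>, k) \<in> ?Q" if "k < q" "\<alpha> \<in> M" for \<alpha> k using kN that by (simp add: Qall_iff)
  have XT: "XX M k \<in> ?v ` S" if k: "k < q" for k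
    using stab_group_memI[OF Q T XX_Gn[OF kN[OF k]], of 1] ghz_times_eigen(1)[OF M(1) q k _ eq] by simp
  have ZT: "gadd (Zel (\<alpha>, k)) (Zel (\<beta>, k)) \<in> ?v ` S" if k: "k < q" and ab: "\<alpha> \<in> M" "\<beta> \<in> M" for k \<alpha> \<beta>
    using stab_group_memI[OF Q T gadd_Gn, of "Zel (\<alpha>, k)" "Zel (\<beta>, k)" 1] inQ[OF k] ab
      ghz_times_eigen(2)[OF M(1) q k _ eq ab] by simp
  obtain \<alpha>0 where \<alpha>0: "\<alpha>0 \<in> M" using M(2) by blast
  \<comment> \<open>Commuting with the ZZ generators forces equal X components at all
    parties.\<close>
  have const: "fst (?v f) (\<alpha>, k) = fst (?v f) (\<alpha>0, k)" if "f \<in> S" "k < q" "\<alpha> \<in> M" for f k \<alpha>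
    using T_om[OF ZT[OF that(2,3) \<alpha>0], of "?v f"] omega_ZZ[OF Q inQ[OF that(2,3)] inQ[OF that(2) \<alpha>0]] that(1)
    by simp
  \<comment> \<open>The joint kernel of the first k X-component functionals, read off at a reference
    party; by \<open>const\<close> any party gives the same functionals.\<close>
  define K where "K k = {f \<in> S. \<forall>j<k. \<not> fst (?v f) (\<alpha>0, j)}" for k
  have K_iff: "f \<in> K k \<longleftrightarrow> f \<in> S \<and> (\<forall>j<k. \<not> fst (?v f) (\<alpha>0, j))" for f k by (simp add: K_def)
  have K_add: "gadd f g \<in> K k" if "f \<in> K k" "g \<in> K k" for f g k
    using that S_add by (simp add: K_iff v_add)
  have v0: "?v gzero = gzero" by (rule symplectic_zero[OF sym])
  have K_sub: "f2_subspace ?Q (K k)" for k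
  proof -
    have "K k \<subseteq> Gn ?Q" unfolding K_def using S_Gn by blast
    moreover have "gzero \<in> K k" using sub by (simp add: K_iff v0 f2_subspace_def)
    ultimately show ?thesis using K_add unfolding f2_subspace_def by blast
  qed
  have K_fin: "finite (K k)" for k
    using K_sub[of k] finite_Gn[OF Q] finite_subset unfolding f2_subspace_def by blast
  have "card S = 2 ^ k * card (K k)" if "k \<le> q" for k
    using that
  proof (induction k)
    case 0
    have "K 0 = S" by (simp add: K_def)
    then show ?case by simp
  next
    case (Suc k)
    \<comment> \<open>The preimage of \<open>XX M k\<close> has no X component on the copies below k
      and a nonzero one on copy k. It lies in K k and witnesses that the next kernel has half the
      size.\<close>
    then obtain g where g: "g \<in> S" "?v g = XX M k" using XT[of k] by fastforce
    have "g \<in> K k" using g by (simp add: K_iff)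
    then have "card (K k) = 2 * card {f \<in> K k. \<not> fst (?v f) (\<alpha>0, k)}"
    proof (intro card_halve(1)[where \<phi> = "\<lambda>f. fst (?v f) (\<alpha>0, k)", OF K_fin])
      show "gadd f h \<in> K k" if "f \<in> K k" "h \<in> K k" for f h using K_add that .
      show "fst (?v (gadd f h)) (\<alpha>0, k) = (fst (?v f) (\<alpha>0, k) \<noteq> fst (?v h) (\<alpha>0, k))"
        if "f \<in> K k" "h \<in> K k" for f h using that by (simp add: K_iff v_add)
      show "fst (?v g) (\<alpha>0, k)" using g \<alpha>0 by simp
    qed
    moreover have "{f \<in> K k. \<not> fst (?v f) (\<alpha>0, k)} = K (Suc k)"
      unfolding K_def by (rule Collect_cong) (simp add: less_Suc_eq all_conj_distrib imp_disjL conj_ac)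
    ultimately show ?case using Suc by simp
  qed
  then have card: "card S = 2 ^ q * card (K q)" by simp
  have "colocal N S \<alpha> \<subseteq> K q" if \<alpha>: "\<alpha> \<in> M" for \<alpha>
  proof
    fix f assume "f \<in> colocal N S \<alpha>"
    then have f: "f \<in> S" "\<forall>j\<in>Qpart N \<alpha>. \<not> fst f j \<and> \<not> snd f j" by (simp_all add: colocal_def)
    \<comment> \<open>A local map keeps a trivial part at \<alpha> trivial, so the X components at
      \<alpha> vanish and \<open>const\<close> carries this to the reference party.\<close>
    have "pr N \<alpha> f = gzero" by (rule pel_eqI) (use f(2) in auto)
    then have "\<not> fst (?v f) (\<alpha>, k)" for k using u0 \<alpha> by (simp add: local_map_def)
    then show "f \<in> K q" using const[OF f(1) _ \<alpha>] f(1) by (simp add: K_iff)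
  qed
  then have "Sloc N M S \<subseteq> K q"
  proof (intro subsetI)
    fix f assume colocal: "\<And>\<alpha>. \<alpha> \<in> M \<Longrightarrow> colocal N S \<alpha> \<subseteq> K q" and "f \<in> Sloc N M S"
    then obtain h where "f = gsum M h" "\<forall>\<alpha>\<in>M. h \<alpha> \<in> colocal N S \<alpha>" unfolding Sloc_def by blast
    then show "f \<in> K q" using gsum_mem[OF K_sub M(1), of h q] colocal by blast
  qed
  then have "card (Sloc N M S) \<le> card (K q)" by (rule card_mono[OF K_fin])
  then have "2 ^ q * 2 ^ f2dim (Sloc N M S) \<le> (2 ^ f2dim S :: nat)"
    using card card_f2_subspace[OF Q sub] card_f2_subspace[OF Q Sloc_subspace(1)[OF M(1) sub, of N]] by simp
  then have "(2::nat) ^ (q + f2dim (Sloc N M S)) \<le> 2 ^ f2dim S" by (simp add: power_add)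
  then have "q + f2dim (Sloc N M S) \<le> f2dim S" by simp
  then show ?thesis by simp
qed

theorem theorem3:
  fixes M :: "'p set" and N :: "'p \<Rightarrow> nat"
    and \<psi> :: "('p \<times> nat \<Rightarrow> bool) \<Rightarrow> complex" and S :: "('p \<times> nat) pel set"
  assumes "finite M" and "card M \<ge> 3"
    and "stab_group (Qall N M) S \<psi>"
  shows "f2dim S - f2dim (Sloc N M S) = (\<Sum>\<alpha>\<in>M. N \<alpha>) - f2dim (Sloc N M S)
    \<and> extractable N M \<psi> (f2dim S - f2dim (Sloc N M S))
    \<and> (\<forall>q. extractable N M \<psi> q \<longrightarrow> q \<le> f2dim S - f2dim (Sloc N M S))"
proof (intro conjI allI impI)
  show "f2dim S - f2dim (Sloc N M S) = (\<Sum>\<alpha>\<in>M. N \<alpha>) - f2dim (Sloc N M S)"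
    using assms(3) by (simp add: stab_group_def card_Qall[OF assms(1)])
  show "extractable N M \<psi> (f2dim S - f2dim (Sloc N M S))"
    by (rule extractable_Delta[OF assms])
  have "M \<noteq> {}" using assms(2) by auto
  then show "q \<le> f2dim S - f2dim (Sloc N M S)" if "extractable N M \<psi> q" for q
    using extractable_le_Delta[OF assms(1) _ assms(3) that] by blast
qed

end
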